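(* For each integer $n\ge 2$, $$d_{SK}(OH_n)\ \ge\ \left[\frac{n}{2\sqrt{n-1}}\right]^{1/2}.$$
   Context: An operator space is a closed subspace $E\subset B(H)$, $H$ a complex Hilbert space, with the norms on $M_n(E)$ induced by $B(\ell_2^n(H))$. For linear $u:E\to F$, $\|u\|_{cb}=\sup_{n\ge1}\|I_{M_n}\otimes u\|_{M_n(E)\to M_n(F)}$. For operator spaces $E,F$, $d_{cb}(E,F)=\inf\{\|u\|_{cb}\|u^{-1}\|_{cb}\}$ over all isomorphisms $u:E\to F$ ($=\infty$ if there is no complete isomorphism). Let $K=K(\ell_2)$ be the space of compact operators on $\ell_2$, and $$d_{SK}(E)=\inf\{d_{cb}(E,F)\mid F\subset K\text{ a closed subspace}\};$$ for finite dimensional $E$ this equals $\inf\{d_{cb}(E,F)\mid F\subset M_k,\ k\ge1\}$. $OH_n$ denotes the $n$-dimensional operator Hilbert space: it is isometric to $\ell_2^n$ and has an orthonormal basis $(\theta_i)_{i\le n}$ such that for all $a_1,\dots,a_n\in B=B(\ell_2)$, $$\Big\|\sum_{i=1}^n\theta_i\otimes a_i\Big\|_{OH_n\otimes_{\min}B}=\Big\|\sum_{i=1}^n a_i\otimes\bar a_i\Big\|_{B\otimes_{\min}\overline{B}}^{1/2},$$ where $\overline{B}$ is the complex conjugate $C^*$-algebra of $B$ and $\otimes_{\min}$ is the minimal (spatial) tensor product. This determines $OH_n$ up to complete isometry. *)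

theory Defs
  imports "HOL-Analysis.Analysis"
begin

section \<open>Complex Hilbert spaces\<close>

text \<open>
  The inner product is antilinear in the first argument. Norm, metric and topology are those
  of the underlying real Hilbert space, whose inner product is the real part of the complex one.
\<close>

class complex_hilbert = real_inner + complete_space +
  fixes scaleC :: "complex \<Rightarrow> 'a \<Rightarrow> 'a" (infixr "*\<^sub>C" 75)
    and cinner :: "'a \<Rightarrow> 'a \<Rightarrow> complex"
  assumes scaleC_add_right: "c *\<^sub>C (x + y) = c *\<^sub>C x + c *\<^sub>C y"
    and scaleC_add_left: "(c + d) *\<^sub>C x = c *\<^sub>C x + d *\<^sub>C x"
    and scaleC_scaleC: "c *\<^sub>C d *\<^sub>C x = (c * d) *\<^sub>C x"
    and scaleC_of_real: "complex_of_real r *\<^sub>C x = r *\<^sub>R x"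
    and cinner_commute: "cinner x y = cnj (cinner y x)"
    and cinner_add_right: "cinner x (y + z) = cinner x y + cinner x z"
    and cinner_scaleC_right: "cinner x (c *\<^sub>C y) = c * cinner x y"
    and Re_cinner: "Re (cinner x y) = x \<bullet> y"

lemma norm_scaleC: "norm (c *\<^sub>C (x :: 'a::complex_hilbert)) = cmod c * norm x"
proof -
  have "cinner (c *\<^sub>C x) x = cnj c * cinner x x"
    by (metis cinner_commute cinner_scaleC_right complex_cnj_mult)
  then have "cinner (c *\<^sub>C x) (c *\<^sub>C x) = of_real ((cmod c)\<^sup>2) * cinner x x"
    by (simp only: cinner_scaleC_right complex_norm_square mult.assoc)
  then have "(c *\<^sub>C x) \<bullet> (c *\<^sub>C x) = (cmod c)\<^sup>2 * (x \<bullet> x)"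
    by (simp only: Re_cinner[symmetric] Re_complex_of_real Im_complex_of_real times_complex.sel)
  then show ?thesis
    by (simp add: norm_eq_sqrt_inner real_sqrt_mult)
qed

lemma bounded_linear_scaleC: "bounded_linear (scaleC c :: 'a::complex_hilbert \<Rightarrow> 'a)"
  by (rule bounded_linear_intro[where K = "cmod c"])
    (simp_all only: scaleC_add_right norm_scaleC mult.commute scaleC_scaleC scaleC_of_real[symmetric] order_refl)


subsection \<open>The space of square summable sequences\<close>

typedef ell2 = "{x :: nat \<Rightarrow> complex. summable (\<lambda>n. (cmod (x n))\<^sup>2)}"
  morphisms ell2_nth Abs_ell2
  by (rule exI[of _ "\<lambda>_. 0"]) simp

setup_lifting type_definition_ell2

lemma summable_ell2: "summable (\<lambda>n. (cmod (ell2_nth x n))\<^sup>2)"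
  using ell2_nth[of x] by simp

lemma sq_summable_add:
  assumes "summable (\<lambda>n. (cmod (x n))\<^sup>2)" "summable (\<lambda>n. (cmod (y n))\<^sup>2)"
  shows "summable (\<lambda>n. (cmod (x n + y n))\<^sup>2)"
proof (rule summable_comparison_test')
  show "summable (\<lambda>n. 2 * (cmod (x n))\<^sup>2 + 2 * (cmod (y n))\<^sup>2)"
    using assms by (intro summable_add summable_mult)
  fix n :: nat
  have "(cmod (x n + y n))\<^sup>2 \<le> (cmod (x n) + cmod (y n))\<^sup>2"
    by (intro power_mono norm_triangle_ineq) simp
  also have "\<dots> \<le> 2 * (cmod (x n))\<^sup>2 + 2 * (cmod (y n))\<^sup>2"
    using zero_le_power2[of "cmod (x n) - cmod (y n)"]
    by (simp add: power2_eq_square algebra_simps)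
  finally show "norm ((cmod (x n + y n))\<^sup>2) \<le> 2 * (cmod (x n))\<^sup>2 + 2 * (cmod (y n))\<^sup>2"
    by simp
qed

lemma sq_summable_mult:
  assumes "summable (\<lambda>n. (cmod (x n))\<^sup>2)"
  shows "summable (\<lambda>n. (cmod (c * x n))\<^sup>2)"
  using summable_mult[OF assms, of "(cmod c)\<^sup>2"] by (simp only: norm_mult power_mult_distrib)

lemma summable_ell2_prod: "summable (\<lambda>n. cnj (ell2_nth x n) * ell2_nth y n)"
proof (rule summable_comparison_test')
  show "summable (\<lambda>n. (cmod (ell2_nth x n))\<^sup>2 + (cmod (ell2_nth y n))\<^sup>2)"
    by (intro summable_add summable_ell2)
  fix n :: nat
  show "norm (cnj (ell2_nth x n) * ell2_nth y n)
      \<le> (cmod (ell2_nth x n))\<^sup>2 + (cmod (ell2_nth y n))\<^sup>2"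
    using zero_le_power2[of "cmod (ell2_nth x n) - cmod (ell2_nth y n)"]
      mult_nonneg_nonneg[OF norm_ge_zero[of "ell2_nth x n"] norm_ge_zero[of "ell2_nth y n"]]
    unfolding norm_mult complex_mod_cnj power2_diff by linarith
qed

instantiation ell2 :: real_inner
begin

lift_definition zero_ell2 :: ell2 is "\<lambda>_. 0" by simp
lift_definition plus_ell2 :: "ell2 \<Rightarrow> ell2 \<Rightarrow> ell2" is "\<lambda>x y n. x n + y n"
  by (rule sq_summable_add)
lift_definition uminus_ell2 :: "ell2 \<Rightarrow> ell2" is "\<lambda>x n. - x n" by simp
lift_definition minus_ell2 :: "ell2 \<Rightarrow> ell2 \<Rightarrow> ell2" is "\<lambda>x y n. x n - y n"
proof -
  fix x y :: "nat \<Rightarrow> complex"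
  assume "summable (\<lambda>n. (cmod (x n))\<^sup>2)" "summable (\<lambda>n. (cmod (y n))\<^sup>2)"
  then show "summable (\<lambda>n. (cmod (x n - y n))\<^sup>2)"
    using sq_summable_add[of x "\<lambda>n. - y n"] by simp
qed
lift_definition scaleR_ell2 :: "real \<Rightarrow> ell2 \<Rightarrow> ell2" is "\<lambda>r x n. of_real r * x n"
  by (rule sq_summable_mult)

definition inner_ell2 :: "ell2 \<Rightarrow> ell2 \<Rightarrow> real" where
  "inner_ell2 x y = Re (\<Sum>n. cnj (ell2_nth x n) * ell2_nth y n)"
definition norm_ell2 :: "ell2 \<Rightarrow> real" where
  "norm_ell2 x = sqrt (x \<bullet> x)"
definition dist_ell2 :: "ell2 \<Rightarrow> ell2 \<Rightarrow> real" where
  "dist_ell2 x y = norm (x - y)"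
definition sgn_ell2 :: "ell2 \<Rightarrow> ell2" where
  "sgn_ell2 x = inverse (norm x) *\<^sub>R x"
definition uniformity_ell2 :: "(ell2 \<times> ell2) filter" where
  "uniformity_ell2 = (INF e\<in>{0<..}. principal {(x, y). dist x y < e})"
definition open_ell2 :: "ell2 set \<Rightarrow> bool" where
  "open_ell2 U \<longleftrightarrow> (\<forall>x\<in>U. eventually (\<lambda>(x', y). x' = x \<longrightarrow> y \<in> U) uniformity)"

lemma inner_ell2_self: "x \<bullet> x = (\<Sum>n. (cmod (ell2_nth x n))\<^sup>2)" for x :: ell2
proof -
  have "Re (\<Sum>n. cnj (ell2_nth x n) * ell2_nth x n) = (\<Sum>n. Re (cnj (ell2_nth x n) * ell2_nth x n))"
    by (rule bounded_linear.suminf[OF bounded_linear_Re summable_ell2_prod])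
  then show ?thesis
    by (simp add: inner_ell2_def cmod_power2 flip: power2_eq_square)
qed

instance
proof
  fix x y z :: ell2 and r s :: real
  show "x + y + z = x + (y + z)" "x + y = y + x" "0 + x = x" "- x + x = 0" "x - y = x + - y"
    "r *\<^sub>R (x + y) = r *\<^sub>R x + r *\<^sub>R y" "(r + s) *\<^sub>R x = r *\<^sub>R x + s *\<^sub>R x"
    "r *\<^sub>R s *\<^sub>R x = (r * s) *\<^sub>R x" "1 *\<^sub>R x = x"
    by (transfer; simp add: algebra_simps)+
  show "dist x y = norm (x - y)" "sgn x = inverse (norm x) *\<^sub>R x" "norm x = sqrt (x \<bullet> x)"
    by (simp_all add: dist_ell2_def sgn_ell2_def norm_ell2_def)
  show "uniformity = (INF e\<in>{0<..}. principal {(x, y :: ell2). dist x y < e})"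
    by (rule uniformity_ell2_def)
  show "open U \<longleftrightarrow> (\<forall>x\<in>U. eventually (\<lambda>(x', y). x' = x \<longrightarrow> y \<in> U) uniformity)" for U :: "ell2 set"
    by (rule open_ell2_def)
  have "(\<Sum>n. cnj (ell2_nth x n) * ell2_nth y n) = cnj (\<Sum>n. cnj (ell2_nth y n) * ell2_nth x n)"
    using bounded_linear.suminf[OF bounded_linear_cnj summable_ell2_prod[of y x]]
    by (simp add: mult.commute)
  then show "x \<bullet> y = y \<bullet> x"
    by (simp add: inner_ell2_def)
  show "(x + y) \<bullet> z = x \<bullet> z + y \<bullet> z"
    by (simp add: inner_ell2_def plus_ell2.rep_eq distrib_right
        suminf_add[OF summable_ell2_prod summable_ell2_prod, symmetric])
  show "(r *\<^sub>R x) \<bullet> y = r * (x \<bullet> y)"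
    using suminf_mult[OF summable_ell2_prod[of x y], of "of_real r"]
    by (simp add: inner_ell2_def scaleR_ell2.rep_eq mult.assoc)
  show "0 \<le> x \<bullet> x"
    by (simp add: inner_ell2_self suminf_nonneg summable_ell2)
  show "x \<bullet> x = 0 \<longleftrightarrow> x = 0"
    by (simp add: inner_ell2_self suminf_eq_zero_iff summable_ell2)
      (transfer, auto)
qed

end

lemma norm_ell2_sq: "(norm x)\<^sup>2 = (\<Sum>n. (cmod (ell2_nth x n))\<^sup>2)" for x :: ell2
  by (simp add: power2_norm_eq_inner inner_ell2_self)

lemma sum_le_norm_ell2: "(\<Sum>n<N. (cmod (ell2_nth x n))\<^sup>2) \<le> (norm x)\<^sup>2"
  unfolding norm_ell2_sq by (rule sum_le_suminf) (simp_all add: summable_ell2)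

lemma cmod_ell2_nth_le: "cmod (ell2_nth x n) \<le> norm x"
proof -
  have "(cmod (ell2_nth x n))\<^sup>2 \<le> (\<Sum>k<Suc n. (cmod (ell2_nth x k))\<^sup>2)"
    by (rule member_le_sum[where f = "\<lambda>k. (cmod (ell2_nth x k))\<^sup>2"]) simp_all
  also have "\<dots> \<le> (norm x)\<^sup>2"
    by (rule sum_le_norm_ell2)
  finally show ?thesis
    by (rule power2_le_imp_le) (rule norm_ge_zero)
qed

instantiation ell2 :: complex_hilbert
begin

lift_definition scaleC_ell2 :: "complex \<Rightarrow> ell2 \<Rightarrow> ell2" is "\<lambda>c x n. c * x n"
  by (rule sq_summable_mult)

definition cinner_ell2 :: "ell2 \<Rightarrow> ell2 \<Rightarrow> complex" where
  "cinner_ell2 x y = (\<Sum>n. cnj (ell2_nth x n) * ell2_nth y n)"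

instance
proof
  fix X :: "nat \<Rightarrow> ell2"
  assume X: "Cauchy X"
  have nth_diff: "ell2_nth (x - y) n = ell2_nth x n - ell2_nth y n" for x y n
    by (simp add: minus_ell2.rep_eq)
  have "Cauchy (\<lambda>m. ell2_nth (X m) n)" for n
  proof (rule metric_CauchyI)
    fix e :: real assume "e > 0"
    then obtain M where M: "\<And>m k. m \<ge> M \<Longrightarrow> k \<ge> M \<Longrightarrow> dist (X m) (X k) < e"
      using metric_CauchyD[OF X] by blast
    have "dist (ell2_nth (X m) n) (ell2_nth (X k) n) < e" if "m \<ge> M" "k \<ge> M" for m k
      using M[OF that] cmod_ell2_nth_le[of "X m - X k" n]
      by (simp add: dist_norm nth_diff)
    then show "\<exists>M. \<forall>m\<ge>M. \<forall>k\<ge>M. dist (ell2_nth (X m) n) (ell2_nth (X k) n) < e"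
      by blast
  qed
  then have "\<exists>l. (\<lambda>m. ell2_nth (X m) n) \<longlonglongrightarrow> l" for n
    by (simp add: Cauchy_convergent_iff convergent_def)
  then obtain x where x: "\<And>n. (\<lambda>m. ell2_nth (X m) n) \<longlonglongrightarrow> x n"
    by metis
  have tail: "\<exists>M. \<forall>m\<ge>M. \<forall>N. (\<Sum>n<N. (cmod (ell2_nth (X m) n - x n))\<^sup>2) \<le> e\<^sup>2"
    if "e > 0" for e
  proof -
    obtain M where M: "\<And>m k. m \<ge> M \<Longrightarrow> k \<ge> M \<Longrightarrow> dist (X m) (X k) < e"
      using metric_CauchyD[OF X \<open>e > 0\<close>] by blast
    have "(\<Sum>n<N. (cmod (ell2_nth (X m) n - x n))\<^sup>2) \<le> e\<^sup>2" if "m \<ge> M" for m N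
    proof (rule tendsto_upperbound)
      show "(\<lambda>k. \<Sum>n<N. (cmod (ell2_nth (X m) n - ell2_nth (X k) n))\<^sup>2)
          \<longlonglongrightarrow> (\<Sum>n<N. (cmod (ell2_nth (X m) n - x n))\<^sup>2)"
        by (intro tendsto_intros x)
      have "(\<Sum>n<N. (cmod (ell2_nth (X m) n - ell2_nth (X k) n))\<^sup>2) \<le> e\<^sup>2" if "k \<ge> M" for k
      proof -
        have "(norm (X m - X k))\<^sup>2 \<le> e\<^sup>2"
          using M[OF \<open>m \<ge> M\<close> that] by (intro power_mono) (auto simp: dist_norm)
        then show ?thesis
          using sum_le_norm_ell2[of "X m - X k" N] by (simp add: nth_diff)
      qed
      then show "\<forall>\<^sub>F k in sequentially.
          (\<Sum>n<N. (cmod (ell2_nth (X m) n - ell2_nth (X k) n))\<^sup>2) \<le> e\<^sup>2"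
        by (auto simp: eventually_sequentially)
    qed simp
    then show ?thesis by blast
  qed
  have sm: "summable (\<lambda>n. (cmod (ell2_nth (X m) n - x n))\<^sup>2)"
    if "\<forall>N. (\<Sum>n<N. (cmod (ell2_nth (X m) n - x n))\<^sup>2) \<le> e\<^sup>2" for m and e :: real
    by (rule summableI_nonneg_bounded[where x = "e\<^sup>2"]) (use that in simp_all)
  obtain M where "\<forall>m\<ge>M. \<forall>N. (\<Sum>n<N. (cmod (ell2_nth (X m) n - x n))\<^sup>2) \<le> 1\<^sup>2"
    using tail[OF zero_less_one] by blast
  then have "summable (\<lambda>n. (cmod (ell2_nth (X M) n - x n))\<^sup>2)"
    using sm[of M 1] by blast
  then have "summable (\<lambda>n. (cmod (ell2_nth (X M) n + - (ell2_nth (X M) n - x n)))\<^sup>2)"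
    by (intro sq_summable_add summable_ell2) (simp only: norm_minus_cancel)
  then have nth_x: "ell2_nth (Abs_ell2 x) = x"
    by (simp add: Abs_ell2_inverse)
  have "X \<longlonglongrightarrow> Abs_ell2 x"
  proof (rule metric_LIMSEQ_I)
    fix e :: real assume "e > 0"
    then obtain M where M: "\<forall>m\<ge>M. \<forall>N. (\<Sum>n<N. (cmod (ell2_nth (X m) n - x n))\<^sup>2) \<le> (e / 2)\<^sup>2"
      using tail[OF half_gt_zero] by blast
    have "dist (X m) (Abs_ell2 x) < e" if "m \<ge> M" for m
    proof -
      have "(norm (X m - Abs_ell2 x))\<^sup>2 \<le> (e / 2)\<^sup>2"
        unfolding norm_ell2_sq nth_diff nth_x
        using M that by (intro suminf_le_const sm[where e = "e / 2"]) blast+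
      then have "norm (X m - Abs_ell2 x) \<le> e / 2"
        by (rule power2_le_imp_le) (use \<open>e > 0\<close> in simp)
      then show ?thesis
        using \<open>e > 0\<close> by (simp add: dist_norm)
    qed
    then show "\<exists>M. \<forall>m\<ge>M. dist (X m) (Abs_ell2 x) < e" by blast
  qed
  then show "convergent X" by (rule convergentI)
next
  fix x y z :: ell2 and c d :: complex and r :: real
  show "c *\<^sub>C (x + y) = c *\<^sub>C x + c *\<^sub>C y" "(c + d) *\<^sub>C x = c *\<^sub>C x + d *\<^sub>C x"
    "c *\<^sub>C d *\<^sub>C x = (c * d) *\<^sub>C x" "complex_of_real r *\<^sub>C x = r *\<^sub>R x"
    by (transfer; simp add: algebra_simps)+
  show "cinner x y = cnj (cinner y x)"
    using bounded_linear.suminf[OF bounded_linear_cnj summable_ell2_prod[of y x]]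
    by (simp add: cinner_ell2_def mult.commute)
  show "cinner x (y + z) = cinner x y + cinner x z"
    by (simp add: cinner_ell2_def plus_ell2.rep_eq distrib_left
        suminf_add[OF summable_ell2_prod summable_ell2_prod, symmetric])
  show "cinner x (c *\<^sub>C y) = c * cinner x y"
    using suminf_mult[OF summable_ell2_prod[of x y], of c]
    by (simp add: cinner_ell2_def scaleC_ell2.rep_eq mult.left_commute)
  show "Re (cinner x y) = x \<bullet> y"
    by (simp add: cinner_ell2_def inner_ell2_def)
qed

end


subsection \<open>The complex conjugate of a Hilbert space\<close>

typedef 'a cconj = "UNIV :: 'a set"
  morphisms of_cconj to_cconj by simp

setup_lifting type_definition_cconj

instantiation cconj :: (complex_hilbert) real_inner
begin

lift_definition zero_cconj :: "'a cconj" is 0 .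
lift_definition plus_cconj :: "'a cconj \<Rightarrow> 'a cconj \<Rightarrow> 'a cconj" is "(+)" .
lift_definition uminus_cconj :: "'a cconj \<Rightarrow> 'a cconj" is uminus .
lift_definition minus_cconj :: "'a cconj \<Rightarrow> 'a cconj \<Rightarrow> 'a cconj" is "(-)" .
lift_definition scaleR_cconj :: "real \<Rightarrow> 'a cconj \<Rightarrow> 'a cconj" is scaleR .
lift_definition inner_cconj :: "'a cconj \<Rightarrow> 'a cconj \<Rightarrow> real" is inner .
lift_definition norm_cconj :: "'a cconj \<Rightarrow> real" is norm .
lift_definition dist_cconj :: "'a cconj \<Rightarrow> 'a cconj \<Rightarrow> real" is dist .
lift_definition sgn_cconj :: "'a cconj \<Rightarrow> 'a cconj" is sgn .

definition uniformity_cconj :: "('a cconj \<times> 'a cconj) filter" where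
  "uniformity_cconj = (INF e\<in>{0<..}. principal {(x, y). dist x y < e})"
definition open_cconj :: "'a cconj set \<Rightarrow> bool" where
  "open_cconj U \<longleftrightarrow> (\<forall>x\<in>U. eventually (\<lambda>(x', y). x' = x \<longrightarrow> y \<in> U) uniformity)"

instance
proof
  fix x y z :: "'a cconj" and r s :: real
  show "x + y + z = x + (y + z)" "x + y = y + x" "0 + x = x" "- x + x = 0" "x - y = x + - y"
    "r *\<^sub>R (x + y) = r *\<^sub>R x + r *\<^sub>R y" "(r + s) *\<^sub>R x = r *\<^sub>R x + s *\<^sub>R x"
    "r *\<^sub>R s *\<^sub>R x = (r * s) *\<^sub>R x" "1 *\<^sub>R x = x"
    by (transfer; simp add: algebra_simps)+
  show "dist x y = norm (x - y)"
    by (transfer) (rule dist_norm)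
  show "sgn x = inverse (norm x) *\<^sub>R x"
    by (transfer) (rule sgn_div_norm)
  show "norm x = sqrt (x \<bullet> x)"
    by (transfer) (rule norm_eq_sqrt_inner)
  show "uniformity = (INF e\<in>{0<..}. principal {(x, y :: 'a cconj). dist x y < e})"
    by (rule uniformity_cconj_def)
  show "open U \<longleftrightarrow> (\<forall>x\<in>U. eventually (\<lambda>(x', y). x' = x \<longrightarrow> y \<in> U) uniformity)" for U :: "'a cconj set"
    by (rule open_cconj_def)
  show "x \<bullet> y = y \<bullet> x"
    by (transfer) (rule inner_commute)
  show "(x + y) \<bullet> z = x \<bullet> z + y \<bullet> z" "(r *\<^sub>R x) \<bullet> y = r * (x \<bullet> y)" "0 \<le> x \<bullet> x"
    "x \<bullet> x = 0 \<longleftrightarrow> x = 0"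
    by (transfer; simp add: inner_add_left)+
qed

end

instantiation cconj :: (complex_hilbert) complex_hilbert
begin

lift_definition scaleC_cconj :: "complex \<Rightarrow> 'a cconj \<Rightarrow> 'a cconj" is "\<lambda>c x. cnj c *\<^sub>C x" .
lift_definition cinner_cconj :: "'a cconj \<Rightarrow> 'a cconj \<Rightarrow> complex" is "\<lambda>x y. cnj (cinner x y)" .

instance
proof
  fix X :: "nat \<Rightarrow> 'a cconj"
  assume "Cauchy X"
  then have "Cauchy (\<lambda>n. of_cconj (X n))"
    by (simp add: Cauchy_def dist_cconj.rep_eq)
  then obtain l where "(\<lambda>n. of_cconj (X n)) \<longlonglongrightarrow> l"
    by (auto simp: Cauchy_convergent_iff convergent_def)
  then have "X \<longlonglongrightarrow> to_cconj l"
    by (simp add: lim_sequentially dist_cconj.rep_eq to_cconj_inverse)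
  then show "convergent X" by (rule convergentI)
next
  fix x y z :: "'a cconj" and c d :: complex and r :: real
  show "c *\<^sub>C (x + y) = c *\<^sub>C x + c *\<^sub>C y" "(c + d) *\<^sub>C x = c *\<^sub>C x + d *\<^sub>C x"
    "c *\<^sub>C d *\<^sub>C x = (c * d) *\<^sub>C x" "complex_of_real r *\<^sub>C x = r *\<^sub>R x"
    by (transfer; simp add: scaleC_add_left scaleC_add_right scaleC_scaleC scaleC_of_real)+
  show "cinner x y = cnj (cinner y x)"
    by (transfer) (metis cinner_commute)
  show "cinner x (y + z) = cinner x y + cinner x z" "cinner x (c *\<^sub>C y) = c * cinner x y"
    "Re (cinner x y) = x \<bullet> y"
    by (transfer; simp add: cinner_add_right cinner_scaleC_right Re_cinner)+
qed

end


section \<open>Operators\<close>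

text \<open>
  The library type of bounded operators only demands real linearity; its norm is the operator
  norm. The set \<open>bop\<close> is the space of bounded complex linear operators.
\<close>

definition bop :: "('a::complex_hilbert \<Rightarrow>\<^sub>L 'a) set" where
  "bop = {T. \<forall>c x. blinfun_apply T (c *\<^sub>C x) = c *\<^sub>C blinfun_apply T x}"

definition compact_ops :: "('a::complex_hilbert \<Rightarrow>\<^sub>L 'a) set" where
  "compact_ops = {T \<in> bop. compact (closure (blinfun_apply T ` cball 0 1))}"

lift_definition scale_op :: "complex \<Rightarrow> ('a::complex_hilbert \<Rightarrow>\<^sub>L 'a) \<Rightarrow> ('a \<Rightarrow>\<^sub>L 'a)"
  is "\<lambda>c T x. c *\<^sub>C T x"
  by (rule bounded_linear_compose[OF bounded_linear_scaleC])

lemma of_cconj_bounded_linear: "bounded_linear (of_cconj :: 'a::complex_hilbert cconj \<Rightarrow> 'a)"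
  by (rule bounded_linear_intro[where K = 1])
    (simp_all add: plus_cconj.rep_eq scaleR_cconj.rep_eq norm_cconj.rep_eq)

lemma to_cconj_bounded_linear: "bounded_linear (to_cconj :: 'a::complex_hilbert \<Rightarrow> 'a cconj)"
  by (rule bounded_linear_intro[where K = 1])
    (simp_all add: plus_cconj.abs_eq scaleR_cconj.abs_eq norm_cconj.abs_eq)

text \<open>
  The conjugate C*-algebra of the bounded operators on a Hilbert space is the algebra of bounded
  operators on the conjugate Hilbert space, the conjugate of \<open>T\<close> acting as the same map.
\<close>

lift_definition conj_op ::
    "('a::complex_hilbert \<Rightarrow>\<^sub>L 'a) \<Rightarrow> ('a cconj \<Rightarrow>\<^sub>L 'a cconj)"
  is "\<lambda>T x. to_cconj (T (of_cconj x))"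
  by (intro bounded_linear_compose[OF to_cconj_bounded_linear]
      bounded_linear_compose[OF _ of_cconj_bounded_linear])

lemma conj_op_bop: "T \<in> bop \<Longrightarrow> conj_op T \<in> bop"
  by (simp add: bop_def conj_op.rep_eq scaleC_cconj.rep_eq scaleC_cconj.abs_eq)


section \<open>Minimal tensor norm\<close>

text \<open>
  A list \<open>[(h\<^sub>1, k\<^sub>1), \<dots>]\<close> stands for the element \<open>\<Sum>\<^sub>j h\<^sub>j \<otimes> k\<^sub>j\<close> of the algebraic tensor product,
  and \<open>tensor_norm\<close> is its norm in the Hilbert space tensor product. Since the algebraic tensor
  product is dense there, \<open>min_norm [(a\<^sub>1, b\<^sub>1), \<dots>]\<close> is the operator norm of \<open>\<Sum>\<^sub>i a\<^sub>i \<otimes> b\<^sub>i\<close> on the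
  Hilbert space tensor product. For \<open>a\<^sub>i, b\<^sub>i \<in> bop\<close> the set whose supremum is taken is bounded by
  \<open>\<Sum>\<^sub>i norm a\<^sub>i * norm b\<^sub>i\<close>.
\<close>

definition tensor_norm :: "('a::complex_hilbert \<times> 'b::complex_hilbert) list \<Rightarrow> real" where
  "tensor_norm v =
     sqrt (Re (\<Sum>(h, k)\<leftarrow>v. \<Sum>(h', k')\<leftarrow>v. cinner h h' * cinner k k'))"

definition tensor_apply ::
  "(('a::complex_hilbert \<Rightarrow>\<^sub>L 'a) \<times> ('b::complex_hilbert \<Rightarrow>\<^sub>L 'b)) list
    \<Rightarrow> ('a \<times> 'b) list \<Rightarrow> ('a \<times> 'b) list" where
  "tensor_apply t v = [(blinfun_apply a h, blinfun_apply b k). (a, b) \<leftarrow> t, (h, k) \<leftarrow> v]"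

definition min_norm ::
  "(('a::complex_hilbert \<Rightarrow>\<^sub>L 'a) \<times> ('b::complex_hilbert \<Rightarrow>\<^sub>L 'b)) list \<Rightarrow> real" where
  "min_norm t = Sup {tensor_norm (tensor_apply t v) |v. tensor_norm v \<le> 1}"


section \<open>Operator spaces\<close>

definition operator_space :: "('a::complex_hilbert \<Rightarrow>\<^sub>L 'a) set \<Rightarrow> bool" where
  "operator_space E \<longleftrightarrow>
     E \<subseteq> bop \<and> subspace E \<and> (\<forall>c. \<forall>T\<in>E. scale_op c T \<in> E) \<and> closed E"

text \<open>The norm of the matrix \<open>(x i j)\<close>, \<open>i, j < k\<close>, as an operator on the \<open>k\<close>-fold Hilbert sum.\<close>

definition mat_norm :: "nat \<Rightarrow> (nat \<Rightarrow> nat \<Rightarrow> 'a::complex_hilbert \<Rightarrow>\<^sub>L 'a) \<Rightarrow> real" where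
  "mat_norm k x =
     Sup {sqrt (\<Sum>i<k. (norm (\<Sum>j<k. blinfun_apply (x i j) (h j)))\<^sup>2) |h. (\<Sum>j<k. (norm (h j))\<^sup>2) \<le> 1}"

definition cb_norm ::
  "('a::complex_hilbert \<Rightarrow>\<^sub>L 'a) set \<Rightarrow> (('a \<Rightarrow>\<^sub>L 'a) \<Rightarrow> ('b::complex_hilbert \<Rightarrow>\<^sub>L 'b)) \<Rightarrow> ennreal" where
  "cb_norm E u =
     (SUP k\<in>{1..}. SUP x\<in>{x. (\<forall>i<k. \<forall>j<k. x i j \<in> E) \<and> mat_norm k x \<le> 1}.
        ennreal (mat_norm k (\<lambda>i j. u (x i j))))"

definition linear_iso ::
  "('a::complex_hilbert \<Rightarrow>\<^sub>L 'a) set \<Rightarrow> ('b::complex_hilbert \<Rightarrow>\<^sub>L 'b) set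
    \<Rightarrow> (('a \<Rightarrow>\<^sub>L 'a) \<Rightarrow> ('b \<Rightarrow>\<^sub>L 'b)) \<Rightarrow> bool" where
  "linear_iso E F u \<longleftrightarrow>
     bij_betw u E F \<and> (\<forall>S\<in>E. \<forall>T\<in>E. u (S + T) = u S + u T) \<and>
     (\<forall>c. \<forall>T\<in>E. u (scale_op c T) = scale_op c (u T))"

definition d_cb ::
  "('a::complex_hilbert \<Rightarrow>\<^sub>L 'a) set \<Rightarrow> ('b::complex_hilbert \<Rightarrow>\<^sub>L 'b) set \<Rightarrow> ennreal" where
  "d_cb E F = (INF u\<in>{u. linear_iso E F u}. cb_norm E u * cb_norm F (inv_into E u))"

definition d_SK :: "('a::complex_hilbert \<Rightarrow>\<^sub>L 'a) set \<Rightarrow> ennreal" where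
  "d_SK E = (INF F\<in>{F :: (ell2 \<Rightarrow>\<^sub>L ell2) set. operator_space F \<and> F \<subseteq> compact_ops}. d_cb E F)"


section \<open>The operator Hilbert space\<close>

text \<open>
  \<open>is_OH n E\<close>: the concretely represented operator space \<open>E\<close> is (a copy of) the \<open>n\<close>-dimensional
  operator Hilbert space.
\<close>

definition is_OH :: "nat \<Rightarrow> ('a::complex_hilbert \<Rightarrow>\<^sub>L 'a) set \<Rightarrow> bool" where
  "is_OH n E \<longleftrightarrow> operator_space E \<and>
     (\<exists>\<theta> :: nat \<Rightarrow> 'a \<Rightarrow>\<^sub>L 'a.
        E = range (\<lambda>c. \<Sum>i<n. scale_op (c i) (\<theta> i)) \<and>
        (\<forall>c. norm (\<Sum>i<n. scale_op (c i) (\<theta> i)) = sqrt (\<Sum>i<n. (cmod (c i))\<^sup>2)) \<and>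
        (\<forall>a :: nat \<Rightarrow> ell2 \<Rightarrow>\<^sub>L ell2. (\<forall>i<n. a i \<in> bop) \<longrightarrow>
           min_norm (map (\<lambda>i. (\<theta> i, a i)) [0..<n]) =
           sqrt (min_norm (map (\<lambda>i. (a i, conj_op (a i))) [0..<n]))))"

end

theory Submission
  imports Defs
begin

text \<open>
  Let \<open>u\<close> be an isomorphism of \<open>OH\<^sub>n\<close> onto a space of compact operators, \<open>x\<^sub>i = u \<theta>\<^sub>i\<close>. The generators
  \<open>\<lambda>(g\<^sub>i)\<close> of the regular representation of the free product of \<open>n\<close> groups of order two satisfy
  \<open>\<parallel>\<Sum>\<^sub>i \<lambda>(g\<^sub>i) \<otimes> cnj \<lambda>(g\<^sub>i)\<parallel> \<le> 2 \<surd>(n - 1)\<close> (the spectral radius of the \<open>n\<close>-regular tree), so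
  \<open>\<parallel>\<Sum>\<^sub>i x\<^sub>i \<otimes> \<lambda>(g\<^sub>i)\<parallel>\<close> is at most \<open>\<parallel>u\<parallel>\<^sub>c\<^sub>b (2 \<surd>(n - 1))\<^sup>1\<^sup>/\<^sup>2\<close>. After replacing the \<open>x\<^sub>i\<close> by matrices,
  let permutation matrices \<open>u\<^sub>i\<close> of a finite quotient of large girth take the place of \<open>\<lambda>(g\<^sub>i)\<close>. A
  moment comparison shows that \<open>\<Sum>\<^sub>i x\<^sub>i \<otimes> u\<^sub>i\<close> exceeds the above bound only on a subspace of small
  relative dimension, and because the \<open>x\<^sub>i\<close> have a fixed size this subspace is removed by a
  projection \<open>q\<close> of almost full rank acting on the second factor only. For \<open>a\<^sub>i = q u\<^sub>i\<close> the norm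
  \<open>\<parallel>\<Sum>\<^sub>i a\<^sub>i \<otimes> cnj a\<^sub>i\<parallel>\<close> is at least the normalized trace of \<open>\<Sum>\<^sub>i a\<^sub>i a\<^sub>i\<^sup>*\<close>, which is almost \<open>n\<close>; applying
  the inverse of \<open>u\<close> to \<open>\<Sum>\<^sub>i x\<^sub>i \<otimes> a\<^sub>i\<close> gives the inequality.
\<close>

section \<open>Orthonormal systems\<close>

text \<open>Behind the bound are two values of the norm of \<Sum> v_i \<otimes> cnj v_i. It is n for
  unitary matrices v_i, since each v_i \<otimes> cnj v_i fixes the maximally entangled vector, but 2
  sqrt(n - 1) for the regular representation, where no such vector exists. The norm of OH is the
  square root of such a quantity, hence the outer square root. Matrices x_i of a fixed size k can
  hardly tell the two cases apart, because they meet the unitaries mainly through moments. The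
  obstacle is that moments control traces and not norms: permutation matrices share a fixed vector,
  so \<Sum> x_i \<otimes> u_i may keep a few large singular values. A projection on the whole tensor
  product would remove them but destroy the form \<Sum> x_i \<otimes> a_i. A projection on the
  second factor preserves it, at the cost of multiplying the removed dimension by k. This is
  affordable because k is fixed before the number of moments, and with it the size of the
  permutations, is chosen. Balls of the tree replace the regular representation throughout, so all
  scalar coefficients are finite matrices.\<close>

lemma cinner_add_left: "cinner (x + y) z = cinner x z + cinner y z"
  for x y z :: "'a::complex_hilbert"
  by (metis cinner_commute cinner_add_right complex_cnj_add)

lemma cinner_scaleC_left: "cinner (c *\<^sub>C x) y = cnj c * cinner x y"
  for x y :: "'a::complex_hilbert"
  by (metis cinner_commute cinner_scaleC_right complex_cnj_mult)

lemma cinner_zero_right [simp]: "cinner x 0 = 0" for x :: "'a::complex_hilbert"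
  using cinner_add_right[of x 0 0] by simp

lemma cinner_zero_left [simp]: "cinner 0 x = 0" for x :: "'a::complex_hilbert"
  using cinner_add_left[of 0 0 x] by simp

lemma cinner_diff_right: "cinner x (y - z) = cinner x y - cinner x z"
  for x y z :: "'a::complex_hilbert"
  using cinner_add_right[of x "y - z" z] by simp

lemma cinner_diff_left: "cinner (x - y) z = cinner x z - cinner y z"
  for x y z :: "'a::complex_hilbert"
  using cinner_add_left[of "x - y" y z] by simp

lemma cinner_sum_right: "cinner x (\<Sum>i\<in>I. f i) = (\<Sum>i\<in>I. cinner x (f i))"
  for x :: "'a::complex_hilbert"
  by (induction I rule: infinite_finite_induct) (simp_all add: cinner_add_right)

lemma cinner_sum_left: "cinner (\<Sum>i\<in>I. f i) x = (\<Sum>i\<in>I. cinner (f i) x)"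
  for x :: "'a::complex_hilbert"
  by (induction I rule: infinite_finite_induct) (simp_all add: cinner_add_left)

lemma cinner_eq_zero_commute: "cinner x y = 0 \<longleftrightarrow> cinner y x = 0" for x y :: "'a::complex_hilbert"
  using cinner_commute[of x y] by simp

lemma cinner_self: "cinner x x = of_real ((norm x)\<^sup>2)" for x :: "'a::complex_hilbert"
proof (rule complex_eqI)
  show "Re (cinner x x) = Re (of_real ((norm x)\<^sup>2))"
    by (simp add: Re_cinner power2_norm_eq_inner)
  have "Im (cinner x x) = - Im (cinner x x)"
    using arg_cong[OF cinner_commute[of x x], of Im] by simp
  then show "Im (cinner x x) = Im (of_real ((norm x)\<^sup>2))" by simp
qed

lemma scaleC_one [simp]: "1 *\<^sub>C x = x" for x :: "'a::complex_hilbert"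
  using scaleC_of_real[of 1 x] by simp

lemma scaleC_zero_left [simp]: "0 *\<^sub>C x = 0" for x :: "'a::complex_hilbert"
  using scaleC_of_real[of 0 x] by simp

lemma scaleC_zero_right [simp]: "c *\<^sub>C 0 = 0" for c :: complex
  using scaleC_add_right[of c 0 0] by simp

lemma scaleC_sum_right: "c *\<^sub>C (\<Sum>i\<in>I. f i) = (\<Sum>i\<in>I. c *\<^sub>C f i)"
  for f :: "_ \<Rightarrow> 'a::complex_hilbert"
  by (induction I rule: infinite_finite_induct) (simp_all add: scaleC_add_right)

lemma scaleC_sum_left: "(\<Sum>i\<in>I. f i) *\<^sub>C x = (\<Sum>i\<in>I. f i *\<^sub>C x)"
  for x :: "'a::complex_hilbert"
  by (induction I rule: infinite_finite_induct) (simp_all add: scaleC_add_left)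

section \<open>Finite orthonormal systems, Bessel's inequality and Gram-Schmidt\<close>

definition corthonormal :: "'a::complex_hilbert set \<Rightarrow> bool" where
  "corthonormal B \<longleftrightarrow> finite B \<and> (\<forall>f\<in>B. \<forall>g\<in>B. cinner f g = (if f = g then 1 else 0))"

text \<open>Membership in the span of \<open>B\<close>, encoded by the expansion itself. Finite
  dimensional subspaces of a Hilbert space enter the proof only as finite orthonormal sets, so their
  dimensions are cardinalities.\<close>

definition cexpands :: "'a::complex_hilbert set \<Rightarrow> 'a \<Rightarrow> bool" where
  "cexpands B x \<longleftrightarrow> x = (\<Sum>f\<in>B. cinner f x *\<^sub>C f)"

lemma corthonormal_coeff:
  assumes "corthonormal B" "f \<in> B"
  shows "cinner f (\<Sum>g\<in>B. c g *\<^sub>C g) = c f"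
proof -
  have "cinner f (\<Sum>g\<in>B. c g *\<^sub>C g) = (\<Sum>g\<in>B. if f = g then c g else 0)"
    unfolding cinner_sum_right cinner_scaleC_right
    using assms by (intro sum.cong) (auto simp: corthonormal_def)
  then show ?thesis using assms by (simp add: corthonormal_def)
qed

lemma norm_corthonormal_sum:
  assumes "corthonormal B"
  shows "(norm (\<Sum>g\<in>B. c g *\<^sub>C g))\<^sup>2 = (\<Sum>g\<in>B. (cmod (c g))\<^sup>2)"
proof -
  have "cinner (\<Sum>g\<in>B. c g *\<^sub>C g) (\<Sum>g\<in>B. c g *\<^sub>C g) = (\<Sum>g\<in>B. cnj (c g) * c g)"
    unfolding cinner_sum_left[of "\<lambda>g. c g *\<^sub>C g"] cinner_scaleC_left
    using assms by (intro sum.cong) (simp_all add: corthonormal_coeff)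
  also have "\<dots> = of_real (\<Sum>g\<in>B. (cmod (c g))\<^sup>2)"
    by (simp add: complex_norm_square mult.commute del: of_real_power)
  finally show ?thesis
    unfolding cinner_self of_real_eq_iff .
qed

lemma cexpands_norm:
  assumes "corthonormal B" "cexpands B x"
  shows "(norm x)\<^sup>2 = (\<Sum>g\<in>B. (cmod (cinner g x))\<^sup>2)"
  using norm_corthonormal_sum[OF assms(1), of "\<lambda>g. cinner g x"] assms(2)
  unfolding cexpands_def by simp

lemma cexpands_sum: "corthonormal B \<Longrightarrow> cexpands B (\<Sum>g\<in>B. c g *\<^sub>C g)"
  unfolding cexpands_def by (intro sum.cong refl) (simp add: corthonormal_coeff)

lemma cinner_cexpands:
  assumes "cexpands B y"
  shows "cinner x y = (\<Sum>g\<in>B. cinner x g * cinner g y)"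
proof -
  have "cinner x y = cinner x (\<Sum>g\<in>B. cinner g y *\<^sub>C g)"
    using assms by (simp add: cexpands_def)
  then show ?thesis
    by (simp add: cinner_sum_right cinner_scaleC_right mult.commute)
qed

lemma cexpands_orthogonal:
  assumes "cexpands B y" "\<forall>f\<in>B. cinner f x = 0"
  shows "cinner x y = 0"
proof -
  have "cinner x f = 0" if "f \<in> B" for f
    using assms(2) that cinner_eq_zero_commute by blast
  then show ?thesis
    using cinner_cexpands[OF assms(1), of x] by simp
qed

lemma corthonormal_residual:
  assumes "corthonormal B" "f \<in> B"
  shows "cinner f (x - (\<Sum>g\<in>B. cinner g x *\<^sub>C g)) = 0"
  using corthonormal_coeff[OF assms] by (simp add: cinner_diff_right)

lemma corthonormal_residual_norm:
  assumes "corthonormal B"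
  shows "(norm x)\<^sup>2 = (norm (x - (\<Sum>g\<in>B. cinner g x *\<^sub>C g)))\<^sup>2 + (\<Sum>g\<in>B. (cmod (cinner g x))\<^sup>2)"
proof -
  define y where "y = (\<Sum>g\<in>B. cinner g x *\<^sub>C g)"
  have "cinner (x - y) y = 0"
    unfolding y_def
    by (rule cexpands_orthogonal[OF cexpands_sum]) (use assms corthonormal_residual in auto)
  then have "(x - y) \<bullet> y = 0" by (simp flip: Re_cinner)
  then have "(norm x)\<^sup>2 = (norm (x - y))\<^sup>2 + (norm y)\<^sup>2"
    unfolding power2_norm_eq_inner
    by (simp add: inner_diff_left inner_diff_right inner_commute)
  then show ?thesis
    using norm_corthonormal_sum[OF assms, of "\<lambda>g. cinner g x"] by (simp add: y_def)
qed

lemma cBessel: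
  assumes "corthonormal B"
  shows "(\<Sum>g\<in>B. (cmod (cinner g x))\<^sup>2) \<le> (norm x)\<^sup>2"
  using corthonormal_residual_norm[OF assms, of x] by simp

lemma cmod_cinner_le: "cmod (cinner x y) \<le> norm x * norm y" for x y :: "'a::complex_hilbert"
proof (cases "x = 0")
  case False
  define e where "e = of_real (1 / norm x) *\<^sub>C x"
  have "corthonormal {e}"
    using False
    by (simp add: corthonormal_def e_def cinner_self norm_scaleC norm_divide)
  from cBessel[OF this, of y] have "cmod (cinner e y) \<le> norm y"
    by simp
  moreover have "cmod (cinner e y) = cmod (cinner x y) / norm x"
    by (simp add: e_def cinner_scaleC_left norm_mult norm_divide)
  ultimately show ?thesis
    using False by (simp add: field_simps)
qed simp

lemma cexpands_mono:
  assumes "corthonormal B'" "B \<subseteq> B'" "cexpands B x"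
  shows "cexpands B' x"
proof -
  have "cinner f x = 0" if "f \<in> B' - B" for f
  proof -
    have "cinner f g = 0" if "g \<in> B" for g
      using that \<open>f \<in> B' - B\<close> assms(1,2) by (auto simp: corthonormal_def)
    then show ?thesis
      using cinner_cexpands[OF assms(3), of f] by simp
  qed
  then have "(\<Sum>f\<in>B'. cinner f x *\<^sub>C f) = (\<Sum>f\<in>B. cinner f x *\<^sub>C f)"
    using assms(1,2) by (intro sum.mono_neutral_right) (auto simp: corthonormal_def)
  then show ?thesis
    using assms(3) by (simp add: cexpands_def)
qed

lemma cexpands_self: "corthonormal B \<Longrightarrow> f \<in> B \<Longrightarrow> cexpands B f"
proof -
  assume B: "corthonormal B" "f \<in> B"
  have "(\<Sum>g\<in>B. cinner g f *\<^sub>C g) = (\<Sum>g\<in>B. if g = f then f else 0)"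
    using B by (intro sum.cong) (auto simp: corthonormal_def)
  then show ?thesis
    using B by (simp add: cexpands_def corthonormal_def)
qed

text \<open>Each vector whose residual does not vanish contributes the normalised residual. The set
  \<open>S\<close> keeps the new vectors in a prescribed linear subspace, and the cardinality bound
  later limits the dimension that has to be removed.\<close>

lemma Gram_Schmidt_extension:
  fixes xs :: "'a::complex_hilbert list"
  assumes "corthonormal B" and S: "\<And>x y. x \<in> S \<Longrightarrow> y \<in> S \<Longrightarrow> x + y \<in> S"
    "\<And>c x. x \<in> S \<Longrightarrow> c *\<^sub>C x \<in> S" and "B \<subseteq> S" "set xs \<subseteq> S"
  shows "\<exists>B'. corthonormal B' \<and> B \<subseteq> B' \<and> B' \<subseteq> S \<and> card B' \<le> card B + length xs \<and>
    (\<forall>x\<in>set xs. cexpands B' x)"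
  using assms(5)
proof (induction xs)
  case Nil
  show ?case using assms(1,4) by auto
next
  case (Cons x xs)
  then obtain B' where B': "corthonormal B'" "B \<subseteq> B'" "B' \<subseteq> S" "card B' \<le> card B + length xs"
    "\<forall>x\<in>set xs. cexpands B' x" by auto
  define r where "r = x - (\<Sum>g\<in>B'. cinner g x *\<^sub>C g)"
  show ?case
  proof (cases "r = 0")
    case True
    then have "cexpands B' x" by (simp add: r_def cexpands_def)
    then show ?thesis using B' by (intro exI[of _ B']) auto
  next
    case False
    define e where "e = of_real (1 / norm r) *\<^sub>C r"
    have fin: "finite B'" using B' by (simp add: corthonormal_def)
    have x: "x \<in> S" using Cons.prems by simp
    have S0: "0 \<in> S" using S(2)[OF x, of 0] by simp
    have "(\<Sum>g\<in>B'. (- cinner g x) *\<^sub>C g) \<in> S"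
      using fin \<open>B' \<subseteq> S\<close> by (induction B' rule: finite_induct) (auto intro: S S0)
    moreover have "(\<Sum>g\<in>B'. (- cinner g x) *\<^sub>C g) = - (\<Sum>g\<in>B'. cinner g x *\<^sub>C g)"
      using scaleC_sum_right[of "-1" "\<lambda>g. cinner g x *\<^sub>C g" B']
        scaleC_of_real[of "-1" "\<Sum>g\<in>B'. cinner g x *\<^sub>C g"]
      by (simp add: scaleC_scaleC)
    ultimately have "r \<in> S" using S(1)[OF x, of "- (\<Sum>g\<in>B'. cinner g x *\<^sub>C g)"]
      by (simp add: r_def)
    then have eS: "e \<in> S" by (simp add: e_def S)
    have ee: "cinner e e = 1"
      using False by (simp add: e_def cinner_self norm_scaleC norm_divide)
    have ge: "cinner g e = 0" if "g \<in> B'" for g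
      using corthonormal_residual[OF B'(1) that, of x]
      by (simp add: e_def r_def cinner_scaleC_right)
    then have eg: "cinner e g = 0" if "g \<in> B'" for g
      using that cinner_eq_zero_commute by blast
    have eB: "e \<notin> B'" using ge ee by force
    have on: "corthonormal (insert e B')"
      using B'(1) ee ge eg by (auto simp: corthonormal_def)
    have "cinner e x = of_real (norm r)"
    proof -
      have "cinner e r = cinner e x"
        by (simp add: r_def cinner_diff_right cinner_sum_right cinner_scaleC_right eg)
      then show ?thesis
        using False by (simp add: e_def cinner_scaleC_left cinner_self power2_eq_square)
    qed
    then have "cinner e x *\<^sub>C e = r"
      using False by (simp add: e_def scaleC_scaleC)
    then have "cexpands (insert e B') x"
      using fin eB by (simp add: cexpands_def r_def)
    moreover have "cexpands (insert e B') y" if "y \<in> set xs" for y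
      using cexpands_mono[OF on _ B'(5)[rule_format, OF that]] by auto
    ultimately show ?thesis
      using on B' eS eB fin by (intro exI[of _ "insert e B'"]) auto
  qed
qed


section \<open>Operator matrices and the minimal tensor norm\<close>

lemma sum_list_tensor_apply:
  "(\<Sum>p\<leftarrow>tensor_apply t v. F p) =
   (\<Sum>(a, b)\<leftarrow>t. \<Sum>(h, k)\<leftarrow>v. F (blinfun_apply a h, blinfun_apply b k))"
  for F :: "_ \<Rightarrow> 'c::comm_monoid_add"
  by (induction t) (auto simp: tensor_apply_def o_def case_prod_beta)

text \<open>Parseval in the second factor: \<Sum> h \<otimes> k is rewritten as \<Sum> H_f \<otimes>
  f, where H_f is the sum of the vectors \<open>cinner f k *\<^sub>C h\<close>, and these terms are
  mutually orthogonal.\<close>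

lemma tensor_norm_expand:
  assumes B: "corthonormal B" and ex: "\<And>h k. (h, k) \<in> set v \<Longrightarrow> cexpands B k"
  shows "tensor_norm v = sqrt (\<Sum>f\<in>B. (norm (\<Sum>(h, k)\<leftarrow>v. cinner f k *\<^sub>C h))\<^sup>2)"
proof -
  define m where "m = length v"
  have nth: "(\<Sum>p\<leftarrow>v. F p) = (\<Sum>j<m. F (v ! j))" for F :: "_ \<Rightarrow> 'c::comm_monoid_add"
    by (simp add: sum_list_sum_nth m_def atLeast0LessThan)
  define h k where "h j = fst (v ! j)" and "k j = snd (v ! j)" for j
  have exk: "cexpands B (k j)" if "j < m" for j
    using that ex[of "h j" "k j"] by (simp add: m_def h_def k_def)
  have "(\<Sum>(h, k)\<leftarrow>v. \<Sum>(h', k')\<leftarrow>v. cinner h h' * cinner k k') =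
      (\<Sum>j<m. \<Sum>l<m. cinner (h j) (h l) * cinner (k j) (k l))"
    by (simp add: nth case_prod_beta h_def k_def)
  also have "\<dots> = (\<Sum>j<m. \<Sum>l<m. \<Sum>f\<in>B. cinner (cinner f (k j) *\<^sub>C h j) (cinner f (k l) *\<^sub>C h l))"
  proof (intro sum.cong refl)
    fix j l assume "j \<in> {..<m}" "l \<in> {..<m}"
    have "cinner (k j) (k l) = (\<Sum>f\<in>B. cnj (cinner f (k j)) * cinner f (k l))"
      using cinner_cexpands[OF exk, of l "k j"] \<open>l \<in> {..<m}\<close> cinner_commute[of "k j"] by simp
    then show "cinner (h j) (h l) * cinner (k j) (k l) =
        (\<Sum>f\<in>B. cinner (cinner f (k j) *\<^sub>C h j) (cinner f (k l) *\<^sub>C h l))"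
      by (simp add: cinner_scaleC_left cinner_scaleC_right sum_distrib_left mult_ac)
  qed
  also have "\<dots> = (\<Sum>j<m. \<Sum>f\<in>B. \<Sum>l<m. cinner (cinner f (k j) *\<^sub>C h j) (cinner f (k l) *\<^sub>C h l))"
    by (intro sum.cong refl sum.swap)
  also have "\<dots> = (\<Sum>f\<in>B. \<Sum>j<m. \<Sum>l<m. cinner (cinner f (k j) *\<^sub>C h j) (cinner f (k l) *\<^sub>C h l))"
    by (rule sum.swap)
  also have "\<dots> = (\<Sum>f\<in>B. cinner (\<Sum>j<m. cinner f (k j) *\<^sub>C h j) (\<Sum>j<m. cinner f (k j) *\<^sub>C h j))"
    unfolding cinner_sum_left by (simp only: cinner_sum_right)
  also have "\<dots> = of_real (\<Sum>f\<in>B. (norm (\<Sum>(h, k)\<leftarrow>v. cinner f k *\<^sub>C h))\<^sup>2)"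
    by (simp add: cinner_self nth case_prod_beta h_def k_def)
  finally show ?thesis
    unfolding tensor_norm_def by simp
qed

lemma tensor_norm_sq_expand:
  assumes "corthonormal B" and "\<And>h k. (h, k) \<in> set v \<Longrightarrow> cexpands B k"
  shows "(tensor_norm v)\<^sup>2 = (\<Sum>f\<in>B. (norm (\<Sum>(h, k)\<leftarrow>v. cinner f k *\<^sub>C h))\<^sup>2)"
  by (simp add: tensor_norm_expand[OF assms] sum_nonneg)

lemma tensor_norm_nonneg: "0 \<le> tensor_norm v"
  for v :: "('a::complex_hilbert \<times> 'b::complex_hilbert) list"
proof -
  have "corthonormal ({} :: 'b set)"
    by (simp add: corthonormal_def)
  from Gram_Schmidt_extension[OF this, where S = UNIV and xs = "map snd v"]
  obtain B :: "'b set" where B: "corthonormal B" "\<forall>x\<in>set (map snd v). cexpands B x"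
    by auto
  have "tensor_norm v = sqrt (\<Sum>f\<in>B. (norm (\<Sum>(h, k)\<leftarrow>v. cinner f k *\<^sub>C h))\<^sup>2)"
    using B(2) by (intro tensor_norm_expand[OF B(1)]) force
  then show ?thesis by (simp add: sum_nonneg)
qed

lemma orthonormal_family:
  fixes f :: "nat \<Rightarrow> 'b::complex_hilbert"
  assumes f: "\<And>s t. s < N \<Longrightarrow> t < N \<Longrightarrow> cinner (f s) (f t) = (if s = t then 1 else 0)"
  shows "inj_on f {..<N}" and "corthonormal (f ` {..<N})"
proof -
  show inj: "inj_on f {..<N}"
  proof (rule inj_onI)
    fix s t assume "s \<in> {..<N}" "t \<in> {..<N}" "f s = f t"
    then show "s = t" using f[of s s] f[of s t] by (auto split: if_splits)
  qed
  show on: "corthonormal (f ` {..<N})"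
    unfolding corthonormal_def
  proof (intro conjI ballI)
    fix g g' assume "g \<in> f ` {..<N}" "g' \<in> f ` {..<N}"
    then obtain s t where "s < N" "t < N" "g = f s" "g' = f t" by auto
    then show "cinner g g' = (if g = g' then 1 else 0)"
      using f[of s t] f[of s s] by auto
  qed simp
qed

lemma tensor_norm_sq_family:
  fixes f :: "nat \<Rightarrow> 'b::complex_hilbert"
  assumes f: "\<And>s t. s < N \<Longrightarrow> t < N \<Longrightarrow> cinner (f s) (f t) = (if s = t then 1 else 0)"
    and ex: "\<And>h k. (h, k) \<in> set v \<Longrightarrow> cexpands (f ` {..<N}) k"
  shows "(tensor_norm v)\<^sup>2 = (\<Sum>t<N. (norm (\<Sum>(h, k)\<leftarrow>v. cinner (f t) k *\<^sub>C h))\<^sup>2)"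
proof -
  note on = orthonormal_family[of N f, OF f]
  show ?thesis
    using tensor_norm_sq_expand[OF on(2) ex] by (simp add: sum.reindex[OF on(1)])
qed

text \<open>Bessel in the second factor: the system \<open>f\<close> is enlarged until it expands
  every second component, and the added terms are dropped.\<close>

lemma tensor_norm_sq_ge:
  fixes f :: "nat \<Rightarrow> 'b::complex_hilbert"
  assumes f: "\<And>s t. s < N \<Longrightarrow> t < N \<Longrightarrow> cinner (f s) (f t) = (if s = t then 1 else 0)"
  shows "(\<Sum>t<N. (norm (\<Sum>(h, k)\<leftarrow>v. cinner (f t) k *\<^sub>C h))\<^sup>2) \<le> (tensor_norm v)\<^sup>2"
proof -
  have inj: "inj_on f {..<N}" and on: "corthonormal (f ` {..<N})"
    using orthonormal_family[of N f] f by blast+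
  have reindex: "(\<Sum>t<N. (norm (\<Sum>(h, k)\<leftarrow>v. cinner (f t) k *\<^sub>C h))\<^sup>2) =
      (\<Sum>g\<in>f ` {..<N}. (norm (\<Sum>(h, k)\<leftarrow>v. cinner g k *\<^sub>C h))\<^sup>2)"
    by (simp add: sum.reindex[OF inj])
  have "\<exists>B. corthonormal B \<and> f ` {..<N} \<subseteq> B \<and> B \<subseteq> UNIV \<and>
      card B \<le> card (f ` {..<N}) + length (map snd v) \<and> (\<forall>x\<in>set (map snd v). cexpands B x)"
    by (rule Gram_Schmidt_extension[OF on]) auto
  then obtain B where B: "corthonormal B" "f ` {..<N} \<subseteq> B" "\<forall>x\<in>set (map snd v). cexpands B x"
    by blast
  have "(\<Sum>g\<in>f ` {..<N}. (norm (\<Sum>(h, k)\<leftarrow>v. cinner g k *\<^sub>C h))\<^sup>2) \<le>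
      (\<Sum>g\<in>B. (norm (\<Sum>(h, k)\<leftarrow>v. cinner g k *\<^sub>C h))\<^sup>2)"
    using B by (intro sum_mono2) (auto simp: corthonormal_def)
  also have "\<dots> = (tensor_norm v)\<^sup>2"
    using B(3) by (intro tensor_norm_sq_expand[OF B(1), symmetric]) force
  finally show "(\<Sum>t<N. (norm (\<Sum>(h, k)\<leftarrow>v. cinner (f t) k *\<^sub>C h))\<^sup>2) \<le> (tensor_norm v)\<^sup>2"
    unfolding reindex .
qed

section \<open>The operator norm of an operator matrix\<close>

lemma mat_norm_bdd_above:
  "bdd_above {sqrt (\<Sum>i<k. (norm (\<Sum>j<k. blinfun_apply (x i j) (h j)))\<^sup>2) |h.
     (\<Sum>j<k. (norm (h j))\<^sup>2) \<le> 1}"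
  for x :: "nat \<Rightarrow> nat \<Rightarrow> 'a::complex_hilbert \<Rightarrow>\<^sub>L 'a"
proof (rule bdd_aboveI, safe)
  fix h :: "nat \<Rightarrow> 'a" assume h: "(\<Sum>j<k. (norm (h j))\<^sup>2) \<le> 1"
  have h1: "norm (h j) \<le> 1" if "j < k" for j
  proof -
    have "(norm (h j))\<^sup>2 \<le> (\<Sum>j<k. (norm (h j))\<^sup>2)"
      using that by (intro member_le_sum) auto
    then have "(norm (h j))\<^sup>2 \<le> 1\<^sup>2" using h by simp
    then show ?thesis by (rule power2_le_imp_le) simp
  qed
  have "norm (\<Sum>j<k. blinfun_apply (x i j) (h j)) \<le> (\<Sum>j<k. norm (x i j))" for i
  proof (rule sum_norm_le)
    fix j assume "j \<in> {..<k}"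
    then have "norm (x i j) * norm (h j) \<le> norm (x i j) * 1"
      using h1 by (intro mult_left_mono) auto
    then show "norm (blinfun_apply (x i j) (h j)) \<le> norm (x i j)"
      using norm_blinfun[of "x i j" "h j"] by simp
  qed
  then show "sqrt (\<Sum>i<k. (norm (\<Sum>j<k. blinfun_apply (x i j) (h j)))\<^sup>2) \<le>
      sqrt (\<Sum>i<k. (\<Sum>j<k. norm (x i j))\<^sup>2)"
    by (intro real_sqrt_le_mono sum_mono power_mono) auto
qed

lemma mat_norm_nonneg: "0 \<le> mat_norm k x"
proof -
  have "0 \<in> {sqrt (\<Sum>i<k. (norm (\<Sum>j<k. blinfun_apply (x i j) (h j)))\<^sup>2) |h.
     (\<Sum>j<k. (norm (h j))\<^sup>2) \<le> 1}"
    by (rule CollectI, rule exI[of _ "\<lambda>_. 0"]) simp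
  then show ?thesis
    unfolding mat_norm_def by (rule cSup_upper) (rule mat_norm_bdd_above)
qed

lemma mat_norm_apply:
  "(\<Sum>i<k. (norm (\<Sum>j<k. blinfun_apply (x i j) (h j)))\<^sup>2) \<le> (mat_norm k x)\<^sup>2 * (\<Sum>j<k. (norm (h j))\<^sup>2)"
proof (cases "(\<Sum>j<k. (norm (h j))\<^sup>2) = 0")
  case True
  then have "h j = 0" if "j < k" for j
    using that by (simp add: sum_nonneg_eq_0_iff)
  then show ?thesis using True by simp
next
  case False
  define r where "r = sqrt (\<Sum>j<k. (norm (h j))\<^sup>2)"
  have r: "r > 0" and r2: "r\<^sup>2 = (\<Sum>j<k. (norm (h j))\<^sup>2)"
    using False by (auto simp: r_def sum_nonneg less_le)
  define h' where "h' j = (1 / r) *\<^sub>R h j" for j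
  have "(\<Sum>j<k. (norm (h' j))\<^sup>2) = (\<Sum>j<k. (norm (h j))\<^sup>2) / r\<^sup>2"
    by (simp add: h'_def power_divide sum_divide_distrib)
  then have "(\<Sum>j<k. (norm (h' j))\<^sup>2) \<le> 1"
    using r r2 by simp
  then have "sqrt (\<Sum>i<k. (norm (\<Sum>j<k. blinfun_apply (x i j) (h' j)))\<^sup>2) \<le> mat_norm k x"
    unfolding mat_norm_def by (intro cSup_upper mat_norm_bdd_above) auto
  then have "(\<Sum>i<k. (norm (\<Sum>j<k. blinfun_apply (x i j) (h' j)))\<^sup>2) \<le> (mat_norm k x)\<^sup>2"
    by (rule sqrt_le_D)
  moreover have "(\<Sum>j<k. blinfun_apply (x i j) (h' j)) = (1 / r) *\<^sub>R (\<Sum>j<k. blinfun_apply (x i j) (h j))" for i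
    by (simp add: h'_def blinfun.scaleR_right scaleR_sum_right)
  ultimately have "(\<Sum>i<k. (norm (\<Sum>j<k. blinfun_apply (x i j) (h j)))\<^sup>2) / r\<^sup>2 \<le> (mat_norm k x)\<^sup>2"
    by (simp add: power_divide sum_divide_distrib)
  then show ?thesis
    using r by (simp add: field_simps flip: r2)
qed

lemma mat_norm_leI:
  assumes "C \<ge> 0" and
    "\<And>h. (\<Sum>i<k. (norm (\<Sum>j<k. blinfun_apply (x i j) (h j)))\<^sup>2) \<le> C\<^sup>2 * (\<Sum>j<k. (norm (h j))\<^sup>2)"
  shows "mat_norm k x \<le> C"
  unfolding mat_norm_def
proof (rule cSup_least)
  show "{sqrt (\<Sum>i<k. (norm (\<Sum>j<k. blinfun_apply (x i j) (h j)))\<^sup>2) |h.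
     (\<Sum>j<k. (norm (h j))\<^sup>2) \<le> 1} \<noteq> {}"
    by (auto intro: exI[of _ "\<lambda>_. 0"])
  fix r assume "r \<in> {sqrt (\<Sum>i<k. (norm (\<Sum>j<k. blinfun_apply (x i j) (h j)))\<^sup>2) |h.
     (\<Sum>j<k. (norm (h j))\<^sup>2) \<le> 1}"
  then obtain h where r: "r = sqrt (\<Sum>i<k. (norm (\<Sum>j<k. blinfun_apply (x i j) (h j)))\<^sup>2)"
    and h: "(\<Sum>j<k. (norm (h j))\<^sup>2) \<le> 1" by blast
  have "C\<^sup>2 * (\<Sum>j<k. (norm (h j))\<^sup>2) \<le> C\<^sup>2 * 1"
    using h by (intro mult_left_mono) auto
  with assms(2)[of h] show "r \<le> C"
    unfolding r using assms(1) by (intro real_le_lsqrt) (auto simp: sum_nonneg)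
qed

lemma bop_sum_list:
  assumes "a \<in> bop"
  shows "blinfun_apply a (\<Sum>(h, k)\<leftarrow>v. c k *\<^sub>C h) = (\<Sum>(h, k)\<leftarrow>v. c k *\<^sub>C blinfun_apply a h)"
  using assms by (induction v) (auto simp: blinfun.add_right bop_def blinfun.zero_right)

text \<open>
  If every \<open>b i\<close> is the matrix \<open>\<alpha> i\<close> in a finite orthonormal system \<open>f\<close>, the identification of
  \<open>\<Sum>\<^sub>t h\<^sub>t \<otimes> f\<^sub>t\<close> with the vector \<open>(h\<^sub>t)\<close> turns \<open>\<Sum>\<^sub>i \<theta>\<^sub>i \<otimes> b\<^sub>i\<close> into an operator matrix.
\<close>

lemma min_norm_eq_mat_norm:
  fixes f :: "nat \<Rightarrow> 'b::complex_hilbert" and \<theta> :: "nat \<Rightarrow> 'a::complex_hilbert \<Rightarrow>\<^sub>L 'a"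
  assumes f: "\<And>s t. s < N \<Longrightarrow> t < N \<Longrightarrow> cinner (f s) (f t) = (if s = t then 1 else 0)"
    and b: "\<And>i k. i < n \<Longrightarrow>
      blinfun_apply (b i) k = (\<Sum>s<N. (\<Sum>t<N. \<alpha> i s t * cinner (f t) k) *\<^sub>C f s)"
    and \<theta>: "\<And>i. i < n \<Longrightarrow> \<theta> i \<in> bop"
  shows "min_norm (map (\<lambda>i. (\<theta> i, b i)) [0..<n]) = mat_norm N (\<lambda>s t. \<Sum>i<n. scale_op (\<alpha> i s t) (\<theta> i))"
    (is "min_norm ?t = mat_norm N ?z")
proof -
  have B: "corthonormal (f ` {..<N})" and inj: "inj_on f {..<N}"
    using orthonormal_family[of N f] f by blast+
  define H :: "('a \<times> 'b) list \<Rightarrow> nat \<Rightarrow> 'a" where "H v t = (\<Sum>(h, k)\<leftarrow>v. cinner (f t) k *\<^sub>C h)" for v t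
  have sum_f: "(\<Sum>s<N. c s *\<^sub>C f s) = (\<Sum>g\<in>f ` {..<N}. c (the_inv_into {..<N} f g) *\<^sub>C g)" for c
    by (simp add: sum.reindex[OF inj] the_inv_into_f_f[OF inj])
  have apply_sq: "(tensor_norm (tensor_apply ?t v))\<^sup>2 =
      (\<Sum>s<N. (norm (\<Sum>t<N. blinfun_apply (?z s t) (H v t)))\<^sup>2)" for v
  proof -
    have "cexpands (f ` {..<N}) k" if "(h, k) \<in> set (tensor_apply ?t v)" for h k
    proof -
      from that obtain i k' where "i < n" "k = blinfun_apply (b i) k'"
        by (auto simp: tensor_apply_def)
      then show ?thesis by (simp add: b sum_f cexpands_sum[OF B])
    qed
    from tensor_norm_sq_family[OF f this]
    have "(tensor_norm (tensor_apply ?t v))\<^sup>2 =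
        (\<Sum>s<N. (norm (\<Sum>(h, k)\<leftarrow>tensor_apply ?t v. cinner (f s) k *\<^sub>C h))\<^sup>2)" by simp
    also have "\<dots> = (\<Sum>s<N. (norm (\<Sum>t<N. blinfun_apply (?z s t) (H v t)))\<^sup>2)"
    proof (intro sum.cong refl arg_cong[where f = "\<lambda>y. (norm y)\<^sup>2"])
      fix s assume s: "s \<in> {..<N}"
      have coeff: "cinner (f s) (blinfun_apply (b i) k) = (\<Sum>t<N. \<alpha> i s t * cinner (f t) k)"
        if "i < n" for i k
      proof -
        have "cinner (f s) (blinfun_apply (b i) k) =
            (\<Sum>r<N. if s = r then (\<Sum>t<N. \<alpha> i r t * cinner (f t) k) else 0)"
          unfolding b[OF that] cinner_sum_right cinner_scaleC_right
          using s by (intro sum.cong) (auto simp: f)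
        then show ?thesis using s by simp
      qed
      have "(\<Sum>(h, k)\<leftarrow>tensor_apply ?t v. cinner (f s) k *\<^sub>C h) =
          (\<Sum>i<n. \<Sum>(h, k)\<leftarrow>v. cinner (f s) (blinfun_apply (b i) k) *\<^sub>C blinfun_apply (\<theta> i) h)"
        unfolding sum_list_tensor_apply
        by (simp add: o_def interv_sum_list_conv_sum_set_nat atLeast0LessThan)
      also have "\<dots> = (\<Sum>i<n. \<Sum>t<N. \<alpha> i s t *\<^sub>C blinfun_apply (\<theta> i) (H v t))"
      proof (intro sum.cong refl)
        fix i assume i: "i \<in> {..<n}"
        have "(\<Sum>(h, k)\<leftarrow>v. cinner (f s) (blinfun_apply (b i) k) *\<^sub>C blinfun_apply (\<theta> i) h) =
           (\<Sum>t<N. \<alpha> i s t *\<^sub>C (\<Sum>(h, k)\<leftarrow>v. cinner (f t) k *\<^sub>C blinfun_apply (\<theta> i) h))"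
          using i
          by (induction v)
            (auto simp: coeff scaleC_add_right sum.distrib scaleC_scaleC scaleC_sum_left)
        then show "(\<Sum>(h, k)\<leftarrow>v. cinner (f s) (blinfun_apply (b i) k) *\<^sub>C blinfun_apply (\<theta> i) h) =
           (\<Sum>t<N. \<alpha> i s t *\<^sub>C blinfun_apply (\<theta> i) (H v t))"
          using i by (simp add: H_def bop_sum_list[OF \<theta>, of i "cinner (f t)" v for t])
      qed
      also have "\<dots> = (\<Sum>t<N. blinfun_apply (?z s t) (H v t))"
        by (subst sum.swap) (simp add: blinfun.sum_left scale_op.rep_eq)
      finally show "(\<Sum>(h, k)\<leftarrow>tensor_apply ?t v. cinner (f s) k *\<^sub>C h) =
          (\<Sum>t<N. blinfun_apply (?z s t) (H v t))" .
    qed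
    finally show ?thesis .
  qed
  \<comment> \<open>The \<open>b i\<close> vanish on the part of a second component that is
    orthogonal to \<open>f\<close>, so Bessel's inequality for the coefficients \<open>H v\<close>
    is enough.\<close>
  have le: "tensor_norm (tensor_apply ?t v) \<le> mat_norm N ?z" if "tensor_norm v \<le> 1" for v
  proof (rule power2_le_imp_le[OF _ mat_norm_nonneg])
    have "(tensor_norm (tensor_apply ?t v))\<^sup>2 \<le> (mat_norm N ?z)\<^sup>2 * (\<Sum>t<N. (norm (H v t))\<^sup>2)"
      unfolding apply_sq by (rule mat_norm_apply)
    also have "\<dots> \<le> (mat_norm N ?z)\<^sup>2 * (tensor_norm v)\<^sup>2"
      unfolding H_def by (intro mult_left_mono tensor_norm_sq_ge f) auto
    also have "\<dots> \<le> (mat_norm N ?z)\<^sup>2 * 1"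
      using that by (intro mult_left_mono) (auto simp: power_le_one tensor_norm_nonneg)
    finally show "(tensor_norm (tensor_apply ?t v))\<^sup>2 \<le> (mat_norm N ?z)\<^sup>2" by simp
  qed
  let ?A = "{tensor_norm (tensor_apply ?t v) |v. tensor_norm v \<le> 1}"
  have bdd: "bdd_above ?A"
    using le by (intro bdd_aboveI) blast
  have nil: "tensor_norm ([] :: ('a \<times> 'b) list) \<le> 1"
    by (simp add: tensor_norm_def)
  show ?thesis
  proof (rule antisym)
    show "min_norm ?t \<le> mat_norm N ?z"
      unfolding min_norm_def using nil le by (intro cSup_least) blast+
    show "mat_norm N ?z \<le> min_norm ?t"
      unfolding mat_norm_def
    proof (rule cSup_least)
      show "{sqrt (\<Sum>s<N. (norm (\<Sum>t<N. blinfun_apply (?z s t) (h t)))\<^sup>2) |h.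
          (\<Sum>t<N. (norm (h t))\<^sup>2) \<le> 1} \<noteq> {}"
        by (auto intro: exI[of _ "\<lambda>_. 0"])
      fix r assume "r \<in> {sqrt (\<Sum>s<N. (norm (\<Sum>t<N. blinfun_apply (?z s t) (h t)))\<^sup>2) |h.
          (\<Sum>t<N. (norm (h t))\<^sup>2) \<le> 1}"
      then obtain h where r: "r = sqrt (\<Sum>s<N. (norm (\<Sum>t<N. blinfun_apply (?z s t) (h t)))\<^sup>2)"
        and h: "(\<Sum>t<N. (norm (h t))\<^sup>2) \<le> 1" by blast
      define v where "v = map (\<lambda>t. (h t, f t)) [0..<N]"
      have Hv: "H v t = h t" if "t < N" for t
      proof -
        have "H v t = (\<Sum>s<N. cinner (f t) (f s) *\<^sub>C h s)"
          by (simp add: H_def v_def o_def interv_sum_list_conv_sum_set_nat atLeast0LessThan)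
        also have "\<dots> = (\<Sum>s<N. if t = s then h s else 0)"
          using that by (intro sum.cong) (auto simp: f)
        finally show ?thesis using that by simp
      qed
      have "cexpands (f ` {..<N}) k" if "(h', k) \<in> set v" for h' k
        using that by (auto simp: v_def intro: cexpands_self[OF B])
      from tensor_norm_sq_family[OF f this] have "(tensor_norm v)\<^sup>2 = (\<Sum>t<N. (norm (H v t))\<^sup>2)"
        by (simp add: H_def)
      also have "\<dots> = (\<Sum>t<N. (norm (h t))\<^sup>2)" by (simp add: Hv)
      finally have "tensor_norm v \<le> 1"
        using h abs_square_le_1[of "tensor_norm v"] by (simp add: abs_le_iff)
      moreover have "r = tensor_norm (tensor_apply ?t v)"
      proof -
        have "r = sqrt ((tensor_norm (tensor_apply ?t v))\<^sup>2)"
          unfolding r apply_sq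
          by (intro arg_cong[where f = sqrt] sum.cong refl arg_cong[where f = "\<lambda>y. (norm y)\<^sup>2"])
            (simp add: Hv)
        then show ?thesis
          by (simp only: real_sqrt_abs abs_of_nonneg[OF tensor_norm_nonneg])
      qed
      ultimately show "r \<le> min_norm ?t"
        unfolding min_norm_def by (intro cSup_upper bdd) blast
    qed
  qed
qed


section \<open>Truncation of compact operators\<close>

lift_definition evec :: "nat \<Rightarrow> (nat \<Rightarrow> complex) \<Rightarrow> ell2" is "\<lambda>N g s. if s < N then g s else 0"
proof -
  fix N :: nat and g :: "nat \<Rightarrow> complex"
  show "summable (\<lambda>n. (cmod (if n < N then g n else 0))\<^sup>2)"
    by (rule summable_finite[of "{..<N}"]) auto
qed

lemma norm_evec_sq: "(norm (evec N g))\<^sup>2 = (\<Sum>s<N. (cmod (g s))\<^sup>2)"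
proof -
  have "(\<Sum>n. (cmod (if n < N then g n else 0))\<^sup>2) = (\<Sum>s<N. (cmod (if s < N then g s else 0))\<^sup>2)"
    by (rule suminf_finite) auto
  then show ?thesis by (simp add: norm_ell2_sq evec.rep_eq)
qed

lemma cinner_evec: "cinner (evec N g) h = (\<Sum>s<N. cnj (g s) * ell2_nth h s)"
proof -
  have "(\<Sum>n. cnj (if n < N then g n else 0) * ell2_nth h n) =
      (\<Sum>s<N. cnj (if s < N then g s else 0) * ell2_nth h s)"
    by (rule suminf_finite) auto
  then show ?thesis by (simp add: cinner_ell2_def evec.rep_eq)
qed

lemma evec_cong: "(\<And>s. s < N \<Longrightarrow> g s = g' s) \<Longrightarrow> evec N g = evec N g'"
  by transfer auto

lemma evec_add: "evec N (\<lambda>s. g s + g' s) = evec N g + evec N g'"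
  by transfer auto

lemma evec_diff: "evec N (\<lambda>s. g s - g' s) = evec N g - evec N g'"
  by transfer auto

lemma evec_scaleC: "evec N (\<lambda>s. c * g s) = c *\<^sub>C evec N g"
  by transfer auto

lemma evec_scaleR: "evec N (\<lambda>s. of_real c * g s) = c *\<^sub>R evec N g"
  by transfer auto

lemma evec_zero: "evec N (\<lambda>s. 0) = 0"
  by transfer auto

lemma evec_sum: "evec N (\<lambda>s. \<Sum>i\<in>I. g i s) = (\<Sum>i\<in>I. evec N (g i))"
  by (induction I rule: infinite_finite_induct) (simp_all add: evec_add evec_zero)

lemma ell2_nth_add: "ell2_nth (x + y) s = ell2_nth x s + ell2_nth y s"
  by (simp add: plus_ell2.rep_eq)

lemma ell2_nth_diff: "ell2_nth (x - y) s = ell2_nth x s - ell2_nth y s"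
  by (simp add: minus_ell2.rep_eq)

lemma ell2_nth_scaleC: "ell2_nth (c *\<^sub>C x) s = c * ell2_nth x s"
  by (simp add: scaleC_ell2.rep_eq)

lemma ell2_nth_scaleR: "ell2_nth (c *\<^sub>R x) s = of_real c * ell2_nth x s"
  by (simp add: scaleR_ell2.rep_eq)

lemma ell2_nth_sum: "ell2_nth (\<Sum>i\<in>I. f i) s = (\<Sum>i\<in>I. ell2_nth (f i) s)"
  by (induction I rule: infinite_finite_induct) (simp_all add: ell2_nth_add zero_ell2.rep_eq)

definition ebase :: "nat \<Rightarrow> ell2" where
  "ebase t = evec (Suc t) (\<lambda>s. if s = t then 1 else 0)"

lemma ell2_nth_ebase: "ell2_nth (ebase t) s = (if s = t then 1 else 0)"
  by (auto simp: ebase_def evec.rep_eq)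

lemma cinner_ebase: "cinner (ebase t) h = ell2_nth h t"
proof -
  have "cinner (ebase t) h = (\<Sum>s<Suc t. if s = t then ell2_nth h t else 0)"
    unfolding ebase_def cinner_evec by (intro sum.cong) auto
  then show ?thesis by simp
qed

lemma evec_eq_sum: "evec N g = (\<Sum>s<N. g s *\<^sub>C ebase s)"
proof -
  have "(\<Sum>i<N. g i * (if s = i then 1 else 0)) = (if s < N then g s else 0)" for s
  proof -
    have "(\<Sum>i<N. g i * (if s = i then 1 else 0)) = (\<Sum>i<N. if s = i then g s else 0)"
      by (intro sum.cong) auto
    then show ?thesis by simp
  qed
  then have "ell2_nth (evec N g) s = ell2_nth (\<Sum>s<N. g s *\<^sub>C ebase s) s" for s
    by (simp add: evec.rep_eq ell2_nth_sum ell2_nth_scaleC ell2_nth_ebase)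
  then show ?thesis by (metis ell2_nth_inverse ext)
qed

lemma norm_evec_le_sum: "norm (evec N g) \<le> (\<Sum>s<N. cmod (g s))"
proof -
  have "norm (evec N g) = L2_set (\<lambda>s. cmod (g s)) {..<N}"
    unfolding L2_set_def norm_evec_sq[symmetric] by simp
  then show ?thesis
    using L2_set_le_sum[of "{..<N}" "\<lambda>s. cmod (g s)"] by simp
qed

definition trunc :: "nat \<Rightarrow> ell2 \<Rightarrow> ell2" where
  "trunc N h = evec N (ell2_nth h)"

lemma norm_trunc_le: "norm (trunc N h) \<le> norm h"
  by (rule power2_le_imp_le) (simp_all add: trunc_def norm_evec_sq sum_le_norm_ell2)

lemma norm_diff_trunc_sq: "(norm (h - trunc N h))\<^sup>2 = (norm h)\<^sup>2 - (\<Sum>s<N. (cmod (ell2_nth h s))\<^sup>2)"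
proof -
  have "(norm (h - trunc N h))\<^sup>2 = (\<Sum>n. (cmod (ell2_nth h n))\<^sup>2 - (cmod (ell2_nth (trunc N h) n))\<^sup>2)"
    unfolding norm_ell2_sq
    by (intro suminf_cong) (simp add: ell2_nth_diff trunc_def evec.rep_eq)
  also have "\<dots> = (norm h)\<^sup>2 - (norm (trunc N h))\<^sup>2"
    unfolding norm_ell2_sq by (rule suminf_diff[symmetric]) (rule summable_ell2)+
  finally show ?thesis by (simp add: trunc_def norm_evec_sq)
qed

lemma norm_diff_trunc_le: "norm (h - trunc N h) \<le> norm h"
  by (rule power2_le_imp_le) (simp_all add: norm_diff_trunc_sq sum_nonneg)

lemma trunc_diff: "trunc N (x - y) = trunc N x - trunc N y"
  unfolding trunc_def evec_diff[symmetric] by (rule evec_cong) (rule ell2_nth_diff)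

lemma trunc_tendsto: "(\<lambda>N. trunc N h) \<longlonglongrightarrow> h"
proof -
  have "(\<lambda>N. (norm h)\<^sup>2 - (\<Sum>s<N. (cmod (ell2_nth h s))\<^sup>2)) \<longlonglongrightarrow> (norm h)\<^sup>2 - (norm h)\<^sup>2"
    using summable_LIMSEQ[OF summable_ell2[of h]]
    by (intro tendsto_diff tendsto_const) (simp add: norm_ell2_sq)
  then have "(\<lambda>N. sqrt ((norm (h - trunc N h))\<^sup>2)) \<longlonglongrightarrow> sqrt 0"
    unfolding norm_diff_trunc_sq by (intro tendsto_real_sqrt) simp
  then have "(\<lambda>N. norm (trunc N h - h)) \<longlonglongrightarrow> 0"
    by (simp add: norm_minus_commute)
  then show ?thesis
    using Lim_null tendsto_norm_zero_iff by blast
qed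

lemma blinfun_bop_sum:
  assumes "x \<in> bop"
  shows "blinfun_apply x (\<Sum>i\<in>I. c i *\<^sub>C h i) = (\<Sum>i\<in>I. c i *\<^sub>C blinfun_apply x (h i))"
  using assms by (simp add: blinfun.sum_right bop_def)

text \<open>The vector \<open>y\<close> plays the part of the adjoint of \<open>x\<close> applied to
  \<open>ebase a\<close>; adjoints themselves are not constructed. Its coordinates are square
  summable by duality, and the identity passes from finitely supported vectors to all
  \<open>h\<close> by continuity.\<close>

lemma bop_nth_Riesz:
  fixes x :: "ell2 \<Rightarrow>\<^sub>L ell2"
  assumes x: "x \<in> bop"
  shows "\<exists>y. \<forall>h. ell2_nth (blinfun_apply x h) a = cinner y h"
proof -
  define \<phi> where "\<phi> m = ell2_nth (blinfun_apply x (ebase m)) a" for m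
  have ap: "ell2_nth (blinfun_apply x (evec M g)) a = (\<Sum>m<M. g m * \<phi> m)" for M g
    by (simp add: evec_eq_sum blinfun_bop_sum[OF x] ell2_nth_sum ell2_nth_scaleC \<phi>_def)
  have "(\<Sum>m<M. (cmod (cnj (\<phi> m)))\<^sup>2) \<le> (norm x)\<^sup>2" for M
  proof -
    \<comment> \<open>The candidate for \<open>y\<close>, cut off at \<open>M\<close>, is its own
      test vector: \<open>x\<close> maps it to a vector whose coordinate \<open>a\<close> is
      \<open>(norm g)\<^sup>2\<close>.\<close>
    define g where "g = evec M (\<lambda>m. cnj (\<phi> m))"
    have "of_real ((norm g)\<^sup>2) = ell2_nth (blinfun_apply x g) a"
      unfolding g_def ap norm_evec_sq by (simp add: complex_norm_square mult.commute del: of_real_power)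
    then have "(norm g)\<^sup>2 = cmod (ell2_nth (blinfun_apply x g) a)"
      by (metis norm_of_real abs_power2)
    also have "\<dots> \<le> norm x * norm g"
      using cmod_ell2_nth_le norm_blinfun order_trans by blast
    finally have "norm g \<le> norm x"
      by (cases "norm g = 0") (auto simp: power2_eq_square)
    then have "(norm g)\<^sup>2 \<le> (norm x)\<^sup>2" by (simp add: power_mono)
    then show ?thesis by (simp add: g_def norm_evec_sq)
  qed
  then have "summable (\<lambda>m. (cmod (cnj (\<phi> m)))\<^sup>2)"
    by (intro summableI_nonneg_bounded) auto
  then obtain y where y: "\<And>m. ell2_nth y m = cnj (\<phi> m)"
    using Abs_ell2_inverse[of "\<lambda>m. cnj (\<phi> m)"] by (metis mem_Collect_eq)
  have "ell2_nth (blinfun_apply x h) a = cinner y h" for h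
  proof -
    have L: "(\<lambda>M. blinfun_apply x (trunc M h)) \<longlonglongrightarrow> blinfun_apply x h"
      by (intro blinfun.tendsto tendsto_const trunc_tendsto)
    have "(\<lambda>M. norm (ell2_nth (blinfun_apply x (trunc M h)) a - ell2_nth (blinfun_apply x h) a)) \<longlonglongrightarrow> 0"
    proof (rule tendsto_sandwich[OF _ _ tendsto_const])
      show "(\<lambda>M. norm (blinfun_apply x (trunc M h) - blinfun_apply x h)) \<longlonglongrightarrow> 0"
        using L Lim_null tendsto_norm_zero by blast
    qed (use cmod_ell2_nth_le in \<open>auto simp flip: ell2_nth_diff\<close>)
    then have "(\<lambda>M. ell2_nth (blinfun_apply x (trunc M h)) a) \<longlonglongrightarrow> ell2_nth (blinfun_apply x h) a"
      using Lim_null tendsto_norm_zero_iff by blast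
    moreover have "(\<lambda>M. ell2_nth (blinfun_apply x (trunc M h)) a) \<longlonglongrightarrow> cinner y h"
      using summable_LIMSEQ[OF summable_ell2_prod[of y h]]
      unfolding trunc_def ap cinner_ell2_def y by (simp add: mult.commute)
    ultimately show ?thesis
      by (rule LIMSEQ_unique)
  qed
  then show ?thesis by blast
qed

lift_definition matop :: "nat \<Rightarrow> (nat \<Rightarrow> nat \<Rightarrow> complex) \<Rightarrow> ell2 \<Rightarrow>\<^sub>L ell2" is
  "\<lambda>N \<alpha> h. evec N (\<lambda>s. \<Sum>t<N. \<alpha> s t * ell2_nth h t)"
proof (rule bounded_linear_intro)
  fix N and \<alpha> :: "nat \<Rightarrow> nat \<Rightarrow> complex" and g h :: ell2 and r :: real
  show "evec N (\<lambda>s. \<Sum>t<N. \<alpha> s t * ell2_nth (g + h) t) =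
      evec N (\<lambda>s. \<Sum>t<N. \<alpha> s t * ell2_nth g t) + evec N (\<lambda>s. \<Sum>t<N. \<alpha> s t * ell2_nth h t)"
    unfolding evec_add[symmetric] by (simp add: ell2_nth_add distrib_left sum.distrib)
  show "evec N (\<lambda>s. \<Sum>t<N. \<alpha> s t * ell2_nth (r *\<^sub>R h) t) =
      r *\<^sub>R evec N (\<lambda>s. \<Sum>t<N. \<alpha> s t * ell2_nth h t)"
    unfolding evec_scaleR[symmetric] by (simp add: ell2_nth_scaleR sum_distrib_left mult_ac)
  have "norm (evec N (\<lambda>s. \<Sum>t<N. \<alpha> s t * ell2_nth h t)) \<le>
      (\<Sum>s<N. cmod (\<Sum>t<N. \<alpha> s t * ell2_nth h t))"
    by (rule norm_evec_le_sum)
  also have "\<dots> \<le> (\<Sum>s<N. \<Sum>t<N. cmod (\<alpha> s t) * norm h)"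
    by (intro sum_mono sum_norm_le) (simp add: norm_mult mult_left_mono cmod_ell2_nth_le)
  finally show "norm (evec N (\<lambda>s. \<Sum>t<N. \<alpha> s t * ell2_nth h t)) \<le>
      norm h * (\<Sum>s<N. \<Sum>t<N. cmod (\<alpha> s t))"
    by (simp add: sum_distrib_left mult.commute)
qed

lemma matop_bop: "matop N \<alpha> \<in> bop"
  by (simp add: bop_def matop.rep_eq ell2_nth_scaleC sum_distrib_left mult_ac flip: evec_scaleC)

text \<open>On the range side, total boundedness of the image of the unit ball makes truncation
  uniform. On the domain side, the first \<open>k0\<close> coordinates of the image are finitely
  many functionals given by vectors close to their truncations, and the remaining coordinates are
  again covered by the range estimate. All large \<open>k\<close> work, so one size serves finitely
  many operators.\<close>

lemma compact_op_approx:
  fixes x :: "ell2 \<Rightarrow>\<^sub>L ell2"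
  assumes x: "x \<in> compact_ops" and e: "e > 0"
  shows "\<exists>k0. \<forall>k\<ge>k0. norm (x - matop k (\<lambda>a b. ell2_nth (blinfun_apply x (ebase b)) a)) \<le> e"
proof -
  have xb: "x \<in> bop" and cpt: "compact (closure (blinfun_apply x ` cball 0 1))"
    using x by (auto simp: compact_ops_def)
  \<comment> \<open>Three errors of \<open>e / 9\<close> make up the \<open>e / 3\<close> of the
    range side.\<close>
  have e9: "e / 9 > 0" using e by simp
  obtain K where K: "finite K" "closure (blinfun_apply x ` cball 0 1) \<subseteq> (\<Union>y\<in>K. ball y (e / 9))"
    using cpt e9 unfolding compact_eq_totally_bounded by meson
  have "\<forall>y\<in>K. \<forall>\<^sub>F k in sequentially. dist (trunc k y) y < e / 9"
    using tendstoD[OF trunc_tendsto e9] by blast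
  then have "\<forall>\<^sub>F k in sequentially. \<forall>y\<in>K. dist (trunc k y) y < e / 9"
    using K(1) by (simp add: eventually_ball_finite)
  then obtain k0 where k0: "\<And>k y. k \<ge> k0 \<Longrightarrow> y \<in> K \<Longrightarrow> norm (y - trunc k y) < e / 9"
    by (auto simp: eventually_sequentially dist_norm norm_minus_commute)
  have left: "norm (blinfun_apply x h - trunc k (blinfun_apply x h)) \<le> e / 3"
    if "k \<ge> k0" "norm h \<le> 1" for k h
  proof -
    have "blinfun_apply x h \<in> closure (blinfun_apply x ` cball 0 1)"
      using that by (intro subsetD[OF closure_subset]) auto
    then obtain y where y: "y \<in> K" "norm (blinfun_apply x h - y) < e / 9"
      using K(2) by (auto simp: dist_norm norm_minus_commute)
    have "blinfun_apply x h - trunc k (blinfun_apply x h) =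
        (blinfun_apply x h - y) + (y - trunc k y) + - trunc k (blinfun_apply x h - y)"
      by (simp add: trunc_diff)
    then have "norm (blinfun_apply x h - trunc k (blinfun_apply x h)) \<le>
        norm (blinfun_apply x h - y) + norm (y - trunc k y) + norm (trunc k (blinfun_apply x h - y))"
      by (metis norm_minus_cancel norm_triangle_mono norm_triangle_ineq order_refl)
    then show ?thesis
      using y k0[OF that(1) y(1)] norm_trunc_le[of k "blinfun_apply x h - y"] by linarith
  qed
  obtain Y where Y: "\<And>a h. ell2_nth (blinfun_apply x h) a = cinner (Y a) h"
    using bop_nth_Riesz[OF xb] by metis
  \<comment> \<open>An error \<open>d\<close> in each of \<open>k0\<close> coordinates adds up to at
    most \<open>e / 3\<close>; the summand 1 allows \<open>k0 = 0\<close>.\<close>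
  define d where "d = e / (3 * (real k0 + 1))"
  have d: "d > 0" using e by (simp add: d_def)
  have "\<forall>a\<in>{..<k0}. \<forall>\<^sub>F l in sequentially. dist (trunc l (Y a)) (Y a) < d"
    using tendstoD[OF trunc_tendsto d] by blast
  then have "\<forall>\<^sub>F l in sequentially. \<forall>a\<in>{..<k0}. dist (trunc l (Y a)) (Y a) < d"
    by (simp add: eventually_ball_finite)
  then obtain l0 where l0: "\<And>l a. l \<ge> l0 \<Longrightarrow> a < k0 \<Longrightarrow> norm (Y a - trunc l (Y a)) < d"
    by (auto simp: eventually_sequentially dist_norm norm_minus_commute)
  have right: "norm (blinfun_apply x (h - trunc l h)) \<le> 2 * e / 3" if "l \<ge> l0" "norm h \<le> 1" for l h
  proof -
    define w where "w = blinfun_apply x (h - trunc l h)"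
    have "cmod (ell2_nth w a) \<le> d" if "a < k0" for a
    proof -
      have tr: "cinner (Y a) (trunc l h) = cinner (trunc l (Y a)) h"
        using cinner_commute[of "Y a" "trunc l h"] by (simp add: trunc_def cinner_evec mult.commute)
      have "ell2_nth w a = cinner (Y a - trunc l (Y a)) h"
        unfolding w_def Y by (simp add: cinner_diff_left cinner_diff_right tr)
      then have "cmod (ell2_nth w a) \<le> norm (Y a - trunc l (Y a)) * norm h"
        by (simp add: cmod_cinner_le)
      also have "\<dots> \<le> d * 1"
        using l0[OF \<open>l \<ge> l0\<close> that] \<open>norm h \<le> 1\<close> d by (intro mult_mono) auto
      finally show ?thesis by simp
    qed
    then have "norm (trunc k0 w) \<le> (\<Sum>a<k0. d)"
      unfolding trunc_def by (intro order_trans[OF norm_evec_le_sum] sum_mono) auto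
    also have "\<dots> \<le> e / 3"
      using e by (simp add: d_def field_simps)
    finally have "norm (trunc k0 w) \<le> e / 3" .
    moreover have "norm (w - trunc k0 w) \<le> e / 3"
      unfolding w_def using norm_diff_trunc_le[of h l] that by (intro left) auto
    moreover have "norm w \<le> norm (w - trunc k0 w) + norm (trunc k0 w)"
      by (metis diff_add_cancel norm_triangle_ineq)
    ultimately show ?thesis by (simp add: w_def)
  qed
  show ?thesis
  proof (intro exI allI impI)
    fix k assume k: "k \<ge> max k0 l0"
    let ?y = "matop k (\<lambda>a b. ell2_nth (blinfun_apply x (ebase b)) a)"
    have y: "blinfun_apply ?y h = trunc k (blinfun_apply x (trunc k h))" for h
      by (simp add: matop.rep_eq trunc_def evec_eq_sum[of k "ell2_nth h"] blinfun_bop_sum[OF xb]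
          ell2_nth_sum ell2_nth_scaleC mult.commute cong: evec_cong)
    have unit: "norm (blinfun_apply (x - ?y) h) \<le> e" if "norm h \<le> 1" for h
    proof -
      have "blinfun_apply (x - ?y) h = (blinfun_apply x h - trunc k (blinfun_apply x h)) +
          trunc k (blinfun_apply x (h - trunc k h))"
        by (simp add: y blinfun.diff_left blinfun.diff_right trunc_diff)
      then have "norm (blinfun_apply (x - ?y) h) \<le> norm (blinfun_apply x h - trunc k (blinfun_apply x h)) +
          norm (trunc k (blinfun_apply x (h - trunc k h)))"
        by (metis norm_triangle_ineq)
      then show ?thesis
        using left[of k h] right[of k h] k that norm_trunc_le[of k "blinfun_apply x (h - trunc k h)"]
        by auto
    qed
    show "norm (x - ?y) \<le> e"
    proof (rule norm_blinfun_bound)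
      fix h
      show "norm (blinfun_apply (x - ?y) h) \<le> e * norm h"
      proof (cases "h = 0")
        case False
        have "norm (blinfun_apply (x - ?y) ((1 / norm h) *\<^sub>R h)) \<le> e"
          using False by (intro unit) simp
        then show ?thesis
          using False by (simp add: blinfun.scaleR_right field_simps)
      qed (simp add: blinfun.zero_right)
    qed (use e in simp)
  qed
qed


section \<open>Matrices over an operator space\<close>

lemma cinner_ebase_ebase: "cinner (ebase s) (ebase t) = (if s = t then 1 else 0)"
  by (simp add: cinner_ebase ell2_nth_ebase)

lemma matop_ebase_expand:
  "blinfun_apply (matop N \<alpha>) h = (\<Sum>s<N. (\<Sum>t<N. \<alpha> s t * cinner (ebase t) h) *\<^sub>C ebase s)"
  by (simp add: matop.rep_eq evec_eq_sum cinner_ebase)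

lemma to_cconj_sum: "to_cconj (\<Sum>i\<in>I. f i) = (\<Sum>i\<in>I. to_cconj (f i))"
  for f :: "_ \<Rightarrow> 'a::complex_hilbert"
  by (rule linear_sum[OF bounded_linear.linear[OF to_cconj_bounded_linear]])

lemma conj_matop_expand:
  "blinfun_apply (conj_op (matop N \<alpha>)) h =
   (\<Sum>s<N. (\<Sum>t<N. cnj (\<alpha> s t) * cinner (to_cconj (ebase t)) h) *\<^sub>C to_cconj (ebase s))"
proof -
  have "to_cconj (c *\<^sub>C x) = cnj c *\<^sub>C to_cconj x" for c and x :: ell2
    by (simp add: scaleC_cconj.abs_eq)
  moreover have "cinner (to_cconj x) h = cnj (cinner x (of_cconj h))" for x
    by (simp add: cinner_cconj.rep_eq to_cconj_inverse)
  ultimately show ?thesis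
    by (simp add: conj_op.rep_eq matop_ebase_expand to_cconj_sum)
qed

lemma min_norm_matop:
  assumes "\<And>i. i < n \<Longrightarrow> \<theta> i \<in> bop"
  shows "min_norm (map (\<lambda>i. (\<theta> i, matop N (\<alpha> i))) [0..<n]) =
    mat_norm N (\<lambda>s t. \<Sum>i<n. scale_op (\<alpha> i s t) (\<theta> i))"
  by (rule min_norm_eq_mat_norm[where f = ebase])
    (simp_all only: cinner_ebase_ebase matop_ebase_expand assms)

lemma min_norm_matop_conj:
  "min_norm (map (\<lambda>i. (matop N (\<alpha> i), conj_op (matop N (\<alpha> i)))) [0..<n]) =
    mat_norm N (\<lambda>s t. \<Sum>i<n. scale_op (cnj (\<alpha> i s t)) (matop N (\<alpha> i)))"
proof (rule min_norm_eq_mat_norm[where f = "\<lambda>s. to_cconj (ebase s)"])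
  show "cinner (to_cconj (ebase s)) (to_cconj (ebase t)) = (if s = t then 1 else 0)" for s t
    by (simp add: cinner_cconj.abs_eq cinner_ebase_ebase)
qed (simp_all only: conj_matop_expand matop_bop)

text \<open>The constant \<open>c\<close> bounds the square of the operator norm. General index sets
  let the tree ball and its numbered copy be treated alike.\<close>

definition op_sq_bound ::
  "'x set \<Rightarrow> 'y set \<Rightarrow> ('x \<Rightarrow> 'y \<Rightarrow> complex) \<Rightarrow> real \<Rightarrow> bool" where
  "op_sq_bound I J A c \<longleftrightarrow>
     (\<forall>g. (\<Sum>x\<in>I. (cmod (\<Sum>y\<in>J. A x y * g y))\<^sup>2) \<le> c * (\<Sum>y\<in>J. (cmod (g y))\<^sup>2))"

text \<open>The matrix of \<Sum> X_i \<otimes> \<beta>_i, its rows and columns indexed by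
  pairs.\<close>

definition amp ::
  "nat \<Rightarrow> (nat \<Rightarrow> nat \<Rightarrow> nat \<Rightarrow> complex) \<Rightarrow> (nat \<Rightarrow> 'v \<Rightarrow> 'v \<Rightarrow> complex) \<Rightarrow> nat \<times> 'v \<Rightarrow> nat \<times> 'v \<Rightarrow> complex" where
  "amp n X \<beta> x y = (\<Sum>i<n. X i (fst x) (fst y) * \<beta> i (snd x) (snd y))"

lemma sum_Times_swap:
  "(\<Sum>x\<in>A \<times> B. f x) = (\<Sum>s\<in>B. \<Sum>a\<in>A. f (a, s))" for f :: "_ \<Rightarrow> 'c::comm_monoid_add"
  by (subst sum.swap) (simp add: sum.cartesian_product)

text \<open>The entries \<open>ell2_nth (h t) b\<close> with \<open>b < k\<close> form a vector on
  the product index set. The further coordinates of \<open>h t\<close> are invisible to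
  \<open>matop k\<close>, so passing back to \<open>h\<close> on the right-hand side only increases
  it.\<close>

lemma mat_norm_matop_le:
  assumes bd: "op_sq_bound ({..<k} \<times> {..<N}) ({..<k} \<times> {..<N}) (amp n X \<beta>) (R\<^sup>2)" and R: "R \<ge> 0"
  shows "mat_norm N (\<lambda>s t. \<Sum>i<n. scale_op (\<beta> i s t) (matop k (X i))) \<le> R"
proof (rule mat_norm_leI[OF R])
  fix h :: "nat \<Rightarrow> ell2"
  let ?J = "{..<k} \<times> {..<N}"
  define g where "g y = ell2_nth (h (snd y)) (fst y)" for y
  have vec: "(\<Sum>t<N. blinfun_apply (\<Sum>i<n. scale_op (\<beta> i s t) (matop k (X i))) (h t)) =
      evec k (\<lambda>a. \<Sum>y\<in>?J. amp n X \<beta> (a, s) y * g y)" for s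
  proof -
    have "(\<Sum>t<N. blinfun_apply (\<Sum>i<n. scale_op (\<beta> i s t) (matop k (X i))) (h t)) =
        evec k (\<lambda>a. \<Sum>t<N. \<Sum>i<n. \<beta> i s t * (\<Sum>b<k. X i a b * ell2_nth (h t) b))"
      by (simp add: blinfun.sum_left scale_op.rep_eq matop.rep_eq evec_sum evec_scaleC)
    also have "\<dots> = evec k (\<lambda>a. \<Sum>y\<in>?J. amp n X \<beta> (a, s) y * g y)"
    proof (rule evec_cong)
      fix a
      have "(\<Sum>i<n. \<beta> i s t * (\<Sum>b<k. X i a b * ell2_nth (h t) b)) =
          (\<Sum>b<k. (\<Sum>i<n. X i a b * \<beta> i s t) * ell2_nth (h t) b)" for t
        unfolding sum_distrib_left sum_distrib_right by (subst sum.swap) (simp add: mult_ac)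
      then show "(\<Sum>t<N. \<Sum>i<n. \<beta> i s t * (\<Sum>b<k. X i a b * ell2_nth (h t) b)) =
          (\<Sum>y\<in>?J. amp n X \<beta> (a, s) y * g y)"
        by (simp add: sum_Times_swap amp_def g_def)
    qed
    finally show ?thesis .
  qed
  have "(\<Sum>s<N. (norm (\<Sum>t<N. blinfun_apply (\<Sum>i<n. scale_op (\<beta> i s t) (matop k (X i))) (h t)))\<^sup>2) =
      (\<Sum>x\<in>?J. (cmod (\<Sum>y\<in>?J. amp n X \<beta> x y * g y))\<^sup>2)"
    unfolding vec norm_evec_sq by (simp only: sum_Times_swap[of _ "{..<k}" "{..<N}"])
  also have "\<dots> \<le> R\<^sup>2 * (\<Sum>y\<in>?J. (cmod (g y))\<^sup>2)"
    using bd by (simp add: op_sq_bound_def)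
  also have "\<dots> \<le> R\<^sup>2 * (\<Sum>t<N. (norm (h t))\<^sup>2)"
    unfolding sum_Times_swap g_def by (intro mult_left_mono sum_mono) (simp_all add: sum_le_norm_ell2)
  finally show "(\<Sum>s<N. (norm (\<Sum>t<N. blinfun_apply (\<Sum>i<n. scale_op (\<beta> i s t) (matop k (X i))) (h t)))\<^sup>2)
      \<le> R\<^sup>2 * (\<Sum>t<N. (norm (h t))\<^sup>2)" .
qed

text \<open>Compression to the first \<open>k\<close> coordinates: vectors supported there are fed
  in, and only the coordinates below \<open>k\<close> of the result are kept.\<close>

lemma op_sq_bound_corner:
  assumes x: "\<And>i. i < n \<Longrightarrow> x i \<in> bop"
    and le: "mat_norm N (\<lambda>s t. \<Sum>i<n. scale_op (\<beta> i s t) (x i)) \<le> R"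
  shows "op_sq_bound ({..<k} \<times> {..<N}) ({..<k} \<times> {..<N})
    (amp n (\<lambda>i a b. ell2_nth (blinfun_apply (x i) (ebase b)) a) \<beta>) (R\<^sup>2)"
  unfolding op_sq_bound_def
proof
  fix g :: "nat \<times> nat \<Rightarrow> complex"
  let ?J = "{..<k} \<times> {..<N}"
  let ?X = "\<lambda>i a b. ell2_nth (blinfun_apply (x i) (ebase b)) a"
  define h where "h t = evec k (\<lambda>b. g (b, t))" for t
  define w where "w s = (\<Sum>t<N. blinfun_apply (\<Sum>i<n. scale_op (\<beta> i s t) (x i)) (h t))" for s
  have nth: "ell2_nth (w s) a = (\<Sum>y\<in>?J. amp n ?X \<beta> (a, s) y * g y)" for a s
  proof -
    have "ell2_nth (blinfun_apply (x i) (h t)) a = (\<Sum>b<k. g (b, t) * ?X i a b)" if "i < n" for i t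
      by (simp add: h_def evec_eq_sum blinfun_bop_sum[OF x[OF that]] ell2_nth_sum ell2_nth_scaleC)
    then have "ell2_nth (w s) a = (\<Sum>t<N. \<Sum>i<n. \<beta> i s t * (\<Sum>b<k. g (b, t) * ?X i a b))"
      by (simp add: w_def blinfun.sum_left scale_op.rep_eq ell2_nth_sum ell2_nth_scaleC)
    moreover have "(\<Sum>i<n. \<beta> i s t * (\<Sum>b<k. g (b, t) * ?X i a b)) =
        (\<Sum>b<k. (\<Sum>i<n. ?X i a b * \<beta> i s t) * g (b, t))" for t
      unfolding sum_distrib_left sum_distrib_right by (subst sum.swap) (simp add: mult_ac)
    ultimately show ?thesis
      by (simp add: sum_Times_swap amp_def)
  qed
  have "(\<Sum>x\<in>?J. (cmod (\<Sum>y\<in>?J. amp n ?X \<beta> x y * g y))\<^sup>2) = (\<Sum>s<N. \<Sum>a<k. (cmod (ell2_nth (w s) a))\<^sup>2)"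
    unfolding nth by (simp only: sum_Times_swap[of _ "{..<k}" "{..<N}"])
  also have "\<dots> \<le> (\<Sum>s<N. (norm (w s))\<^sup>2)"
    by (intro sum_mono sum_le_norm_ell2)
  also have "\<dots> \<le> (mat_norm N (\<lambda>s t. \<Sum>i<n. scale_op (\<beta> i s t) (x i)))\<^sup>2 * (\<Sum>t<N. (norm (h t))\<^sup>2)"
    unfolding w_def by (rule mat_norm_apply)
  also have "\<dots> \<le> R\<^sup>2 * (\<Sum>t<N. (norm (h t))\<^sup>2)"
    using le by (intro mult_right_mono power_mono) (auto simp: mat_norm_nonneg sum_nonneg)
  also have "(\<Sum>t<N. (norm (h t))\<^sup>2) = (\<Sum>y\<in>?J. (cmod (g y))\<^sup>2)"
    by (simp add: h_def norm_evec_sq sum_Times_swap)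
  finally show "(\<Sum>x\<in>?J. (cmod (\<Sum>y\<in>?J. amp n ?X \<beta> x y * g y))\<^sup>2) \<le> R\<^sup>2 * (\<Sum>y\<in>?J. (cmod (g y))\<^sup>2)" .
qed

section \<open>Matrix norms under perturbation of the operator coefficients\<close>

lemma mat_norm_apply_L2:
  "L2_set (\<lambda>i. norm (\<Sum>j<k. blinfun_apply (x i j) (h j))) {..<k} \<le> mat_norm k x * L2_set (\<lambda>j. norm (h j)) {..<k}"
  unfolding L2_set_def
  using real_sqrt_le_mono[OF mat_norm_apply[of x h k]] mat_norm_nonneg[of k x]
  by (simp add: real_sqrt_mult)

lemma mat_norm_leI_L2:
  assumes "C \<ge> 0" and
    "\<And>h. L2_set (\<lambda>i. norm (\<Sum>j<k. blinfun_apply (x i j) (h j))) {..<k} \<le> C * L2_set (\<lambda>j. norm (h j)) {..<k}"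
  shows "mat_norm k x \<le> C"
proof (rule mat_norm_leI[OF assms(1)])
  fix h
  have "(L2_set (\<lambda>i. norm (\<Sum>j<k. blinfun_apply (x i j) (h j))) {..<k})\<^sup>2 \<le> (C * L2_set (\<lambda>j. norm (h j)) {..<k})\<^sup>2"
    by (rule power_mono[OF assms(2) L2_set_nonneg])
  then show "(\<Sum>i<k. (norm (\<Sum>j<k. blinfun_apply (x i j) (h j)))\<^sup>2) \<le> C\<^sup>2 * (\<Sum>j<k. (norm (h j))\<^sup>2)"
    unfolding L2_set_def power_mult_distrib by (simp add: sum_nonneg)
qed

lemma mat_norm_add: "mat_norm k (\<lambda>i j. x i j + y i j) \<le> mat_norm k x + mat_norm k y"
proof (rule mat_norm_leI_L2)
  fix h
  have "L2_set (\<lambda>i. norm (\<Sum>j<k. blinfun_apply (x i j + y i j) (h j))) {..<k} \<le>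
      L2_set (\<lambda>i. norm (\<Sum>j<k. blinfun_apply (x i j) (h j)) + norm (\<Sum>j<k. blinfun_apply (y i j) (h j))) {..<k}"
    by (rule L2_set_mono) (simp_all add: blinfun.add_left sum.distrib norm_triangle_ineq)
  also have "\<dots> \<le> L2_set (\<lambda>i. norm (\<Sum>j<k. blinfun_apply (x i j) (h j))) {..<k} +
      L2_set (\<lambda>i. norm (\<Sum>j<k. blinfun_apply (y i j) (h j))) {..<k}"
    by (rule L2_set_triangle_ineq)
  also have "\<dots> \<le> mat_norm k x * L2_set (\<lambda>j. norm (h j)) {..<k} + mat_norm k y * L2_set (\<lambda>j. norm (h j)) {..<k}"
    by (intro add_mono mat_norm_apply_L2)
  finally show "L2_set (\<lambda>i. norm (\<Sum>j<k. blinfun_apply (x i j + y i j) (h j))) {..<k} \<le>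
      (mat_norm k x + mat_norm k y) * L2_set (\<lambda>j. norm (h j)) {..<k}"
    by (simp add: distrib_right)
qed (simp add: mat_norm_nonneg)

lemma mat_norm_sum: "mat_norm k (\<lambda>s t. \<Sum>i\<in>I. x i s t) \<le> (\<Sum>i\<in>I. mat_norm k (x i))"
proof (induction I rule: infinite_finite_induct)
  case (insert i I)
  then show ?case
    using mat_norm_add[of k "x i" "\<lambda>s t. \<Sum>i\<in>I. x i s t"] by simp
qed (auto intro!: mat_norm_leI)

text \<open>The operator \<beta> \<otimes> 1 acts on each coordinate separately, once all
  \<open>h t\<close> are expanded in one orthonormal system.\<close>

lemma contraction_amplify:
  fixes h :: "nat \<Rightarrow> 'a::complex_hilbert"
  assumes "op_sq_bound {..<N} {..<N} \<beta> 1"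
  shows "(\<Sum>s<N. (norm (\<Sum>t<N. \<beta> s t *\<^sub>C h t))\<^sup>2) \<le> (\<Sum>t<N. (norm (h t))\<^sup>2)"
proof -
  have "corthonormal ({} :: 'a set)"
    by (simp add: corthonormal_def)
  from Gram_Schmidt_extension[OF this, where S = UNIV and xs = "map h [0..<N]"]
  obtain B where B: "corthonormal B" "\<And>t. t < N \<Longrightarrow> cexpands B (h t)"
    by auto
  have "(\<Sum>t<N. \<beta> s t *\<^sub>C h t) = (\<Sum>t<N. \<beta> s t *\<^sub>C (\<Sum>f\<in>B. cinner f (h t) *\<^sub>C f))" for s
    using B(2) by (simp add: cexpands_def)
  also have "\<dots> s = (\<Sum>f\<in>B. (\<Sum>t<N. \<beta> s t * cinner f (h t)) *\<^sub>C f)" for s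
    unfolding scaleC_sum_left scaleC_sum_right by (subst sum.swap) (simp add: scaleC_scaleC)
  finally have "(norm (\<Sum>t<N. \<beta> s t *\<^sub>C h t))\<^sup>2 = (\<Sum>f\<in>B. (cmod (\<Sum>t<N. \<beta> s t * cinner f (h t)))\<^sup>2)" for s
    by (simp add: norm_corthonormal_sum[OF B(1)])
  then have "(\<Sum>s<N. (norm (\<Sum>t<N. \<beta> s t *\<^sub>C h t))\<^sup>2) = (\<Sum>f\<in>B. \<Sum>s<N. (cmod (\<Sum>t<N. \<beta> s t * cinner f (h t)))\<^sup>2)"
    by (simp add: sum.swap[of _ B])
  also have "\<dots> \<le> (\<Sum>f\<in>B. \<Sum>t<N. (cmod (cinner f (h t)))\<^sup>2)"
    by (rule sum_mono) (use assms in \<open>simp add: op_sq_bound_def\<close>)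
  also have "\<dots> = (\<Sum>t<N. (norm (h t))\<^sup>2)"
    by (subst sum.swap) (simp add: cexpands_norm[OF B(1) B(2)])
  finally show ?thesis .
qed

lemma mat_norm_scalar_matrix:
  assumes "op_sq_bound {..<N} {..<N} \<beta> 1" "d \<in> bop"
  shows "mat_norm N (\<lambda>s t. scale_op (\<beta> s t) d) \<le> norm d"
proof (rule mat_norm_leI)
  fix h
  have "(\<Sum>t<N. blinfun_apply (scale_op (\<beta> s t) d) (h t)) = blinfun_apply d (\<Sum>t<N. \<beta> s t *\<^sub>C h t)" for s
    by (simp add: scale_op.rep_eq blinfun_bop_sum[OF assms(2)])
  then have "(\<Sum>s<N. (norm (\<Sum>t<N. blinfun_apply (scale_op (\<beta> s t) d) (h t)))\<^sup>2) \<le>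
      (\<Sum>s<N. (norm d * norm (\<Sum>t<N. \<beta> s t *\<^sub>C h t))\<^sup>2)"
    by (intro sum_mono power_mono) (simp_all add: norm_blinfun)
  also have "\<dots> \<le> (norm d)\<^sup>2 * (\<Sum>t<N. (norm (h t))\<^sup>2)"
    unfolding power_mult_distrib sum_distrib_left[symmetric]
    by (intro mult_left_mono contraction_amplify assms) simp
  finally show "(\<Sum>s<N. (norm (\<Sum>t<N. blinfun_apply (scale_op (\<beta> s t) d) (h t)))\<^sup>2) \<le>
      (norm d)\<^sup>2 * (\<Sum>t<N. (norm (h t))\<^sup>2)" .
qed simp

lemma scale_op_diff: "scale_op c (S - T) = scale_op c S - scale_op c T"
proof (rule blinfun_eqI)
  fix x
  have "c *\<^sub>C (u - v) = c *\<^sub>C u - c *\<^sub>C v" for u v :: 'a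
    using scaleC_add_right[of c "u - v" v] by simp
  then show "blinfun_apply (scale_op c (S - T)) x = blinfun_apply (scale_op c S - scale_op c T) x"
    by (simp add: scale_op.rep_eq blinfun.diff_left)
qed

lemma bop_diff: "S \<in> bop \<Longrightarrow> T \<in> bop \<Longrightarrow> S - T \<in> bop"
proof -
  have "c *\<^sub>C (u - v) = c *\<^sub>C u - c *\<^sub>C v" for c and u v :: 'a
    using scaleC_add_right[of c "u - v" v] by simp
  then show "S \<in> bop \<Longrightarrow> T \<in> bop \<Longrightarrow> S - T \<in> bop"
    by (simp add: bop_def blinfun.diff_left)
qed

text \<open>The error does not depend on \<open>N\<close>, which is essential: the compact operators
  are truncated before the size \<open>N\<close> of the coefficient matrices is known.\<close>

lemma mat_norm_perturb:
  assumes "\<And>i. i < n \<Longrightarrow> op_sq_bound {..<N} {..<N} (\<beta> i) 1"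
    and "\<And>i. i < n \<Longrightarrow> x i \<in> bop" "\<And>i. i < n \<Longrightarrow> y i \<in> bop"
  shows "mat_norm N (\<lambda>s t. \<Sum>i<n. scale_op (\<beta> i s t) (x i)) \<le>
    mat_norm N (\<lambda>s t. \<Sum>i<n. scale_op (\<beta> i s t) (y i)) + (\<Sum>i<n. norm (x i - y i))"
proof -
  have eq: "(\<lambda>s t. \<Sum>i<n. scale_op (\<beta> i s t) (x i)) =
      (\<lambda>s t. (\<Sum>i<n. scale_op (\<beta> i s t) (y i)) + (\<Sum>i<n. scale_op (\<beta> i s t) (x i - y i)))"
    by (simp add: scale_op_diff sum_subtractf)
  have "mat_norm N (\<lambda>s t. \<Sum>i<n. scale_op (\<beta> i s t) (x i - y i)) \<le>
      (\<Sum>i<n. mat_norm N (\<lambda>s t. scale_op (\<beta> i s t) (x i - y i)))"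
    by (rule mat_norm_sum)
  also have "\<dots> \<le> (\<Sum>i<n. norm (x i - y i))"
    by (intro sum_mono mat_norm_scalar_matrix assms bop_diff) auto
  finally show ?thesis
    unfolding eq using mat_norm_add[of N "\<lambda>s t. \<Sum>i<n. scale_op (\<beta> i s t) (y i)"
        "\<lambda>s t. \<Sum>i<n. scale_op (\<beta> i s t) (x i - y i)"] by linarith
qed

text \<open>Test on the maximally entangled vector \<open>\<Sum>\<^sub>t e\<^sub>t \<otimes> e\<^sub>t\<close>.\<close>

lemma mat_norm_conj_ge:
  assumes N: "N > 0"
  shows "(\<Sum>i<n. \<Sum>s<N. \<Sum>t<N. (cmod (\<alpha> i s t))\<^sup>2) / real N \<le>
    mat_norm N (\<lambda>s t. \<Sum>i<n. scale_op (cnj (\<alpha> i s t)) (matop N (\<alpha> i)))"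
    (is "_ \<le> mat_norm N ?z")
proof -
  define w where "w s = (\<Sum>t<N. blinfun_apply (?z s t) (ebase t))" for s
  define c where "c s = (\<Sum>t<N. \<Sum>i<n. (cmod (\<alpha> i s t))\<^sup>2)" for s
  \<comment> \<open>Only the diagonal coordinates of the image are kept; their sum is its inner
    product with the entangled vector.\<close>
  have "ell2_nth (w s) s = of_real (c s)" if "s < N" for s
  proof -
    have "(\<Sum>r<N. \<alpha> i s r * (if r = t then 1 else 0)) = \<alpha> i s t" if "t < N" for i t
    proof -
      have "(\<Sum>r<N. \<alpha> i s r * (if r = t then 1 else 0)) = (\<Sum>r<N. if r = t then \<alpha> i s r else 0)"
        by (intro sum.cong) auto
      then show ?thesis using that by simp
    qed
    then show ?thesis
      using that
      by (simp add: w_def c_def blinfun.sum_left scale_op.rep_eq ell2_nth_sum ell2_nth_scaleC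
          matop.rep_eq evec.rep_eq ell2_nth_ebase complex_norm_square mult.commute del: of_real_power)
  qed
  then have "(c s)\<^sup>2 \<le> (norm (w s))\<^sup>2" if "s < N" for s
    using that cmod_ell2_nth_le[of "w s" s] by (intro power2_le_iff_abs_le[THEN iffD2]) auto
  then have "(\<Sum>s<N. (c s)\<^sup>2) \<le> (\<Sum>s<N. (norm (w s))\<^sup>2)"
    by (intro sum_mono) auto
  also have "\<dots> \<le> (mat_norm N ?z)\<^sup>2 * (\<Sum>t<N. (norm (ebase t))\<^sup>2)"
    unfolding w_def by (rule mat_norm_apply)
  also have "(\<Sum>t<N. (norm (ebase t))\<^sup>2) = real N"
  proof -
    have "(norm (ebase t))\<^sup>2 = 1" for t
      using cinner_self[of "ebase t"] cinner_ebase_ebase[of t t] by (metis of_real_eq_1_iff)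
    then show ?thesis by simp
  qed
  finally have "(\<Sum>s<N. (c s)\<^sup>2) \<le> (mat_norm N ?z)\<^sup>2 * real N" .
  moreover have "(\<Sum>s<N. c s)\<^sup>2 \<le> (\<Sum>s<N. (c s)\<^sup>2) * real N"
    using sum_squared_le_sum_of_squares[of c "{..<N}"] N by simp
  ultimately have "(\<Sum>s<N. c s)\<^sup>2 \<le> (mat_norm N ?z)\<^sup>2 * real N * real N"
    using mult_right_mono[of "\<Sum>s<N. (c s)\<^sup>2" _ "real N"] by fastforce
  then have "(\<Sum>s<N. c s)\<^sup>2 \<le> (mat_norm N ?z * real N)\<^sup>2"
    by (simp add: power2_eq_square mult_ac)
  then have "(\<Sum>s<N. c s) \<le> mat_norm N ?z * real N"
    by (rule power2_le_imp_le) (simp add: mat_norm_nonneg)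
  moreover have "(\<Sum>s<N. c s) = (\<Sum>i<n. \<Sum>s<N. \<Sum>t<N. (cmod (\<alpha> i s t))\<^sup>2)"
    unfolding c_def by (subst (2) sum.swap, subst sum.swap) simp
  ultimately show ?thesis
    using N by (simp add: field_simps)
qed

section \<open>Amplifications of completely bounded maps\<close>

lemma scale_op_scale_op: "scale_op c (scale_op d T) = scale_op (c * d) T"
  by (rule blinfun_eqI) (simp add: scale_op.rep_eq scaleC_scaleC)

lemma scale_op_one: "scale_op 1 T = T"
  by (rule blinfun_eqI) (simp add: scale_op.rep_eq)

lemma mat_norm_scale:
  assumes "r \<ge> 0"
  shows "mat_norm k (\<lambda>i j. scale_op (of_real r) (x i j)) \<le> r * mat_norm k x"
proof (rule mat_norm_leI)
  fix h
  have "(\<Sum>j<k. blinfun_apply (scale_op (of_real r) (x i j)) (h j)) = r *\<^sub>R (\<Sum>j<k. blinfun_apply (x i j) (h j))" for i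
    by (simp add: scale_op.rep_eq scaleC_of_real scaleR_sum_right)
  then have "(\<Sum>i<k. (norm (\<Sum>j<k. blinfun_apply (scale_op (of_real r) (x i j)) (h j)))\<^sup>2) =
      r\<^sup>2 * (\<Sum>i<k. (norm (\<Sum>j<k. blinfun_apply (x i j) (h j)))\<^sup>2)"
    by (simp add: power_mult_distrib sum_distrib_left)
  also have "\<dots> \<le> r\<^sup>2 * ((mat_norm k x)\<^sup>2 * (\<Sum>j<k. (norm (h j))\<^sup>2))"
    by (intro mult_left_mono mat_norm_apply) simp
  finally show "(\<Sum>i<k. (norm (\<Sum>j<k. blinfun_apply (scale_op (of_real r) (x i j)) (h j)))\<^sup>2) \<le>
      (r * mat_norm k x)\<^sup>2 * (\<Sum>j<k. (norm (h j))\<^sup>2)"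
    by (simp add: power_mult_distrib mult_ac)
qed (simp add: assms mat_norm_nonneg)

text \<open>Rescaling to the unit ball by a positive upper bound \<open>\<delta>\<close>, instead of
  the norm itself, avoids a separate case of norm zero.\<close>

lemma mat_norm_cb_le:
  assumes cb: "cb_norm E u = ennreal c" "c \<ge> 0" and k: "k \<ge> 1" and \<delta>: "\<delta> > 0"
    and E: "\<And>c T. T \<in> E \<Longrightarrow> scale_op c T \<in> E"
    and u: "\<And>c T. T \<in> E \<Longrightarrow> u (scale_op c T) = scale_op c (u T)"
    and x: "\<And>i j. x i j \<in> E" and le: "mat_norm k x \<le> \<delta>"
  shows "mat_norm k (\<lambda>i j. u (x i j)) \<le> c * \<delta>"
proof -
  define y where "y i j = scale_op (of_real (1 / \<delta>)) (x i j)" for i j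
  have "mat_norm k y \<le> 1 / \<delta> * mat_norm k x"
    unfolding y_def using \<delta> by (intro mat_norm_scale) simp
  also have "\<dots> \<le> 1" using le \<delta> by simp
  finally have "mat_norm k y \<le> 1" .
  then have "y \<in> {x. (\<forall>i<k. \<forall>j<k. x i j \<in> E) \<and> mat_norm k x \<le> 1}"
    using x E by (simp add: y_def)
  then have "ennreal (mat_norm k (\<lambda>i j. u (y i j))) \<le> cb_norm E u"
    unfolding cb_norm_def using k by (intro SUP_upper2[of k] SUP_upper) auto
  then have yc: "mat_norm k (\<lambda>i j. u (y i j)) \<le> c"
    using cb by simp
  have "u (x i j) = scale_op (of_real \<delta>) (u (y i j))" for i j
    unfolding y_def u[OF x] scale_op_scale_op using \<delta> by (simp add: scale_op_one flip: of_real_mult)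
  then have "mat_norm k (\<lambda>i j. u (x i j)) \<le> \<delta> * mat_norm k (\<lambda>i j. u (y i j))"
    using mat_norm_scale[of \<delta> k "\<lambda>i j. u (y i j)"] \<delta> by simp
  also have "\<dots> \<le> \<delta> * c" using yc \<delta> by (intro mult_left_mono) auto
  finally show ?thesis by (simp add: mult.commute)
qed


section \<open>The regular tree\<close>

text \<open>Cauchy-Schwarz with the weights \<open>A x y * \<omega> y\<close> and
  \<open>A x y / \<omega> y\<close>; the row estimate is used twice, the second time for the columns
  by symmetry.\<close>

lemma Schur_test:
  fixes A :: "'x \<Rightarrow> 'x \<Rightarrow> real"
  assumes I: "finite I" and pos: "\<And>x y. A x y \<ge> 0" and sym: "\<And>x y. x \<in> I \<Longrightarrow> y \<in> I \<Longrightarrow> A x y = A y x"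
    and \<omega>: "\<And>x. x \<in> I \<Longrightarrow> \<omega> x > 0" and R: "R \<ge> 0"
    and le: "\<And>x. x \<in> I \<Longrightarrow> (\<Sum>y\<in>I. A x y * \<omega> y) \<le> R * \<omega> x"
  shows "op_sq_bound I I (\<lambda>x y. of_real (A x y)) (R\<^sup>2)"
  unfolding op_sq_bound_def
proof
  fix g :: "'x \<Rightarrow> complex"
  have row: "(cmod (\<Sum>y\<in>I. of_real (A x y) * g y))\<^sup>2 \<le> R * \<omega> x * (\<Sum>y\<in>I. A x y * ((cmod (g y))\<^sup>2 / \<omega> y))"
    if x: "x \<in> I" for x
  proof -
    have "cmod (\<Sum>y\<in>I. of_real (A x y) * g y) \<le> (\<Sum>y\<in>I. A x y * cmod (g y))"
      by (rule sum_norm_le) (simp add: norm_mult pos)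
    also have "\<dots> = (\<Sum>y\<in>I. sqrt (A x y * \<omega> y) * sqrt (A x y * ((cmod (g y))\<^sup>2 / \<omega> y)))"
    proof (rule sum.cong)
      fix y assume "y \<in> I"
      then have "A x y * \<omega> y * (A x y * ((cmod (g y))\<^sup>2 / \<omega> y)) = (A x y * cmod (g y))\<^sup>2"
        using \<omega>[of y] by (simp add: field_simps power2_eq_square)
      then show "A x y * cmod (g y) = sqrt (A x y * \<omega> y) * sqrt (A x y * ((cmod (g y))\<^sup>2 / \<omega> y))"
        unfolding real_sqrt_mult[symmetric] using pos[of x y] by (simp del: mult_eq_0_iff)
    qed simp
    finally have "(cmod (\<Sum>y\<in>I. of_real (A x y) * g y))\<^sup>2 \<le>
        (\<Sum>y\<in>I. sqrt (A x y * \<omega> y) * sqrt (A x y * ((cmod (g y))\<^sup>2 / \<omega> y)))\<^sup>2"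
      by (simp add: power_mono)
    also have "\<dots> \<le> (\<Sum>y\<in>I. (sqrt (A x y * \<omega> y))\<^sup>2) * (\<Sum>y\<in>I. (sqrt (A x y * ((cmod (g y))\<^sup>2 / \<omega> y)))\<^sup>2)"
      by (rule Cauchy_Schwarz_ineq_sum)
    also have "\<dots> = (\<Sum>y\<in>I. A x y * \<omega> y) * (\<Sum>y\<in>I. A x y * ((cmod (g y))\<^sup>2 / \<omega> y))"
      using pos \<omega> by (intro arg_cong2[where f = "(*)"] sum.cong) (auto simp: less_imp_le)
    also have "\<dots> \<le> R * \<omega> x * (\<Sum>y\<in>I. A x y * ((cmod (g y))\<^sup>2 / \<omega> y))"
      using pos \<omega> by (intro mult_right_mono le x sum_nonneg) (auto simp: less_imp_le)
    finally show ?thesis .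
  qed
  have "(\<Sum>x\<in>I. (cmod (\<Sum>y\<in>I. of_real (A x y) * g y))\<^sup>2) \<le>
      (\<Sum>x\<in>I. R * \<omega> x * (\<Sum>y\<in>I. A x y * ((cmod (g y))\<^sup>2 / \<omega> y)))"
    by (rule sum_mono) (rule row)
  also have "\<dots> = (\<Sum>y\<in>I. \<Sum>x\<in>I. R * \<omega> x * (A x y * ((cmod (g y))\<^sup>2 / \<omega> y)))"
    unfolding sum_distrib_left by (rule sum.swap)
  also have "\<dots> = (\<Sum>y\<in>I. R * ((cmod (g y))\<^sup>2 / \<omega> y) * (\<Sum>x\<in>I. A y x * \<omega> x))"
    unfolding sum_distrib_left
    by (intro sum.cong refl) (auto simp: sym mult_ac)
  also have "\<dots> \<le> (\<Sum>y\<in>I. R * ((cmod (g y))\<^sup>2 / \<omega> y) * (R * \<omega> y))"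
    using \<omega> R by (intro sum_mono mult_left_mono le) (auto simp: less_imp_le)
  also have "\<dots> = (\<Sum>y\<in>I. R\<^sup>2 * (cmod (g y))\<^sup>2)"
  proof (rule sum.cong)
    fix y assume "y \<in> I"
    then show "R * ((cmod (g y))\<^sup>2 / \<omega> y) * (R * \<omega> y) = R\<^sup>2 * (cmod (g y))\<^sup>2"
      using \<omega>[of y] by (simp add: power2_eq_square)
  qed simp
  finally show "(\<Sum>x\<in>I. (cmod (\<Sum>y\<in>I. of_real (A x y) * g y))\<^sup>2) \<le> R\<^sup>2 * (\<Sum>y\<in>I. (cmod (g y))\<^sup>2)"
    by (simp add: sum_distrib_left)
qed

text \<open>
  Words without equal adjacent letters are the elements of the free product of \<open>n\<close> copies of the
  group of order two, and \<open>flip i\<close> is left multiplication by the \<open>i\<close>-th generator. The Cayley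
  graph is the \<open>n\<close>-regular tree.
\<close>

definition rwords :: "nat \<Rightarrow> nat \<Rightarrow> nat list set" where
  "rwords n L = {w. set w \<subseteq> {..<n} \<and> length w \<le> L \<and> distinct_adj w}"

fun flip :: "nat \<Rightarrow> nat list \<Rightarrow> nat list" where
  "flip i [] = [i]"
| "flip i (j # w) = (if j = i then w else i # j # w)"

lemma finite_rwords: "finite (rwords n L)"
  by (rule finite_subset[OF _ finite_lists_length_le[of "{..<n}" L]]) (auto simp: rwords_def)

lemma Nil_in_rwords: "[] \<in> rwords n L"
  by (simp add: rwords_def)

lemma flip_flip: "distinct_adj w \<Longrightarrow> flip i (flip i w) = w"
  by (cases w rule: remdups_adj.cases) auto

lemma flip_in_rwords: "w \<in> rwords n L \<Longrightarrow> i < n \<Longrightarrow> length w < L \<Longrightarrow> flip i w \<in> rwords n L"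
  by (cases w) (auto simp: rwords_def distinct_adj_Cons)

lemma length_flip_ge: "length w \<le> Suc (length (flip i w))"
  by (cases w) auto

lemma flip_eq_iff:
  "w \<in> rwords n L \<Longrightarrow> w' \<in> rwords n L \<Longrightarrow> w' = flip i w \<longleftrightarrow> w = flip i w'"
  by (auto simp: rwords_def flip_flip)

text \<open>With \<open>r\<^sup>2 = n - 1\<close> this is the spherical function of the n-regular
  tree at the edge of its spectrum: a positive radial eigenfunction of the adjacency operator with
  eigenvalue \<open>2 * r\<close>. The linear factor appears because the recursion in the distance
  has the double characteristic root \<open>1 / r\<close>; its slope is fixed by the equation at the
  root of the tree.\<close>

definition tree_weight :: "real \<Rightarrow> nat \<Rightarrow> real" where
  "tree_weight r d = (1 + (r\<^sup>2 - 1) / (r\<^sup>2 + 1) * real d) / r ^ d"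

lemma tree_weight_pos: "r \<ge> 1 \<Longrightarrow> tree_weight r d > 0"
  unfolding tree_weight_def by (intro divide_pos_pos add_pos_nonneg) auto

lemma tree_weight_root: "r \<ge> 1 \<Longrightarrow> (r\<^sup>2 + 1) * tree_weight r 1 = 2 * r * tree_weight r 0"
proof -
  assume r: "r \<ge> 1"
  have p: "r\<^sup>2 + 1 \<noteq> 0" by (simp add: add_nonneg_eq_0_iff)
  have "(r\<^sup>2 + 1) * (1 + (r\<^sup>2 - 1) / (r\<^sup>2 + 1)) = 2 * r\<^sup>2"
    using p by (simp add: distrib_left)
  then show ?thesis
    using r by (simp add: tree_weight_def power2_eq_square)
qed

lemma tree_weight_step:
  assumes "r \<ge> 1"
  shows "tree_weight r d + r\<^sup>2 * tree_weight r (Suc (Suc d)) = 2 * r * tree_weight r (Suc d)"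
proof -
  define c where "c = (r\<^sup>2 - 1) / (r\<^sup>2 + 1)"
  show ?thesis
    using assms unfolding tree_weight_def c_def[symmetric]
    by (simp add: field_simps power2_eq_square)
qed

text \<open>The root has \<open>r\<^sup>2 + 1\<close> neighbours at distance one; every other vertex
  has one neighbour nearer to the root and \<open>r\<^sup>2\<close> neighbours farther away. These
  cases are \<open>tree_weight_root\<close> and \<open>tree_weight_step\<close>.\<close>

lemma tree_weight_sum:
  assumes n: "n \<ge> 2" and w: "set w \<subseteq> {..<n}" and r: "r = sqrt (real n - 1)"
  shows "(\<Sum>i<n. tree_weight r (length (flip i w))) = 2 * r * tree_weight r (length w)"
proof -
  have r1: "r \<ge> 1" and nr: "real n = r\<^sup>2 + 1"
    using n by (auto simp: r)
  show ?thesis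
  proof (cases w)
    case Nil
    then show ?thesis
      using tree_weight_root[OF r1] by (simp add: nr)
  next
    case (Cons j v)
    then have j: "j \<in> {..<n}" using w by simp
    have "(\<Sum>i<n. tree_weight r (length (flip i w))) =
        tree_weight r (length (flip j w)) + (\<Sum>i\<in>{..<n} - {j}. tree_weight r (length (flip i w)))"
      using j by (subst sum.remove[of _ j]) auto
    also have "(\<Sum>i\<in>{..<n} - {j}. tree_weight r (length (flip i w))) =
        (\<Sum>i\<in>{..<n} - {j}. tree_weight r (Suc (Suc (length v))))"
      using Cons by (intro sum.cong) auto
    also have "\<dots> = r\<^sup>2 * tree_weight r (Suc (Suc (length v)))"
      using j n nr by (simp add: of_nat_diff)
    finally show ?thesis
      using tree_weight_step[OF r1, of "length v"] Cons by simp
  qed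
qed

definition tree_adj :: "nat \<Rightarrow> nat list \<Rightarrow> nat list \<Rightarrow> complex" where
  "tree_adj i w w' = (if w' = flip i w then 1 else 0)"

text \<open>
  Fell's absorption principle in its simplest form: the Schur weight of the first tensor factor
  alone is a Schur weight for the diagonal action.
\<close>

lemma tree_norm_le:
  assumes n: "n \<ge> 2" and e: "bij_betw e {..<N} (rwords n L)"
  shows "mat_norm N (\<lambda>s t. \<Sum>i<n. scale_op (cnj (tree_adj i (e s) (e t)))
      (matop N (\<lambda>s t. tree_adj i (e s) (e t)))) \<le> 2 * sqrt (real n - 1)"
proof (rule mat_norm_matop_le)
  define r where "r = sqrt (real n - 1)"
  have r1: "r \<ge> 1" using n by (simp add: r_def)
  let ?I = "{..<N} \<times> {..<N}"
  define \<delta> :: "nat \<Rightarrow> nat \<Rightarrow> nat \<Rightarrow> real" where "\<delta> i s t = (if e t = flip i (e s) then 1 else 0)" for i s t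
  define A where "A x y = (\<Sum>i<n. \<delta> i (fst x) (fst y) * \<delta> i (snd x) (snd y))" for x y
  have eW: "e s \<in> rwords n L" if "s < N" for s
    using e that by (auto simp: bij_betw_def)
  have \<delta>0: "\<delta> i s t \<ge> 0" for i s t by (simp add: \<delta>_def)
  have \<delta>sym: "\<delta> i s t = \<delta> i t s" if "s < N" "t < N" for i s t
    using flip_eq_iff[OF eW[OF that(1)] eW[OF that(2)]] by (simp add: \<delta>_def)
  \<comment> \<open>An inequality, since the neighbour of a boundary word may lie outside the ball
    and its nonnegative weight is then lost.\<close>
  have row: "(\<Sum>t<N. \<delta> i s t * \<phi> (e t)) \<le> \<phi> (flip i (e s))"
    if "\<And>w. \<phi> w \<ge> 0" for \<phi> :: "nat list \<Rightarrow> real" and i s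
  proof -
    have "(\<Sum>t<N. \<delta> i s t * \<phi> (e t)) = (\<Sum>w\<in>rwords n L. if w = flip i (e s) then \<phi> w else 0)"
      unfolding \<delta>_def
      by (subst sum.reindex_bij_betw[OF e, symmetric]) (intro sum.cong refl, auto)
    also have "\<dots> \<le> \<phi> (flip i (e s))"
      using that by (simp add: finite_rwords)
    finally show ?thesis .
  qed
  have "op_sq_bound ?I ?I (\<lambda>x y. of_real (A x y)) ((2 * r)\<^sup>2)"
  proof (rule Schur_test[where \<omega> = "\<lambda>x. tree_weight r (length (e (fst x)))"])
    fix x assume x: "x \<in> ?I"
    have "(\<Sum>y\<in>?I. A x y * tree_weight r (length (e (fst y)))) =
        (\<Sum>y\<in>?I. \<Sum>i<n. \<delta> i (fst x) (fst y) * tree_weight r (length (e (fst y))) * \<delta> i (snd x) (snd y))"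
      by (simp add: A_def sum_distrib_left mult_ac)
    also have "\<dots> = (\<Sum>i<n. \<Sum>y\<in>?I. \<delta> i (fst x) (fst y) * tree_weight r (length (e (fst y))) * \<delta> i (snd x) (snd y))"
      by (rule sum.swap)
    also have "\<dots> = (\<Sum>i<n. (\<Sum>b<N. \<delta> i (fst x) b * tree_weight r (length (e b))) * (\<Sum>t<N. \<delta> i (snd x) t))"
      by (simp add: sum_product sum.cartesian_product case_prod_beta)
    \<comment> \<open>For each generator the second coordinate has at most one neighbour, so the sum
      without weight is at most 1.\<close>
    also have "\<dots> \<le> (\<Sum>i<n. tree_weight r (length (flip i (e (fst x)))) * 1)"
    proof (intro sum_mono mult_mono)
      fix i
      show "(\<Sum>b<N. \<delta> i (fst x) b * tree_weight r (length (e b))) \<le> tree_weight r (length (flip i (e (fst x))))"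
        using row[of "\<lambda>w. tree_weight r (length w)"] tree_weight_pos[OF r1] by (simp add: less_imp_le)
      show "(\<Sum>t<N. \<delta> i (snd x) t) \<le> 1"
        using row[of "\<lambda>_. 1" i "snd x"] by simp
    qed (auto intro!: sum_nonneg \<delta>0 tree_weight_pos[OF r1, THEN less_imp_le])
    also have "\<dots> = 2 * r * tree_weight r (length (e (fst x)))"
      using x eW[of "fst x"] tree_weight_sum[OF n _ r_def] by (auto simp: rwords_def)
    finally show "(\<Sum>y\<in>?I. A x y * tree_weight r (length (e (fst y)))) \<le>
        2 * r * tree_weight r (length (e (fst x)))" .
  next
    show "A x y = A y x" if "x \<in> ?I" "y \<in> ?I" for x y
      unfolding A_def using that by (intro sum.cong refl arg_cong2[where f = "(*)"] \<delta>sym) auto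
  qed (use r1 in \<open>auto intro!: sum_nonneg mult_nonneg_nonneg \<delta>0 tree_weight_pos simp: A_def\<close>)
  moreover have "(\<lambda>x y. complex_of_real (A x y)) =
      amp n (\<lambda>i s t. tree_adj i (e s) (e t)) (\<lambda>i s t. cnj (tree_adj i (e s) (e t)))"
    by (intro ext) (auto simp: A_def amp_def \<delta>_def tree_adj_def intro!: sum.cong)
  ultimately show "op_sq_bound ?I ?I
      (amp n (\<lambda>i s t. tree_adj i (e s) (e t)) (\<lambda>i s t. cnj (tree_adj i (e s) (e t)))) ((2 * sqrt (real n - 1))\<^sup>2)"
    by (simp add: r_def)
qed (use n in simp)


section \<open>Finite permutation models\<close>

definition mv :: "'y set \<Rightarrow> ('x \<Rightarrow> 'y \<Rightarrow> complex) \<Rightarrow> ('y \<Rightarrow> complex) \<Rightarrow> 'x \<Rightarrow> complex" where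
  "mv J A g x = (\<Sum>y\<in>J. A x y * g y)"

lemma op_sq_bound_mv:
  "op_sq_bound I J A c \<longleftrightarrow> (\<forall>g. (\<Sum>x\<in>I. (cmod (mv J A g x))\<^sup>2) \<le> c * (\<Sum>y\<in>J. (cmod (g y))\<^sup>2))"
  by (simp add: op_sq_bound_def mv_def)

lemma mv_cong: "(\<And>y. y \<in> J \<Longrightarrow> g y = g' y) \<Longrightarrow> mv J A g = mv J A g'"
  by (intro ext) (simp add: mv_def)

lemma cmod_sum_mult_sq_le:
  "(cmod (\<Sum>x\<in>I. f x * g x))\<^sup>2 \<le> (\<Sum>x\<in>I. (cmod (f x))\<^sup>2) * (\<Sum>x\<in>I. (cmod (g x))\<^sup>2)"
proof -
  have "cmod (\<Sum>x\<in>I. f x * g x) \<le> (\<Sum>x\<in>I. cmod (f x) * cmod (g x))"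
    by (rule sum_norm_le) (simp add: norm_mult)
  then have "(cmod (\<Sum>x\<in>I. f x * g x))\<^sup>2 \<le> (\<Sum>x\<in>I. cmod (f x) * cmod (g x))\<^sup>2"
    by (simp add: power_mono)
  then show ?thesis
    by (rule order_trans[OF _ Cauchy_Schwarz_ineq_sum])
qed

lemma le_of_sq_le_mult:
  fixes a b :: real
  assumes "a\<^sup>2 \<le> b * a" "a \<ge> 0" "b \<ge> 0"
  shows "a \<le> b"
  using assms by (cases "a = 0") (auto simp: power2_eq_square)

text \<open>For \<open>v\<close> the adjoint applied to \<open>h\<close>, the square norm of
  \<open>v\<close> is the modulus of the inner product of \<open>h\<close> with the image of
  \<open>v\<close> under \<open>A\<close>. Cauchy-Schwarz and the bound for \<open>A\<close> leave
  one factor \<open>nn\<close> to cancel.\<close>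

lemma op_sq_bound_adjoint:
  assumes "op_sq_bound I J A c" "c \<ge> 0"
  shows "op_sq_bound J I (\<lambda>y x. cnj (A x y)) c"
  unfolding op_sq_bound_mv
proof
  fix h
  define v where "v = mv I (\<lambda>y x. cnj (A x y)) h"
  define nn where "nn = (\<Sum>y\<in>J. (cmod (v y))\<^sup>2)"
  have "complex_of_real nn = (\<Sum>y\<in>J. cnj (v y) * v y)"
    by (simp add: nn_def complex_norm_square mult.commute del: of_real_power)
  also have "\<dots> = (\<Sum>y\<in>J. \<Sum>x\<in>I. cnj (v y) * (cnj (A x y) * h x))"
    by (subst (2) v_def) (simp add: mv_def sum_distrib_left)
  also have "\<dots> = (\<Sum>x\<in>I. \<Sum>y\<in>J. cnj (v y) * (cnj (A x y) * h x))"
    by (rule sum.swap)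
  also have "\<dots> = (\<Sum>x\<in>I. h x * cnj (mv J A v x))"
    by (simp add: mv_def sum_distrib_left mult_ac)
  finally have "nn\<^sup>2 = (cmod (\<Sum>x\<in>I. h x * cnj (mv J A v x)))\<^sup>2"
    by (metis norm_of_real power2_abs)
  also have "\<dots> \<le> (\<Sum>x\<in>I. (cmod (h x))\<^sup>2) * (\<Sum>x\<in>I. (cmod (cnj (mv J A v x)))\<^sup>2)"
    by (rule cmod_sum_mult_sq_le)
  also have "\<dots> \<le> (\<Sum>x\<in>I. (cmod (h x))\<^sup>2) * (c * nn)"
    using assms(1) by (intro mult_left_mono) (auto simp: op_sq_bound_mv nn_def sum_nonneg)
  finally have "nn\<^sup>2 \<le> (c * (\<Sum>x\<in>I. (cmod (h x))\<^sup>2)) * nn"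
    by (simp add: mult_ac)
  then have "nn \<le> c * (\<Sum>x\<in>I. (cmod (h x))\<^sup>2)"
    by (rule le_of_sq_le_mult) (auto simp: nn_def assms(2) intro!: sum_nonneg mult_nonneg_nonneg)
  then show "(\<Sum>y\<in>J. (cmod (mv I (\<lambda>y x. cnj (A x y)) h y))\<^sup>2) \<le> c * (\<Sum>x\<in>I. (cmod (h x))\<^sup>2)"
    by (simp add: nn_def v_def)
qed

text \<open>The composition of \<open>A\<close> with its adjoint, \<open>A\<close> acting last,
  written as a function so that its powers are iterates \<open>^^\<close>.\<close>

definition gram_map :: "'x set \<Rightarrow> ('x \<Rightarrow> 'x \<Rightarrow> complex) \<Rightarrow> ('x \<Rightarrow> complex) \<Rightarrow> 'x \<Rightarrow> complex" where
  "gram_map I A g = mv I A (mv I (\<lambda>y x. cnj (A x y)) g)"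

lemma gram_map_pow_bound:
  assumes A: "op_sq_bound I I A c" and c: "c \<ge> 0"
  shows "(\<Sum>x\<in>I. (cmod ((gram_map I A ^^ p) g x))\<^sup>2) \<le> c ^ (2 * p) * (\<Sum>x\<in>I. (cmod (g x))\<^sup>2)"
proof (induction p)
  case (Suc p)
  define h where "h = (gram_map I A ^^ p) g"
  have "(\<Sum>x\<in>I. (cmod (gram_map I A h x))\<^sup>2) \<le> c * (\<Sum>x\<in>I. (cmod (mv I (\<lambda>y x. cnj (A x y)) h x))\<^sup>2)"
    unfolding gram_map_def using A by (simp add: op_sq_bound_mv)
  also have "\<dots> \<le> c * (c * (\<Sum>x\<in>I. (cmod (h x))\<^sup>2))"
    using op_sq_bound_adjoint[OF A c] c by (intro mult_left_mono) (simp_all add: op_sq_bound_mv)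
  also have "\<dots> \<le> c * (c * (c ^ (2 * p) * (\<Sum>x\<in>I. (cmod (g x))\<^sup>2)))"
    using Suc.IH c by (intro mult_left_mono) (simp_all add: h_def)
  finally show ?case
    by (simp add: h_def mult_ac)
qed simp

text \<open>A word whose neighbour leaves the ball is left fixed. The truncated reflection thus
  remains an involution, now of a finite set; this is a classical way to see that the free product
  is residually finite.\<close>

definition tree_perm :: "nat \<Rightarrow> nat \<Rightarrow> nat \<Rightarrow> nat list \<Rightarrow> nat list" where
  "tree_perm n L i w = (if w \<in> rwords n L \<and> flip i w \<in> rwords n L then flip i w else w)"

lemma tree_perm_tree_perm: "tree_perm n L i (tree_perm n L i w) = w"
  using flip_flip[of w i] by (auto simp: tree_perm_def rwords_def)

lemma tree_perm_permutes: "tree_perm n L i permutes rwords n L"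
  unfolding permutes_def
proof (intro conjI allI impI)
  fix y show "\<exists>!x. tree_perm n L i x = y"
    by (rule ex1I[of _ "tree_perm n L i y"]) (auto simp: tree_perm_tree_perm)
qed (simp add: tree_perm_def)

fun tree_act :: "nat \<Rightarrow> nat \<Rightarrow> nat list \<Rightarrow> nat list \<Rightarrow> nat list" where
  "tree_act n L [] = id"
| "tree_act n L (i # w) = tree_perm n L i \<circ> tree_act n L w"

text \<open>Cancellation of letters is respected because the generators act by involutions, so
  \<open>tree_act\<close> is the homomorphism of the free product into the permutations of the
  ball.\<close>

lemma tree_act_flip: "tree_act n L (flip i w) = tree_perm n L i \<circ> tree_act n L w"
  by (cases w) (auto simp: fun_eq_iff tree_perm_tree_perm)

definition perm_adj :: "(nat \<Rightarrow> nat \<Rightarrow> nat) \<Rightarrow> nat \<Rightarrow> nat \<Rightarrow> nat \<Rightarrow> complex" where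
  "perm_adj \<pi> i s t = (if t = \<pi> i s then 1 else 0)"

lemma sum_rotate:
  "(\<Sum>b\<in>A. \<Sum>s\<in>B. \<Sum>i\<in>C. F b s i) = (\<Sum>i\<in>C. \<Sum>b\<in>A. \<Sum>s\<in>B. F b s i)"
  for F :: "_ \<Rightarrow> _ \<Rightarrow> _ \<Rightarrow> 'c::comm_monoid_add"
proof -
  have "(\<Sum>b\<in>A. \<Sum>s\<in>B. \<Sum>i\<in>C. F b s i) = (\<Sum>b\<in>A. \<Sum>i\<in>C. \<Sum>s\<in>B. F b s i)"
    by (intro sum.cong refl sum.swap)
  also have "\<dots> = (\<Sum>i\<in>C. \<Sum>b\<in>A. \<Sum>s\<in>B. F b s i)"
    by (rule sum.swap)
  finally show ?thesis .
qed

lemma mv_amp_perm: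
  assumes "\<And>i. i < n \<Longrightarrow> \<pi> i t < N"
  shows "mv ({..<k} \<times> {..<N}) (amp n X (perm_adj \<pi>)) g (a, t) = (\<Sum>i<n. \<Sum>b<k. X i a b * g (b, \<pi> i t))"
proof -
  have "mv ({..<k} \<times> {..<N}) (amp n X (perm_adj \<pi>)) g (a, t) =
      (\<Sum>b<k. \<Sum>s<N. \<Sum>i<n. X i a b * perm_adj \<pi> i t s * g (b, s))"
    unfolding mv_def by (simp add: sum.cartesian_product' amp_def sum_distrib_right)
  also have "\<dots> = (\<Sum>i<n. \<Sum>b<k. \<Sum>s<N. X i a b * perm_adj \<pi> i t s * g (b, s))"
    by (rule sum_rotate)
  also have "\<dots> = (\<Sum>i<n. \<Sum>b<k. X i a b * g (b, \<pi> i t))"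
  proof (intro sum.cong refl)
    fix i b assume "i \<in> {..<n}"
    have "(\<Sum>s<N. X i a b * perm_adj \<pi> i t s * g (b, s)) = (\<Sum>s<N. if s = \<pi> i t then X i a b * g (b, s) else 0)"
      by (intro sum.cong) (auto simp: perm_adj_def)
    then show "(\<Sum>s<N. X i a b * perm_adj \<pi> i t s * g (b, s)) = X i a b * g (b, \<pi> i t)"
      using assms \<open>i \<in> {..<n}\<close> by simp
  qed
  finally show ?thesis .
qed

lemma mv_amp_tree:
  "mv ({..<k} \<times> rwords n L) (amp n X tree_adj) g (a, w) =
   (\<Sum>i<n. \<Sum>b<k. X i a b * (if flip i w \<in> rwords n L then g (b, flip i w) else 0))"
proof -
  let ?W = "rwords n L"
  have "mv ({..<k} \<times> ?W) (amp n X tree_adj) g (a, w) =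
      (\<Sum>b<k. \<Sum>s\<in>?W. \<Sum>i<n. X i a b * tree_adj i w s * g (b, s))"
    unfolding mv_def by (simp add: sum.cartesian_product' amp_def sum_distrib_right)
  also have "\<dots> = (\<Sum>i<n. \<Sum>b<k. \<Sum>s\<in>?W. X i a b * tree_adj i w s * g (b, s))"
    by (rule sum_rotate)
  also have "\<dots> = (\<Sum>i<n. \<Sum>b<k. X i a b * (if flip i w \<in> ?W then g (b, flip i w) else 0))"
  proof (intro sum.cong refl)
    fix i b
    have "(\<Sum>s\<in>?W. X i a b * tree_adj i w s * g (b, s)) =
        (\<Sum>s\<in>?W. if s = flip i w then X i a b * g (b, s) else 0)"
      by (intro sum.cong) (auto simp: tree_adj_def)
    then show "(\<Sum>s\<in>?W. X i a b * tree_adj i w s * g (b, s)) =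
        X i a b * (if flip i w \<in> ?W then g (b, flip i w) else 0)"
      by (simp add: finite_rwords)
  qed
  finally show ?thesis .
qed

text \<open>Since every flip is an involution, the adjoint has the same form, with each
  \<open>X i\<close> replaced by its adjoint. One intertwining argument then serves both factors of
  \<open>gram_map\<close>.\<close>

lemma amp_tree_adjoint:
  "mv ({..<k} \<times> rwords n L) (\<lambda>y x. cnj (amp n X tree_adj x y)) g (a, w) =
   mv ({..<k} \<times> rwords n L) (amp n (\<lambda>i a b. cnj (X i b a)) tree_adj) g (a, w)"
  if "w \<in> rwords n L"
  unfolding mv_def amp_def
proof (intro sum.cong refl)
  fix y assume "y \<in> {..<k} \<times> rwords n L"
  then have "tree_adj i w (snd y) = cnj (tree_adj i (snd y) w)" for i
    using flip_eq_iff[OF that, of "snd y" i] by (auto simp: tree_adj_def)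
  then show "cnj (\<Sum>i<n. X i (fst y) (fst (a, w)) * tree_adj i (snd y) (snd (a, w))) * g y =
      (\<Sum>i<n. cnj (X i (fst y) (fst (a, w))) * tree_adj i (snd (a, w)) (snd y)) * g y"
    by simp
qed

lemma amp_perm_adjoint:
  assumes "\<And>i t. i < n \<Longrightarrow> t < N \<Longrightarrow> \<pi> i (\<pi> i t) = t" "t < N"
  shows "mv ({..<k} \<times> {..<N}) (\<lambda>y x. cnj (amp n X (perm_adj \<pi>) x y)) g (a, t) =
    mv ({..<k} \<times> {..<N}) (amp n (\<lambda>i a b. cnj (X i b a)) (perm_adj \<pi>)) g (a, t)"
  unfolding mv_def amp_def
proof (intro sum.cong refl)
  fix y assume y: "y \<in> {..<k} \<times> {..<N}"
  have "perm_adj \<pi> i t (snd y) = cnj (perm_adj \<pi> i (snd y) t)" if "i < n" for i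
    using assms(1)[OF that] assms(2) y by (auto simp: perm_adj_def)
  then show "cnj (\<Sum>i<n. X i (fst y) (fst (a, t)) * perm_adj \<pi> i (snd y) (snd (a, t))) * g y =
      (\<Sum>i<n. cnj (X i (fst y) (fst (a, t))) * perm_adj \<pi> i (snd (a, t)) (snd y)) * g y"
    by simp
qed

text \<open>
  The involutions \<open>tree_perm i\<close> of the finite tree act on its permutation group by left
  multiplication, and seen from any permutation \<open>\<gamma>\<close> this action looks like the tree: transporting
  a function on words along \<open>w \<mapsto> tree_act w \<circ> \<gamma>\<close> intertwines the two amplified operators as long
  as the support stays away from the longest words.
\<close>

lemma permutation_model:
  fixes n L :: nat
  shows "\<exists>N \<pi>. N > 0 \<and> (\<forall>i t. t < N \<longrightarrow> \<pi> i t < N \<and> \<pi> i (\<pi> i t) = t) \<and>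
    (\<forall>k X c p x. op_sq_bound ({..<k} \<times> rwords n L) ({..<k} \<times> rwords n L) (amp n X tree_adj) c \<longrightarrow>
       c \<ge> 0 \<longrightarrow> 2 * p \<le> L \<longrightarrow> x \<in> {..<k} \<times> {..<N} \<longrightarrow>
       (\<Sum>y\<in>{..<k} \<times> {..<N}. (cmod ((gram_map ({..<k} \<times> {..<N}) (amp n X (perm_adj \<pi>)) ^^ p)
          (\<lambda>y. if y = x then 1 else 0) y))\<^sup>2) \<le> c ^ (2 * p))"
proof -
  let ?W = "rwords n L"
  let ?\<sigma> = "tree_perm n L"
  define V where "V = {p. p permutes ?W}"
  have finV: "finite V" unfolding V_def by (rule finite_permutations[OF finite_rwords])
  define N where "N = card V"
  have "id \<in> V" by (simp add: V_def permutes_id)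
  then have N: "N > 0" using finV by (auto simp: N_def card_gt_0_iff)
  obtain f where f: "bij_betw f {..<N} V"
    using ex_bij_betw_nat_finite[OF finV] by (auto simp: N_def atLeast0LessThan)
  have inj: "inj_on f {..<N}" and fV: "\<And>t. t < N \<Longrightarrow> f t permutes ?W"
    using f by (auto simp: bij_betw_def V_def)
  have "\<exists>s<N. f s = ?\<sigma> i \<circ> f t" if "t < N" for i t
  proof -
    have "?\<sigma> i \<circ> f t \<in> V"
      using permutes_compose[OF fV[OF that] tree_perm_permutes] by (simp add: V_def)
    then show ?thesis using f by (auto simp: bij_betw_def)
  qed
  then have "\<forall>i t. \<exists>s. t < N \<longrightarrow> s < N \<and> f s = ?\<sigma> i \<circ> f t"
    by blast
  then obtain \<pi> where \<pi>: "\<And>i t. t < N \<Longrightarrow> \<pi> i t < N" "\<And>i t. t < N \<Longrightarrow> f (\<pi> i t) = ?\<sigma> i \<circ> f t"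
    unfolding choice_iff by blast
  have inv: "\<pi> i (\<pi> i t) = t" if "t < N" for i t
  proof -
    have "f (\<pi> i (\<pi> i t)) = f t"
      using \<pi> that by (auto simp: fun_eq_iff tree_perm_tree_perm)
    then show ?thesis using inj \<pi>(1) that by (simp add: inj_on_eq_iff)
  qed
  have bound: "(\<Sum>y\<in>{..<k} \<times> {..<N}. (cmod ((gram_map ({..<k} \<times> {..<N}) (amp n X (perm_adj \<pi>)) ^^ p)
          (\<lambda>y. if y = x then 1 else 0) y))\<^sup>2) \<le> c ^ (2 * p)"
    if A: "op_sq_bound ({..<k} \<times> ?W) ({..<k} \<times> ?W) (amp n X tree_adj) c"
      and c: "c \<ge> 0" and p: "2 * p \<le> L" and x: "x \<in> {..<k} \<times> {..<N}" for k X c p x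
  proof -
    obtain a0 t0 where x_eq: "x = (a0, t0)" and a0: "a0 < k" and t0: "t0 < N" using x by auto
    \<comment> \<open>The point sent to the root by the base permutation. A permutation reached from
      the base along a reduced word of the ball takes this point to that very word, so the word can
      be read off.\<close>
    define r where "r = inv_into UNIV (f t0) []"
    have r: "f t0 r = []"
      unfolding r_def using permutes_surj[OF fV[OF t0]] by (simp add: surj_f_inv_f)
    have "r \<in> ?W"
      using permutes_in_image[OF fV[OF t0], of r] r Nil_in_rwords by simp
    then have ftr: "f t r \<in> ?W" if "t < N" for t
      using permutes_in_image[OF fV[OF that]] by simp
    \<comment> \<open>Values are transported only to permutations that really arise from the base
      along the word they read off.\<close>
    define \<Phi> where "\<Phi> z y = (if f (snd y) = tree_act n L (f (snd y) r) \<circ> f t0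
        then z (fst y, f (snd y) r) else 0)" for z :: "nat \<times> nat list \<Rightarrow> complex" and y :: "nat \<times> nat"
    let ?IV = "{..<k} \<times> {..<N}" and ?IW = "{..<k} \<times> ?W"
    \<comment> \<open>The length bound \<open>j\<close> grows by one with each application of the
      amplified operator or its adjoint, hence \<open>2 * p\<close> applications stay within words
      of length \<open>L\<close>.\<close>
    define supp where "supp j z \<longleftrightarrow> (\<forall>b w. length w > j \<longrightarrow> z (b, w) = 0)"
      for j and z :: "nat \<times> nat list \<Rightarrow> complex"
    have supp_mv: "supp (Suc j) (mv ?IW (amp n Y tree_adj) z)" if "supp j z" for j z Y
      unfolding supp_def
    proof (intro allI impI)
      fix b w assume "length (w :: nat list) > Suc j"
      then have "length (flip i w) > j" for i
        using length_flip_ge[of w i] by linarith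
      then show "mv ?IW (amp n Y tree_adj) z (b, w) = 0"
        using that unfolding mv_amp_tree supp_def by (intro sum.neutral ballI) simp
    qed
    have step: "mv ?IV (amp n Y (perm_adj \<pi>)) (\<Phi> z) y = \<Phi> (mv ?IW (amp n Y tree_adj) z) y"
      if z: "supp j z" "j < L" and y: "y \<in> ?IV" for Y z j y
    proof -
      obtain a t where y_eq: "y = (a, t)" and t: "t < N" using y by auto
      have "\<Phi> z (b, \<pi> i t) = (if f t = tree_act n L (f t r) \<circ> f t0 then
          (if flip i (f t r) \<in> ?W then z (b, flip i (f t r)) else 0) else 0)" if "i < n" for i b
      proof (cases "flip i (f t r) \<in> ?W")
        case True
        then have s: "?\<sigma> i (f t r) = flip i (f t r)"
          using ftr[OF t] by (simp add: tree_perm_def)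
        have "?\<sigma> i \<circ> f t = ?\<sigma> i \<circ> (tree_act n L (f t r) \<circ> f t0) \<longleftrightarrow> f t = tree_act n L (f t r) \<circ> f t0"
          by (simp add: fun_eq_iff inj_eq[OF permutes_inj[OF tree_perm_permutes]])
        then show ?thesis
          using True by (simp add: \<Phi>_def \<pi>(2)[OF t] s tree_act_flip o_assoc)
      next
        \<comment> \<open>Here \<open>tree_perm\<close> fixes the word, whereas the tree has no such
          edge inside the ball. The word has maximal length and lies beyond the support of
          \<open>z\<close>, so both contributions vanish.\<close>
        case False
        then have s: "?\<sigma> i (f t r) = f t r" by (simp add: tree_perm_def)
        have "\<not> length (f t r) < L"
          using False flip_in_rwords[OF ftr[OF t] that] by blast
        then have "z (b, f t r) = 0" using z by (simp add: supp_def)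
        moreover have "f (\<pi> i t) r = f t r" by (simp add: \<pi>(2)[OF t] s)
        ultimately have "\<Phi> z (b, \<pi> i t) = 0"
          unfolding \<Phi>_def fst_conv snd_conv by (simp only: if_cancel)
        then show ?thesis using False by simp
      qed
      then show ?thesis
        using \<pi>(1)[OF t] unfolding y_eq by (simp add: mv_amp_perm mv_amp_tree \<Phi>_def[of _ "(a, t)"])
    qed
    define z where "z p = (gram_map ?IW (amp n X tree_adj) ^^ p) (\<lambda>y. if y = (a0, []) then 1 else 0)" for p
    define v where "v p = (gram_map ?IV (amp n X (perm_adj \<pi>)) ^^ p) (\<lambda>y. if y = x then 1 else 0)" for p
    have ind: "2 * p \<le> L \<Longrightarrow> supp (2 * p) (z p) \<and> (\<forall>y\<in>?IV. v p y = \<Phi> (z p) y)" for p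
    proof (induction p)
      case 0
      have "(if y = x then 1 else 0) = \<Phi> (\<lambda>y. if y = (a0, []) then 1 else 0) y" if "y \<in> ?IV" for y
      proof -
        have "f (snd y) = f t0 \<longleftrightarrow> snd y = t0"
          using that inj t0 by (auto simp: inj_on_eq_iff)
        then show ?thesis
          using r by (auto simp: \<Phi>_def x_eq prod_eq_iff)
      qed
      then show ?case by (simp add: z_def v_def supp_def)
    next
      case (Suc p)
      let ?Xs = "\<lambda>i a b. cnj (X i b a)"
      define z1 where "z1 = mv ?IW (amp n ?Xs tree_adj) (z p)"
      define v1 where "v1 = mv ?IV (amp n ?Xs (perm_adj \<pi>)) (v p)"
      have IH: "supp (2 * p) (z p)" "\<And>y. y \<in> ?IV \<Longrightarrow> v p y = \<Phi> (z p) y"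
        using Suc by auto
      have zS: "z (Suc p) = mv ?IW (amp n X tree_adj) z1"
        unfolding z_def funpow.simps o_apply gram_map_def z1_def
        by (rule mv_cong) (auto simp: amp_tree_adjoint)
      have vS: "v (Suc p) = mv ?IV (amp n X (perm_adj \<pi>)) v1"
        unfolding v_def funpow.simps o_apply gram_map_def v1_def
        by (rule mv_cong) (auto simp: amp_perm_adjoint inv)
      have s1: "supp (Suc (2 * p)) z1"
        unfolding z1_def by (rule supp_mv[OF IH(1)])
      have "v1 = mv ?IV (amp n ?Xs (perm_adj \<pi>)) (\<Phi> (z p))"
        unfolding v1_def by (rule mv_cong) (rule IH(2))
      then have "v1 y = \<Phi> z1 y" if "y \<in> ?IV" for y
        unfolding z1_def using step[OF IH(1) _ that] Suc.prems by simp
      then have "v (Suc p) = mv ?IV (amp n X (perm_adj \<pi>)) (\<Phi> z1)"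
        unfolding vS by (rule mv_cong)
      then have "v (Suc p) y = \<Phi> (z (Suc p)) y" if "y \<in> ?IV" for y
        unfolding zS using step[OF s1 _ that] Suc.prems by simp
      moreover have "supp (2 * Suc p) (z (Suc p))"
        unfolding zS using supp_mv[OF s1] by simp
      ultimately show ?case by blast
    qed
    have "(\<Sum>y\<in>?IV. (cmod (v p y))\<^sup>2) = (\<Sum>y\<in>?IV. (cmod (\<Phi> (z p) y))\<^sup>2)"
      by (rule sum.cong) (use ind[OF p] in auto)
    also have "\<dots> = (\<Sum>y\<in>{y\<in>?IV. f (snd y) = tree_act n L (f (snd y) r) \<circ> f t0}.
        (cmod (z p (fst y, f (snd y) r)))\<^sup>2)"
      by (rule sum.mono_neutral_cong_right) (auto simp: \<Phi>_def)
    also have "\<dots> = (\<Sum>y\<in>(\<lambda>y. (fst y, f (snd y) r)) `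
        {y\<in>?IV. f (snd y) = tree_act n L (f (snd y) r) \<circ> f t0}. (cmod (z p y))\<^sup>2)"
    proof (rule sum.reindex_cong[OF _ refl refl, symmetric])
      \<comment> \<open>Different permutations that carry mass read off different words, so the
        transport does not increase the norm.\<close>
      show "inj_on (\<lambda>y. (fst y, f (snd y) r)) {y\<in>?IV. f (snd y) = tree_act n L (f (snd y) r) \<circ> f t0}"
      proof (rule inj_onI)
        fix y y' assume y: "y \<in> {y\<in>?IV. f (snd y) = tree_act n L (f (snd y) r) \<circ> f t0}"
          "y' \<in> {y\<in>?IV. f (snd y) = tree_act n L (f (snd y) r) \<circ> f t0}"
          and eq: "(fst y, f (snd y) r) = (fst y', f (snd y') r)"
        then have "f (snd y) = f (snd y')" by (metis (mono_tags, lifting) mem_Collect_eq prod.inject)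
        then have "snd y = snd y'" using y inj by (auto simp: inj_on_eq_iff)
        then show "y = y'" using eq by (simp add: prod_eq_iff)
      qed
    qed
    also have "\<dots> \<le> (\<Sum>y\<in>?IW. (cmod (z p y))\<^sup>2)"
      by (rule sum_mono2) (auto simp: finite_rwords ftr)
    also have "\<dots> \<le> c ^ (2 * p) * (\<Sum>y\<in>?IW. (cmod (if y = (a0, []) then 1 else 0))\<^sup>2)"
      unfolding z_def by (rule gram_map_pow_bound[OF A c])
    also have "(\<Sum>y\<in>?IW. (cmod (if y = (a0, []) then 1 else 0))\<^sup>2) = (\<Sum>y\<in>?IW. if y = (a0, []) then 1 else 0)"
      by (intro sum.cong) auto
    also have "\<dots> = (1 :: real)"
      using a0 Nil_in_rwords by (simp add: finite_rwords)
    finally show ?thesis by (simp add: v_def)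
  qed
  show ?thesis
    using N \<pi>(1) inv bound by (intro exI[of _ N] exI[of _ \<pi>]) blast
qed


section \<open>Removal of a small subspace\<close>

definition ip :: "'x set \<Rightarrow> ('x \<Rightarrow> complex) \<Rightarrow> ('x \<Rightarrow> complex) \<Rightarrow> complex" where
  "ip I u v = (\<Sum>x\<in>I. cnj (u x) * v x)"

definition sqn :: "'x set \<Rightarrow> ('x \<Rightarrow> complex) \<Rightarrow> real" where
  "sqn I u = (\<Sum>x\<in>I. (cmod (u x))\<^sup>2)"

lemma sqn_nonneg: "sqn I u \<ge> 0"
  by (simp add: sqn_def sum_nonneg)

lemma ip_self: "ip I u u = of_real (sqn I u)"
  by (simp add: ip_def sqn_def complex_norm_square mult.commute del: of_real_power)

lemma ip_cnj: "ip I u v = cnj (ip I v u)"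
  by (simp add: ip_def mult.commute)

lemma ip_Cauchy_Schwarz: "(cmod (ip I u v))\<^sup>2 \<le> sqn I u * sqn I v"
  using cmod_sum_mult_sq_le[of "\<lambda>x. cnj (u x)" v I] by (simp add: ip_def sqn_def)

lemma ip_mv: "ip I (mv I A u) v = ip I u (mv I (\<lambda>y x. cnj (A x y)) v)"
proof -
  have "ip I (mv I A u) v = (\<Sum>x\<in>I. \<Sum>y\<in>I. cnj (A x y) * cnj (u y) * v x)"
    by (simp add: ip_def mv_def sum_distrib_right)
  also have "\<dots> = (\<Sum>y\<in>I. \<Sum>x\<in>I. cnj (A x y) * cnj (u y) * v x)"
    by (rule sum.swap)
  also have "\<dots> = ip I u (mv I (\<lambda>y x. cnj (A x y)) v)"
    by (simp add: ip_def mv_def sum_distrib_left mult_ac)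
  finally show ?thesis .
qed

lemma ip_gram_map: "ip I (gram_map I A u) v = ip I u (gram_map I A v)"
  unfolding gram_map_def ip_mv by simp

lemma sqn_mv_adjoint: "of_real (sqn I (mv I (\<lambda>y x. cnj (A x y)) u)) = ip I u (gram_map I A u)"
  unfolding gram_map_def ip_self[symmetric] ip_mv by simp

lemma ip_gram_map_pow: "ip I ((gram_map I A ^^ p) u) v = ip I u ((gram_map I A ^^ p) v)"
proof (induction p arbitrary: v)
  case (Suc p)
  have "(gram_map I A ^^ Suc p) v = (gram_map I A ^^ p) (gram_map I A v)"
    by (simp add: funpow_swap1)
  then show ?case using Suc.IH[of "gram_map I A v"] by (simp add: ip_gram_map)
qed simp

text \<open>Write G for \<open>gram_map I A\<close>. The square norm of G^P u is the inner product
  of u with G^(2P) u, hence at most the norm of the latter. Iterating this doubling replaces the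
  spectral theorem and is the reason for exponents that are powers of two.\<close>

lemma gram_map_pow_ge:
  assumes u: "sqn I u = 1" and c: "c \<ge> 0" and ge: "sqn I (mv I (\<lambda>y x. cnj (A x y)) u) \<ge> c"
  shows "sqn I ((gram_map I A ^^ (2 ^ j)) u) \<ge> c ^ (2 * 2 ^ j)"
proof (induction j)
  case 0
  have "cmod (ip I u (gram_map I A u)) \<ge> c"
    unfolding sqn_mv_adjoint[symmetric] using ge by simp
  then have "c\<^sup>2 \<le> (cmod (ip I u (gram_map I A u)))\<^sup>2"
    using c by (intro power_mono)
  then show ?case
    using ip_Cauchy_Schwarz[of I u "gram_map I A u"] u by simp
next
  case (Suc j)
  let ?P = "2 ^ j :: nat"
  define w where "w = (gram_map I A ^^ ?P) u"
  have "of_real (sqn I w) = ip I u ((gram_map I A ^^ ?P) w)"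
    unfolding ip_self[symmetric] by (subst w_def) (simp add: ip_gram_map_pow)
  also have "(gram_map I A ^^ ?P) w = (gram_map I A ^^ (2 ^ Suc j)) u"
    by (simp add: w_def mult_2 funpow_add)
  finally have "(sqn I w)\<^sup>2 = (cmod (ip I u ((gram_map I A ^^ (2 ^ Suc j)) u)))\<^sup>2"
    by (metis norm_of_real power2_abs)
  also have "\<dots> \<le> sqn I ((gram_map I A ^^ (2 ^ Suc j)) u)"
    using ip_Cauchy_Schwarz[of I u "(gram_map I A ^^ (2 ^ Suc j)) u"] u by simp
  finally have "(sqn I w)\<^sup>2 \<le> sqn I ((gram_map I A ^^ (2 ^ Suc j)) u)" .
  moreover have "(c ^ (2 * ?P))\<^sup>2 \<le> (sqn I w)\<^sup>2"
    using Suc.IH c by (intro power_mono) (auto simp: w_def)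
  ultimately show ?case
    by (simp add: power_mult[symmetric] mult_ac)
qed

lemma ip_Bessel:
  fixes u :: "nat \<Rightarrow> 'x \<Rightarrow> complex"
  assumes on: "\<And>j l. j < m \<Longrightarrow> l < m \<Longrightarrow> ip I (u j) (u l) = (if j = l then 1 else 0)"
  shows "(\<Sum>j<m. (cmod (ip I (u j) v))\<^sup>2) \<le> sqn I v"
proof -
  define b where "b j = ip I (u j) v" for j
  define w where "w x = (\<Sum>j<m. b j * u j x)" for x
  define B where "B = (\<Sum>j<m. (cmod (b j))\<^sup>2)"
  have B0: "B \<ge> 0" by (simp add: B_def sum_nonneg)
  have left: "ip I w g = (\<Sum>j<m. cnj (b j) * ip I (u j) g)" for g
  proof -
    have "ip I w g = (\<Sum>x\<in>I. \<Sum>j<m. cnj (b j) * (cnj (u j x) * g x))"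
      by (simp add: ip_def w_def sum_distrib_right mult.assoc)
    also have "\<dots> = (\<Sum>j<m. \<Sum>x\<in>I. cnj (b j) * (cnj (u j x) * g x))"
      by (rule sum.swap)
    finally show ?thesis by (simp add: ip_def sum_distrib_left)
  qed
  have "ip I (u l) w = b l" if "l < m" for l
  proof -
    have "ip I (u l) w = cnj (\<Sum>j<m. cnj (b j) * ip I (u j) (u l))"
      using ip_cnj[of I "u l" w] left by simp
    also have "(\<Sum>j<m. cnj (b j) * ip I (u j) (u l)) = (\<Sum>j<m. if j = l then cnj (b j) else 0)"
      using that by (intro sum.cong) (auto simp: on)
    also have "\<dots> = cnj (b l)" using that by simp
    finally show ?thesis by simp
  qed
  then have ww: "ip I w w = of_real B"
    unfolding left B_def by (simp add: complex_norm_square mult.commute del: of_real_power)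
  have wv: "ip I w v = of_real B"
    unfolding left B_def b_def[symmetric] by (simp add: complex_norm_square mult.commute del: of_real_power)
  have "sqn I w = B" using ww unfolding ip_self by simp
  then have "B\<^sup>2 \<le> sqn I v * B"
    using ip_Cauchy_Schwarz[of I w v] wv by (simp add: mult.commute)
  then have "B \<le> sqn I v"
    by (rule le_of_sq_le_mult) (auto simp: B0 sqn_nonneg)
  then show ?thesis by (simp add: B_def b_def)
qed

text \<open>
  The trace of the \<open>2P\<close>-th power of \<open>A A\<^sup>*\<close>, computed in the standard basis, bounds how many
  orthonormal vectors on which \<open>A\<^sup>*\<close> is large there can be.
\<close>

lemma orthonormal_count:
  assumes I: "finite I" and c: "c \<ge> 0"
    and on: "\<And>j l. j < m \<Longrightarrow> l < m \<Longrightarrow> ip I (u j) (u l) = (if j = l then 1 else 0)"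
    and ge: "\<And>j. j < m \<Longrightarrow> sqn I (mv I (\<lambda>y x. cnj (A x y)) (u j)) \<ge> c"
    and D: "\<And>x. x \<in> I \<Longrightarrow> sqn I ((gram_map I A ^^ (2 ^ q)) (\<lambda>y. if y = x then 1 else 0)) \<le> D"
  shows "real m * c ^ (2 * 2 ^ q) \<le> real (card I) * D"
proof -
  let ?G = "gram_map I A ^^ (2 ^ q)"
  have "sqn I (u j) = 1" if "j < m" for j
    using on[OF that that] unfolding ip_self by simp
  then have "(\<Sum>j<m. c ^ (2 * 2 ^ q)) \<le> (\<Sum>j<m. sqn I (?G (u j)))"
    by (intro sum_mono gram_map_pow_ge c ge) auto
  also have "\<dots> = (\<Sum>j<m. \<Sum>x\<in>I. (cmod (ip I (u j) (?G (\<lambda>y. if y = x then 1 else 0))))\<^sup>2)"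
  proof -
    \<comment> \<open>As the power is self-adjoint, its values are inner products with the images of
      the basis vectors; the sum over \<open>j\<close> is then left to Bessel's inequality.\<close>
    have "?G g x = cnj (ip I g (?G (\<lambda>y. if y = x then 1 else 0)))" if "x \<in> I" for g x
    proof -
      have "ip I (?G g) (\<lambda>y. if y = x then 1 else 0) = (\<Sum>y\<in>I. if y = x then cnj (?G g y) else 0)"
        unfolding ip_def by (intro sum.cong) auto
      then have "cnj (?G g x) = ip I (?G g) (\<lambda>y. if y = x then 1 else 0)"
        using I that by simp
      then show ?thesis
        unfolding ip_gram_map_pow by (metis complex_cnj_cnj)
    qed
    then show ?thesis by (simp add: sqn_def)
  qed
  also have "\<dots> = (\<Sum>x\<in>I. \<Sum>j<m. (cmod (ip I (u j) (?G (\<lambda>y. if y = x then 1 else 0))))\<^sup>2)"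
    by (rule sum.swap)
  also have "\<dots> \<le> (\<Sum>x\<in>I. D)"
    by (intro sum_mono order_trans[OF ip_Bessel D] on)
  finally show ?thesis by simp
qed

section \<open>Tuples of finitely supported vectors and the exceptional set\<close>

definition supported :: "nat \<Rightarrow> ell2 set" where
  "supported N = {h. \<forall>t\<ge>N. ell2_nth h t = 0}"

lemma supported_add: "x \<in> supported N \<Longrightarrow> y \<in> supported N \<Longrightarrow> x + y \<in> supported N"
  by (simp add: supported_def ell2_nth_add)

lemma supported_scaleC: "x \<in> supported N \<Longrightarrow> c *\<^sub>C x \<in> supported N"
  by (simp add: supported_def ell2_nth_scaleC)

lemma cinner_supported:
  assumes "x \<in> supported N"
  shows "cinner x y = (\<Sum>t<N. cnj (ell2_nth x t) * ell2_nth y t)"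
  unfolding cinner_ell2_def by (rule suminf_finite) (use assms in \<open>auto simp: supported_def\<close>)

lemma norm_supported_sq:
  assumes "x \<in> supported N"
  shows "(norm x)\<^sup>2 = (\<Sum>t<N. (cmod (ell2_nth x t))\<^sup>2)"
  unfolding norm_ell2_sq by (rule suminf_finite) (use assms in \<open>auto simp: supported_def\<close>)

text \<open>Identifies the tuple \<open>\<xi>\<close> with the tensor \<Sum> e_a \<otimes> \<xi>_a,
  as a function on pairs of indices.\<close>

definition coords :: "(nat \<Rightarrow> ell2) \<Rightarrow> nat \<times> nat \<Rightarrow> complex" where
  "coords \<xi> x = ell2_nth (\<xi> (fst x)) (snd x)"

lemma ip_coords:
  assumes "\<And>a. a < k \<Longrightarrow> \<xi> a \<in> supported N"
  shows "ip ({..<k} \<times> {..<N}) (coords \<xi>) (coords \<eta>) = (\<Sum>a<k. cinner (\<xi> a) (\<eta> a))"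
  unfolding ip_def coords_def sum.cartesian_product'
  by (intro sum.cong refl) (simp add: cinner_supported[OF assms])

lemma sqn_coords:
  assumes "\<And>a. a < k \<Longrightarrow> \<xi> a \<in> supported N"
  shows "sqn ({..<k} \<times> {..<N}) (coords \<xi>) = (\<Sum>a<k. (norm (\<xi> a))\<^sup>2)"
  unfolding sqn_def coords_def sum.cartesian_product'
  by (intro sum.cong refl) (simp add: norm_supported_sq[OF assms])

text \<open>
  A maximal orthonormal family of vectors with \<open>\<parallel>A\<^sup>* \<xi>\<parallel>\<^sup>2 > c\<close>, each new one chosen in the tensor
  product with the orthogonal complement of all the components used so far, leaves a small set
  \<open>F\<close> off which \<open>A\<^sup>*\<close> is bounded.
\<close>

lemma exceptional_subspace:
  fixes A :: "nat \<times> nat \<Rightarrow> nat \<times> nat \<Rightarrow> complex"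
  assumes c: "c > 0" and I: "I = {..<k} \<times> {..<N}"
    and D: "\<And>x. x \<in> I \<Longrightarrow> sqn I ((gram_map I A ^^ (2 ^ q)) (\<lambda>y. if y = x then 1 else 0)) \<le> D"
  shows "\<exists>F m. corthonormal F \<and> F \<subseteq> supported N \<and> card F \<le> k * m \<and>
    real m * c ^ (2 * 2 ^ q) \<le> real (k * N) * D \<and>
    (\<forall>\<xi>. (\<forall>a<k. \<xi> a \<in> supported N \<and> (\<forall>f\<in>F. cinner f (\<xi> a) = 0)) \<longrightarrow>
       sqn I (mv I (\<lambda>y x. cnj (A x y)) (coords \<xi>)) \<le> c * (\<Sum>a<k. (norm (\<xi> a))\<^sup>2))"
proof -
  let ?As = "\<lambda>y x. cnj (A x y)"
  \<comment> \<open>Invariant of the greedy choice: the span of \<open>F\<close> contains all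
    components of the \<open>m\<close> chosen vectors, and each vector accounts for at most
    \<open>k\<close> elements of \<open>F\<close>.\<close>
  define H where "H m F \<xi> \<longleftrightarrow> corthonormal F \<and> F \<subseteq> supported N \<and> card F \<le> k * m \<and>
      (\<forall>j<m. sqn I (mv I ?As (coords (\<xi> j))) \<ge> c \<and>
         (\<forall>a<k. \<xi> j a \<in> supported N \<and> cexpands F (\<xi> j a))) \<and>
      (\<forall>j<m. \<forall>l<m. (\<Sum>a<k. cinner (\<xi> j a) (\<xi> l a)) = (if j = l then 1 else 0))"
    for m F and \<xi> :: "nat \<Rightarrow> nat \<Rightarrow> ell2"
  have count: "real m * c ^ (2 * 2 ^ q) \<le> real (k * N) * D" if "H m F \<xi>" for m F \<xi>
  proof -
    have "real m * c ^ (2 * 2 ^ q) \<le> real (card I) * D"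
    proof (rule orthonormal_count[where u = "\<lambda>j. coords (\<xi> j)"])
      show "ip I (coords (\<xi> j)) (coords (\<xi> l)) = (if j = l then 1 else 0)" if "j < m" "l < m" for j l
        using that \<open>H m F \<xi>\<close> unfolding I by (subst ip_coords) (auto simp: H_def)
    qed (use that c D in \<open>auto simp: H_def I\<close>)
    then show ?thesis by (simp add: I)
  qed
  have H0: "H 0 {} \<xi>" for \<xi>
    by (simp add: H_def corthonormal_def)
  \<comment> \<open>The counting estimate bounds the length of such a family, so a longest one
    exists.\<close>
  define M where "M = nat \<lceil>real (k * N) * D / c ^ (2 * 2 ^ q)\<rceil>"
  have "m \<le> M" if "\<exists>F \<xi>. H m F \<xi>" for m
  proof -
    have "real m \<le> real (k * N) * D / c ^ (2 * 2 ^ q)"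
      using that count c by (auto simp: pos_le_divide_eq)
    then show ?thesis unfolding M_def by linarith
  qed
  moreover define m where "m = (GREATEST m. \<exists>F \<xi>. H m F \<xi>)"
  ultimately have "\<exists>F \<xi>. H m F \<xi>" and max: "\<And>m' F \<xi>. H m' F \<xi> \<Longrightarrow> m' \<le> m"
    using GreatestI_nat[of "\<lambda>m. \<exists>F \<xi>. H m F \<xi>" 0 M] Greatest_le_nat[of "\<lambda>m. \<exists>F \<xi>. H m F \<xi>" _ M] H0
    by blast+
  then obtain F \<xi> where H: "H m F \<xi>" by blast
  have on: "corthonormal F" and FS: "F \<subseteq> supported N" and card: "card F \<le> k * m"
    and \<xi>S: "\<And>j a. j < m \<Longrightarrow> a < k \<Longrightarrow> \<xi> j a \<in> supported N \<and> cexpands F (\<xi> j a)"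
    and \<xi>c: "\<And>j. j < m \<Longrightarrow> sqn I (mv I ?As (coords (\<xi> j))) \<ge> c"
    and \<xi>o: "\<And>j l. j < m \<Longrightarrow> l < m \<Longrightarrow> (\<Sum>a<k. cinner (\<xi> j a) (\<xi> l a)) = (if j = l then 1 else 0)"
    using H unfolding H_def by blast+
  have good: "sqn I (mv I ?As (coords \<eta>)) \<le> c * (\<Sum>a<k. (norm (\<eta> a))\<^sup>2)"
    if \<eta>: "\<And>a. a < k \<Longrightarrow> \<eta> a \<in> supported N" "\<And>a f. a < k \<Longrightarrow> f \<in> F \<Longrightarrow> cinner f (\<eta> a) = 0" for \<eta>
  proof (rule ccontr)
    assume bad: "\<not> ?thesis"
    define r where "r = sqrt (\<Sum>a<k. (norm (\<eta> a))\<^sup>2)"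
    have r2: "r\<^sup>2 = (\<Sum>a<k. (norm (\<eta> a))\<^sup>2)" by (simp add: r_def sum_nonneg)
    have "r \<noteq> 0"
    proof
      assume "r = 0"
      then have "sqn I (coords \<eta>) = 0"
        using r2 unfolding I by (subst sqn_coords) (auto simp: \<eta>)
      then have "coords \<eta> x = 0" if "x \<in> I" for x
        using that by (auto simp: sqn_def sum_nonneg_eq_0_iff I)
      then have "sqn I (mv I ?As (coords \<eta>)) = 0"
        by (simp add: sqn_def mv_def)
      then show False using bad r2 \<open>r = 0\<close> by simp
    qed
    then have r: "r > 0" by (simp add: r_def less_le sum_nonneg)
    define \<zeta> where "\<zeta> a = of_real (1 / r) *\<^sub>C \<eta> a" for a
    have \<zeta>S: "\<zeta> a \<in> supported N" "f \<in> F \<Longrightarrow> cinner f (\<zeta> a) = 0" if "a < k" for a f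
      using \<eta> that by (auto simp: \<zeta>_def supported_scaleC cinner_scaleC_right)
    have "mv I ?As (coords \<zeta>) x = of_real (1 / r) * mv I ?As (coords \<eta>) x" for x
      by (simp add: mv_def coords_def \<zeta>_def ell2_nth_scaleC sum_distrib_left mult_ac)
    then have "sqn I (mv I ?As (coords \<zeta>)) = sqn I (mv I ?As (coords \<eta>)) / r\<^sup>2"
      by (simp add: sqn_def norm_mult norm_divide power_divide sum_divide_distrib)
    then have \<zeta>c: "sqn I (mv I ?As (coords \<zeta>)) \<ge> c"
      using bad r unfolding r2[symmetric] by (simp add: pos_le_divide_eq)
    have \<zeta>1: "(\<Sum>a<k. cinner (\<zeta> a) (\<zeta> a)) = 1"
    proof -
      have "(\<Sum>a<k. (norm (\<zeta> a))\<^sup>2) = (\<Sum>a<k. (norm (\<eta> a))\<^sup>2) / r\<^sup>2"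
        using r by (simp add: \<zeta>_def norm_scaleC norm_divide power_divide sum_divide_distrib)
      then have "(\<Sum>a<k. (norm (\<zeta> a))\<^sup>2) = 1"
        using r by (simp flip: r2)
      then show ?thesis
        by (simp only: cinner_self of_real_sum[symmetric] of_real_1)
    qed
    have "\<exists>F'. corthonormal F' \<and> F \<subseteq> F' \<and> F' \<subseteq> supported N \<and> card F' \<le> card F + length (map \<zeta> [0..<k]) \<and>
        (\<forall>x\<in>set (map \<zeta> [0..<k]). cexpands F' x)"
      using \<zeta>S FS by (intro Gram_Schmidt_extension[OF on]) (auto intro: supported_add supported_scaleC)
    then obtain F' where F': "corthonormal F'" "F \<subseteq> F'" "F' \<subseteq> supported N" "card F' \<le> card F + k"
      "\<And>a. a < k \<Longrightarrow> cexpands F' (\<zeta> a)" by auto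
    define \<xi>' where "\<xi>' j = (if j < m then \<xi> j else \<zeta>)" for j
    \<comment> \<open>The components are orthogonal one by one, which gives orthogonality in the
      tensor product.\<close>
    have cross: "(\<Sum>a<k. cinner (\<zeta> a) (\<xi> j a)) = 0" "(\<Sum>a<k. cinner (\<xi> j a) (\<zeta> a)) = 0" if "j < m" for j
    proof -
      have z: "cinner (\<zeta> a) (\<xi> j a) = 0" if "a < k" for a
        using \<xi>S[OF \<open>j < m\<close> that] \<zeta>S[OF that] by (intro cexpands_orthogonal[of F]) auto
      then show "(\<Sum>a<k. cinner (\<zeta> a) (\<xi> j a)) = 0" by simp
      show "(\<Sum>a<k. cinner (\<xi> j a) (\<zeta> a)) = 0"
        using z by (intro sum.neutral) (auto simp: cinner_eq_zero_commute[of "\<xi> j _"])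
    qed
    have "H (Suc m) F' \<xi>'"
      unfolding H_def
    proof (intro conjI allI impI)
      fix j assume j: "j < Suc m"
      show "sqn I (mv I ?As (coords (\<xi>' j))) \<ge> c"
        using \<xi>c \<zeta>c by (simp add: \<xi>'_def)
      show "\<xi>' j a \<in> supported N" "cexpands F' (\<xi>' j a)" if "a < k" for a
        using \<xi>S[OF _ that] \<zeta>S[OF that] F'(5)[OF that] cexpands_mono[OF F'(1,2)] by (auto simp: \<xi>'_def)
      show "(\<Sum>a<k. cinner (\<xi>' j a) (\<xi>' l a)) = (if j = l then 1 else 0)" if "l < Suc m" for l
        using j that \<xi>o cross \<zeta>1 by (auto simp: \<xi>'_def less_Suc_eq)
    qed (use F' card in auto)
    then show False using max by fastforce
  qed
  show ?thesis
    using on FS card count[OF H] good by (intro exI[of _ F] exI[of _ m]) blast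
qed


section \<open>The transfer inequality\<close>

text \<open>The matrix \<open>q\<close> is the projection onto the complement of \<open>F\<close>
  among the first \<open>N\<close> coordinates. Its square Hilbert-Schmidt norm equals
  \<open>N - card F\<close>; the diagonal entries \<open>1 - \<tau> s\<close> alone already give the
  last estimate, whose factor 2 does no harm.\<close>

lemma projection_matrix:
  assumes F: "corthonormal F" "F \<subseteq> supported N"
  defines "q \<equiv> \<lambda>s t. (if s = t then 1 else 0) - (\<Sum>f\<in>F. ell2_nth f s * cnj (ell2_nth f t))"
  shows "q s t = cnj (q t s)"
    and "s < N \<Longrightarrow> ell2_nth (evec N g - (\<Sum>f\<in>F. cinner f (evec N g) *\<^sub>C f)) s = (\<Sum>t<N. q s t * g t)"
    and "op_sq_bound {..<N} {..<N} q 1"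
    and "(\<Sum>s<N. \<Sum>t<N. (cmod (q s t))\<^sup>2) \<ge> real N - 2 * real (card F)"
proof -
  show "q s t = cnj (q t s)"
    by (auto simp: q_def mult.commute)
  have nth: "ell2_nth (evec N g - (\<Sum>f\<in>F. cinner f (evec N g) *\<^sub>C f)) s = (\<Sum>t<N. q s t * g t)"
    if "s < N" for s g
  proof -
    have "cinner f (evec N g) = (\<Sum>t<N. cnj (ell2_nth f t) * g t)" if "f \<in> F" for f
      using F(2) that by (subst cinner_supported[of _ N]) (auto simp: evec.rep_eq)
    then have "ell2_nth (evec N g - (\<Sum>f\<in>F. cinner f (evec N g) *\<^sub>C f)) s =
        g s - (\<Sum>f\<in>F. (\<Sum>t<N. cnj (ell2_nth f t) * g t) * ell2_nth f s)"
      using that by (simp add: ell2_nth_diff ell2_nth_sum ell2_nth_scaleC evec.rep_eq)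
    also have "(\<Sum>f\<in>F. (\<Sum>t<N. cnj (ell2_nth f t) * g t) * ell2_nth f s) =
        (\<Sum>t<N. (\<Sum>f\<in>F. ell2_nth f s * cnj (ell2_nth f t)) * g t)"
      unfolding sum_distrib_right by (subst sum.swap) (simp add: mult_ac)
    also have "g s = (\<Sum>t<N. (if s = t then 1 else 0) * g t)"
    proof -
      have "(\<Sum>t<N. (if s = t then 1 else 0) * g t) = (\<Sum>t<N. if s = t then g t else 0)"
        by (intro sum.cong) auto
      then show ?thesis using that by simp
    qed
    finally show ?thesis
      by (simp add: q_def left_diff_distrib sum_subtractf)
  qed
  then show "s < N \<Longrightarrow> ell2_nth (evec N g - (\<Sum>f\<in>F. cinner f (evec N g) *\<^sub>C f)) s = (\<Sum>t<N. q s t * g t)" .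
  show "op_sq_bound {..<N} {..<N} q 1"
    unfolding op_sq_bound_def
  proof
    fix g
    let ?h = "evec N g - (\<Sum>f\<in>F. cinner f (evec N g) *\<^sub>C f)"
    have "(\<Sum>s<N. (cmod (\<Sum>t<N. q s t * g t))\<^sup>2) = (\<Sum>s<N. (cmod (ell2_nth ?h s))\<^sup>2)"
      by (simp add: nth)
    also have "\<dots> \<le> (norm ?h)\<^sup>2" by (rule sum_le_norm_ell2)
    also have "\<dots> \<le> (norm (evec N g))\<^sup>2"
      using corthonormal_residual_norm[OF F(1), of "evec N g"] by (simp add: sum_nonneg)
    finally show "(\<Sum>s<N. (cmod (\<Sum>t<N. q s t * g t))\<^sup>2) \<le> 1 * (\<Sum>t<N. (cmod (g t))\<^sup>2)"
      by (simp add: norm_evec_sq)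
  qed
  define \<tau> where "\<tau> s = (\<Sum>f\<in>F. (cmod (ell2_nth f s))\<^sup>2)" for s
  have "(\<Sum>s<N. \<tau> s) = (\<Sum>f\<in>F. \<Sum>s<N. (cmod (ell2_nth f s))\<^sup>2)"
    unfolding \<tau>_def by (rule sum.swap)
  also have "\<dots> = (\<Sum>f\<in>F. 1)"
  proof (rule sum.cong)
    fix f assume "f \<in> F"
    then have "cinner f f = 1" using F(1) by (simp add: corthonormal_def)
    then have "(norm f)\<^sup>2 = 1" unfolding cinner_self by (metis of_real_eq_1_iff)
    then show "(\<Sum>s<N. (cmod (ell2_nth f s))\<^sup>2) = 1"
      using F(2) \<open>f \<in> F\<close> norm_supported_sq by auto
  qed simp
  finally have \<tau>: "(\<Sum>s<N. \<tau> s) = real (card F)" by simp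
  have "1 - 2 * \<tau> s \<le> (\<Sum>t<N. (cmod (q s t))\<^sup>2)" if "s < N" for s
  proof -
    have "q s s = of_real (1 - \<tau> s)"
      by (simp add: q_def \<tau>_def complex_norm_square del: of_real_power)
    then have "(cmod (q s s))\<^sup>2 = (1 - \<tau> s)\<^sup>2"
      by (simp only: norm_of_real power2_abs)
    also have "\<dots> \<ge> 1 - 2 * \<tau> s" by (simp add: power2_diff)
    also have "(cmod (q s s))\<^sup>2 \<le> (\<Sum>t<N. (cmod (q s t))\<^sup>2)"
      using that by (intro member_le_sum) auto
    finally show ?thesis by simp
  qed
  then have "(\<Sum>s<N. 1 - 2 * \<tau> s) \<le> (\<Sum>s<N. \<Sum>t<N. (cmod (q s t))\<^sup>2)"
    by (intro sum_mono) auto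
  then show "(\<Sum>s<N. \<Sum>t<N. (cmod (q s t))\<^sup>2) \<ge> real N - 2 * real (card F)"
    using \<tau> by (simp add: sum_subtractf flip: sum_distrib_left)
qed

text \<open>The removed dimension is at most \<open>k * m\<close>, with
  \<open>m / N \<le> k * (c0 / c) ^ (2 * P)\<close>. As \<open>k\<close> is fixed and
  \<open>c0 < c\<close>, its proportion of \<open>N\<close> tends to zero with growing
  \<open>P\<close>. The hypothesis concerns all \<open>L\<close> because the radius of the ball is
  chosen according to \<open>P\<close>.\<close>

lemma matrix_model:
  assumes c0: "c0 \<ge> 0" and c: "c > c0" and \<epsilon>: "\<epsilon> > 0"
    and tree: "\<And>L. op_sq_bound ({..<k} \<times> rwords n L) ({..<k} \<times> rwords n L) (amp n X tree_adj) c0"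
  shows "\<exists>N \<alpha>. N > 0 \<and> op_sq_bound ({..<k} \<times> {..<N}) ({..<k} \<times> {..<N}) (amp n X \<alpha>) c \<and>
    (\<forall>i<n. op_sq_bound {..<N} {..<N} (\<alpha> i) 1) \<and>
    (\<Sum>i<n. \<Sum>s<N. \<Sum>t<N. (cmod (\<alpha> i s t))\<^sup>2) \<ge> real n * real N * (1 - \<epsilon>)"
proof -
  have ratio: "0 \<le> c0 / c" "c0 / c < 1" using c0 c by auto
  \<comment> \<open>The denominator reflects two factors \<open>k\<close> and the factor 2 of the
    Hilbert-Schmidt estimate; adding 1 covers \<open>k = 0\<close>.\<close>
  have "\<epsilon> / (2 * (real k)\<^sup>2 + 1) > 0" using \<epsilon> by (simp add: add_nonneg_pos)
  then obtain j where j: "(c0 / c) ^ j < \<epsilon> / (2 * (real k)\<^sup>2 + 1)"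
    using real_arch_pow_inv ratio(2) by blast
  \<comment> \<open>Counting works with exponents that are powers of two, and
    \<open>2 ^ j > j\<close> is large enough.\<close>
  define P :: nat where "P = 2 ^ j"
  have "j < P" unfolding P_def by (rule less_exp)
  then have "(c0 / c) ^ (2 * P) \<le> (c0 / c) ^ j"
    using ratio by (intro power_decreasing) auto
  then have "2 * (real k)\<^sup>2 * (c0 / c) ^ (2 * P) \<le> 2 * (real k)\<^sup>2 * (\<epsilon> / (2 * (real k)\<^sup>2 + 1))"
    using j by (intro mult_left_mono) auto
  also have "\<dots> \<le> \<epsilon>"
    using \<epsilon> by (simp add: pos_divide_le_eq add_nonneg_pos)
  finally have small: "2 * (real k)\<^sup>2 * (c0 / c) ^ (2 * P) \<le> \<epsilon>" .
  \<comment> \<open>Radius \<open>2 * P\<close>: the power \<open>P\<close> of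
    \<open>gram_map\<close> consists of \<open>2 * P\<close> applications of the amplified operator
    and its adjoint.\<close>
  obtain N \<pi> where N: "N > 0" and \<pi>01: "\<forall>i t. t < N \<longrightarrow> \<pi> i t < N \<and> \<pi> i (\<pi> i t) = t"
    and mom: "\<forall>k X c p x. op_sq_bound ({..<k} \<times> rwords n (2 * P)) ({..<k} \<times> rwords n (2 * P)) (amp n X tree_adj) c \<longrightarrow>
       c \<ge> 0 \<longrightarrow> 2 * p \<le> 2 * P \<longrightarrow> x \<in> {..<k} \<times> {..<N} \<longrightarrow>
       (\<Sum>y\<in>{..<k} \<times> {..<N}. (cmod ((gram_map ({..<k} \<times> {..<N}) (amp n X (perm_adj \<pi>)) ^^ p)
          (\<lambda>y. if y = x then 1 else 0) y))\<^sup>2) \<le> c ^ (2 * p)"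
    using permutation_model[of n "2 * P"] by (elim exE conjE) (rule that)
  have \<pi>: "\<pi> i t < N" "\<pi> i (\<pi> i t) = t" if "t < N" for i t
    using \<pi>01 that by auto
  define I where "I = {..<k} \<times> {..<N}"
  let ?T = "amp n X (perm_adj \<pi>)"
  have "sqn I ((gram_map I ?T ^^ (2 ^ j)) (\<lambda>y. if y = x then 1 else 0)) \<le> c0 ^ (2 * P)" if "x \<in> I" for x
    unfolding sqn_def I_def P_def[symmetric] using mom[rule_format, OF tree c0] that by (simp add: I_def)
  from exceptional_subspace[OF _ I_def this, of c] c c0
  obtain F m where F: "corthonormal F" "F \<subseteq> supported N" "card F \<le> k * m"
    and m: "real m * c ^ (2 * P) \<le> real (k * N) * c0 ^ (2 * P)"
    and good: "\<And>\<xi>. (\<And>a. a < k \<Longrightarrow> \<xi> a \<in> supported N) \<Longrightarrow> (\<And>a f. a < k \<Longrightarrow> f \<in> F \<Longrightarrow> cinner f (\<xi> a) = 0) \<Longrightarrow>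
       sqn I (mv I (\<lambda>y x. cnj (?T x y)) (coords \<xi>)) \<le> c * (\<Sum>a<k. (norm (\<xi> a))\<^sup>2)"
    unfolding P_def by (auto simp: order.strict_implies_order)
  define q where "q s t = (if s = t then 1 else 0) - (\<Sum>f\<in>F. ell2_nth f s * cnj (ell2_nth f t))" for s t
  note proj = projection_matrix[OF F(1,2), folded q_def]
  \<comment> \<open>The entries of \<open>q\<close> times the permutation matrix of
    \<open>\<pi> i\<close>, as \<open>\<pi> i\<close> is its own inverse.\<close>
  define \<alpha> where "\<alpha> i s t = q s (\<pi> i t)" for i s t
  have bij: "bij_betw (\<pi> i) {..<N} {..<N}" for i
    by (rule bij_betwI[of _ _ _ "\<pi> i"]) (use \<pi> in auto)
  \<comment> \<open>The adjoint is bounded first because it begins with the projection, which moves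
    every vector into the complement of \<open>F\<close>, where \<open>good\<close> applies.\<close>
  have "op_sq_bound I I (\<lambda>y x. cnj (amp n X \<alpha> x y)) c"
    unfolding op_sq_bound_mv
  proof
    fix h :: "nat \<times> nat \<Rightarrow> complex"
    define \<xi> where "\<xi> a = evec N (\<lambda>s. h (a, s)) - (\<Sum>f\<in>F. cinner f (evec N (\<lambda>s. h (a, s))) *\<^sub>C f)" for a
    have \<xi>S: "\<xi> a \<in> supported N" for a
      using F(2) by (auto simp: supported_def \<xi>_def ell2_nth_diff ell2_nth_sum ell2_nth_scaleC evec.rep_eq
          intro!: sum.neutral)
    have \<xi>nth: "ell2_nth (\<xi> a) t = (\<Sum>s<N. q t s * h (a, s))" if "t < N" for a t
      unfolding \<xi>_def by (rule proj(2)[OF that])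
    have eq: "mv I (\<lambda>y x. cnj (amp n X \<alpha> x y)) h y = mv I (\<lambda>y x. cnj (?T x y)) (coords \<xi>) y" if "y \<in> I" for y
    proof -
      obtain b t where y: "y = (b, t)" and t: "t < N" using \<open>y \<in> I\<close> by (auto simp: I_def)
      have "mv I (\<lambda>y x. cnj (?T x y)) (coords \<xi>) y = (\<Sum>i<n. \<Sum>a<k. cnj (X i a b) * coords \<xi> (a, \<pi> i t))"
        unfolding y I_def using \<pi> t by (subst amp_perm_adjoint) (auto simp: mv_amp_perm)
      also have "\<dots> = (\<Sum>i<n. \<Sum>a<k. \<Sum>s<N. cnj (X i a b) * (cnj (q s (\<pi> i t)) * h (a, s)))"
        using \<pi>(1)[OF t] by (simp add: coords_def \<xi>nth sum_distrib_left proj(1)[of "\<pi> _ t"])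
      also have "\<dots> = (\<Sum>a<k. \<Sum>s<N. \<Sum>i<n. cnj (X i a b) * (cnj (q s (\<pi> i t)) * h (a, s)))"
        by (rule sum_rotate[symmetric])
      also have "\<dots> = mv I (\<lambda>y x. cnj (amp n X \<alpha> x y)) h y"
        unfolding mv_def I_def y
        by (simp add: sum.cartesian_product' amp_def \<alpha>_def sum_distrib_right mult.assoc)
      finally show ?thesis by simp
    qed
    have "(\<Sum>x\<in>I. (cmod (mv I (\<lambda>y x. cnj (amp n X \<alpha> x y)) h x))\<^sup>2) = sqn I (mv I (\<lambda>y x. cnj (?T x y)) (coords \<xi>))"
      unfolding sqn_def by (rule sum.cong) (simp_all add: eq)
    also have "\<dots> \<le> c * (\<Sum>a<k. (norm (\<xi> a))\<^sup>2)"
      by (rule good[OF \<xi>S]) (simp add: \<xi>_def corthonormal_residual[OF F(1)])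
    also have "\<dots> \<le> c * (\<Sum>a<k. (norm (evec N (\<lambda>s. h (a, s))))\<^sup>2)"
    proof (intro mult_left_mono sum_mono)
      fix a
      show "(norm (\<xi> a))\<^sup>2 \<le> (norm (evec N (\<lambda>s. h (a, s))))\<^sup>2"
        unfolding \<xi>_def using corthonormal_residual_norm[OF F(1), of "evec N (\<lambda>s. h (a, s))"]
        by (simp add: sum_nonneg)
    qed (use c c0 in simp)
    also have "(\<Sum>a<k. (norm (evec N (\<lambda>s. h (a, s))))\<^sup>2) = (\<Sum>y\<in>I. (cmod (h y))\<^sup>2)"
      by (simp add: norm_evec_sq I_def sum.cartesian_product')
    finally show "(\<Sum>x\<in>I. (cmod (mv I (\<lambda>y x. cnj (amp n X \<alpha> x y)) h x))\<^sup>2) \<le> c * (\<Sum>y\<in>I. (cmod (h y))\<^sup>2)" .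
  qed
  from op_sq_bound_adjoint[OF this] have 1: "op_sq_bound I I (amp n X \<alpha>) c"
    using c c0 by simp
  have 2: "op_sq_bound {..<N} {..<N} (\<alpha> i) 1" for i
    unfolding op_sq_bound_def
  proof
    fix g :: "nat \<Rightarrow> complex"
    have "(\<Sum>t<N. \<alpha> i s t * g t) = (\<Sum>t<N. q s t * g (\<pi> i t))" for s
      using sum.reindex_bij_betw[OF bij[of i], of "\<lambda>t. q s t * g (\<pi> i t)"] \<pi>
      by (simp add: \<alpha>_def)
    moreover have "(\<Sum>t<N. (cmod (g (\<pi> i t)))\<^sup>2) = (\<Sum>t<N. (cmod (g t))\<^sup>2)"
      by (rule sum.reindex_bij_betw[OF bij])
    ultimately show "(\<Sum>s<N. (cmod (\<Sum>t<N. \<alpha> i s t * g t))\<^sup>2) \<le> 1 * (\<Sum>t<N. (cmod (g t))\<^sup>2)"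
      using proj(3)[unfolded op_sq_bound_def, rule_format, of "\<lambda>t. g (\<pi> i t)"] by simp
  qed
  have "c ^ (2 * P) > 0" using c c0 by simp
  then have "real m \<le> real (k * N) * (c0 / c) ^ (2 * P)"
    using m by (simp add: power_divide pos_le_divide_eq)
  then have "real k * real m \<le> real k * (real (k * N) * (c0 / c) ^ (2 * P))"
    by (rule mult_left_mono) simp
  moreover have "real (card F) \<le> real k * real m"
    using F(3) by (metis of_nat_le_iff of_nat_mult)
  ultimately have "2 * real (card F) \<le> 2 * (real k)\<^sup>2 * (c0 / c) ^ (2 * P) * real N"
    by (simp add: power2_eq_square mult_ac)
  also have "\<dots> \<le> \<epsilon> * real N" using small by (intro mult_right_mono) auto
  finally have card: "2 * real (card F) \<le> \<epsilon> * real N" .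
  have "real N * (1 - \<epsilon>) \<le> (\<Sum>s<N. \<Sum>t<N. (cmod (\<alpha> i s t))\<^sup>2)" for i
  proof -
    have "(\<Sum>t<N. (cmod (\<alpha> i s t))\<^sup>2) = (\<Sum>t<N. (cmod (q s t))\<^sup>2)" for s
      unfolding \<alpha>_def by (rule sum.reindex_bij_betw[OF bij])
    then show ?thesis using proj(4) card by (simp add: algebra_simps)
  qed
  then have "(\<Sum>i<n. real N * (1 - \<epsilon>)) \<le> (\<Sum>i<n. \<Sum>s<N. \<Sum>t<N. (cmod (\<alpha> i s t))\<^sup>2)"
    by (rule sum_mono)
  then show ?thesis
    using N 1 2 unfolding I_def by (intro exI[of _ N] exI[of _ \<alpha>]) (auto simp: mult_ac)
qed

lemma op_sq_bound_reindex:
  assumes m: "bij_betw m I' I" and A: "op_sq_bound I' I' (\<lambda>x y. A (m x) (m y)) c"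
  shows "op_sq_bound I I A c"
  unfolding op_sq_bound_def
proof
  fix g
  have "(\<Sum>y\<in>I. A x y * g y) = (\<Sum>y\<in>I'. A x (m y) * g (m y))" for x
    by (rule sum.reindex_bij_betw[OF m, symmetric])
  moreover have "(\<Sum>x\<in>I. (cmod (\<Sum>y\<in>I'. A x (m y) * g (m y)))\<^sup>2) =
      (\<Sum>x\<in>I'. (cmod (\<Sum>y\<in>I'. A (m x) (m y) * g (m y)))\<^sup>2)"
    by (rule sum.reindex_bij_betw[OF m, symmetric])
  moreover have "(\<Sum>y\<in>I. (cmod (g y))\<^sup>2) = (\<Sum>y\<in>I'. (cmod (g (m y)))\<^sup>2)"
    by (rule sum.reindex_bij_betw[OF m, symmetric])
  ultimately show "(\<Sum>x\<in>I. (cmod (\<Sum>y\<in>I. A x y * g y))\<^sup>2) \<le> c * (\<Sum>y\<in>I. (cmod (g y))\<^sup>2)"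
    using A unfolding op_sq_bound_def by simp
qed

text \<open>The isomorphism and its inverse enter only through the estimates \<open>fwd\<close> and
  \<open>bwd\<close>, where \<open>C1\<close> and \<open>C2\<close> stand for the two completely
  bounded norms.\<close>

lemma transfer_inequality:
  fixes \<theta> :: "nat \<Rightarrow> 'h::complex_hilbert \<Rightarrow>\<^sub>L 'h" and x :: "nat \<Rightarrow> ell2 \<Rightarrow>\<^sub>L ell2"
  assumes n: "n \<ge> 2" and x: "\<And>i. i < n \<Longrightarrow> x i \<in> compact_ops"
    and OH: "\<And>N \<alpha>. mat_norm N (\<lambda>s t. \<Sum>i<n. scale_op (\<alpha> i s t) (\<theta> i)) =
      sqrt (mat_norm N (\<lambda>s t. \<Sum>i<n. scale_op (cnj (\<alpha> i s t)) (matop N (\<alpha> i))))"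
    and C: "C1 \<ge> 0" "C2 \<ge> 0"
    and fwd: "\<And>N \<alpha> \<delta>. N \<ge> 1 \<Longrightarrow> \<delta> > 0 \<Longrightarrow> mat_norm N (\<lambda>s t. \<Sum>i<n. scale_op (\<alpha> i s t) (\<theta> i)) \<le> \<delta> \<Longrightarrow>
      mat_norm N (\<lambda>s t. \<Sum>i<n. scale_op (\<alpha> i s t) (x i)) \<le> C1 * \<delta>"
    and bwd: "\<And>N \<alpha> \<delta>. N \<ge> 1 \<Longrightarrow> \<delta> > 0 \<Longrightarrow> mat_norm N (\<lambda>s t. \<Sum>i<n. scale_op (\<alpha> i s t) (x i)) \<le> \<delta> \<Longrightarrow>
      mat_norm N (\<lambda>s t. \<Sum>i<n. scale_op (\<alpha> i s t) (\<theta> i)) \<le> C2 * \<delta>"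
  shows "sqrt (real n) \<le> C1 * C2 * sqrt (2 * sqrt (real n - 1))"
proof -
  define R where "R = sqrt (2 * sqrt (real n - 1))"
  have R: "R > 0" using n by (simp add: R_def)
  have xb: "x i \<in> bop" if "i < n" for i
    using x[OF that] by (simp add: compact_ops_def)
  let ?X = "\<lambda>i a b. ell2_nth (blinfun_apply (x i) (ebase b)) a"
  have tree: "op_sq_bound ({..<k} \<times> rwords n L) ({..<k} \<times> rwords n L) (amp n ?X tree_adj) ((C1 * R)\<^sup>2)" for k L
  proof -
    define N where "N = card (rwords n L)"
    obtain e where e: "bij_betw e {..<N} (rwords n L)"
      using ex_bij_betw_nat_finite[OF finite_rwords] by (auto simp: N_def atLeast0LessThan)
    have N: "N \<ge> 1"
      using Nil_in_rwords[of n L] finite_rwords[of n L] unfolding N_def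
      by (metis One_nat_def Suc_leI card_gt_0_iff empty_iff)
    have "mat_norm N (\<lambda>s t. \<Sum>i<n. scale_op (tree_adj i (e s) (e t)) (\<theta> i)) \<le> R"
      unfolding OH R_def by (intro real_sqrt_le_mono tree_norm_le[OF n e])
    then have "mat_norm N (\<lambda>s t. \<Sum>i<n. scale_op (tree_adj i (e s) (e t)) (x i)) \<le> C1 * R"
      by (rule fwd[OF N R])
    then have "op_sq_bound ({..<k} \<times> {..<N}) ({..<k} \<times> {..<N})
        (amp n ?X (\<lambda>i s t. tree_adj i (e s) (e t))) ((C1 * R)\<^sup>2)"
      by (intro op_sq_bound_corner xb)
    moreover have "amp n ?X (\<lambda>i s t. tree_adj i (e s) (e t)) =
        (\<lambda>x y. amp n ?X tree_adj (map_prod id e x) (map_prod id e y))"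
      by (simp add: amp_def fun_eq_iff)
    moreover have "bij_betw (map_prod id e) ({..<k} \<times> {..<N}) ({..<k} \<times> rwords n L)"
      using e by (intro bij_betw_map_prod) auto
    ultimately show ?thesis
      using op_sq_bound_reindex by simp
  qed
  \<comment> \<open>The order of choice matters: \<open>\<epsilon>\<close> first, then the
    truncation size \<open>k\<close>, and only then \<open>N\<close>. One \<open>\<epsilon>\<close>
    is the strict gap demanded by \<open>matrix_model\<close>, and \<open>n * \<epsilon>\<close> is
    the cost of truncation.\<close>
  have ineq: "sqrt (real n * (1 - \<epsilon>)) \<le> C2 * (C1 * R + \<epsilon> + real n * \<epsilon>)" if \<epsilon>: "\<epsilon> > 0" for \<epsilon>
  proof -
    have "\<forall>i\<in>{..<n}. \<forall>\<^sub>F k in sequentially. norm (x i - matop k (?X i)) \<le> \<epsilon>"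
      using compact_op_approx[OF x \<epsilon>] by (auto simp: eventually_sequentially)
    then have "\<forall>\<^sub>F k in sequentially. \<forall>i\<in>{..<n}. norm (x i - matop k (?X i)) \<le> \<epsilon>"
      by (simp add: eventually_ball_finite)
    then obtain k where k: "\<And>i. i < n \<Longrightarrow> norm (x i - matop k (?X i)) \<le> \<epsilon>"
      by (auto simp: eventually_sequentially)
    have CR: "0 \<le> C1 * R" using C R by simp
    have "(C1 * R)\<^sup>2 < (C1 * R + \<epsilon>)\<^sup>2"
      using CR \<epsilon> by (intro power_strict_mono) auto
    from matrix_model[OF zero_le_power2 this \<epsilon> tree[of k]]
    obtain N \<alpha> where N: "N > 0"
      and b: "op_sq_bound ({..<k} \<times> {..<N}) ({..<k} \<times> {..<N}) (amp n ?X \<alpha>) ((C1 * R + \<epsilon>)\<^sup>2)"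
      and con: "\<And>i. i < n \<Longrightarrow> op_sq_bound {..<N} {..<N} (\<alpha> i) 1"
      and HS: "(\<Sum>i<n. \<Sum>s<N. \<Sum>t<N. (cmod (\<alpha> i s t))\<^sup>2) \<ge> real n * real N * (1 - \<epsilon>)"
      by auto
    have "mat_norm N (\<lambda>s t. \<Sum>i<n. scale_op (\<alpha> i s t) (x i)) \<le>
        mat_norm N (\<lambda>s t. \<Sum>i<n. scale_op (\<alpha> i s t) (matop k (?X i))) + (\<Sum>i<n. norm (x i - matop k (?X i)))"
      by (rule mat_norm_perturb[OF con xb matop_bop])
    also have "\<dots> \<le> (C1 * R + \<epsilon>) + (\<Sum>i<n. \<epsilon>)"
      using CR \<epsilon> k by (intro add_mono sum_mono mat_norm_matop_le[OF b]) auto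
    finally have le: "mat_norm N (\<lambda>s t. \<Sum>i<n. scale_op (\<alpha> i s t) (x i)) \<le> C1 * R + \<epsilon> + real n * \<epsilon>"
      by simp
    have "real n * (1 - \<epsilon>) \<le> (\<Sum>i<n. \<Sum>s<N. \<Sum>t<N. (cmod (\<alpha> i s t))\<^sup>2) / real N"
      using HS N by (simp add: pos_le_divide_eq mult_ac)
    also have "\<dots> \<le> mat_norm N (\<lambda>s t. \<Sum>i<n. scale_op (cnj (\<alpha> i s t)) (matop N (\<alpha> i)))"
      by (rule mat_norm_conj_ge[OF N])
    finally have "sqrt (real n * (1 - \<epsilon>)) \<le> mat_norm N (\<lambda>s t. \<Sum>i<n. scale_op (\<alpha> i s t) (\<theta> i))"
      unfolding OH by (rule real_sqrt_le_mono)
    also have "\<dots> \<le> C2 * (C1 * R + \<epsilon> + real n * \<epsilon>)"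
    proof (rule bwd[OF _ _ le])
      have "0 < C1 * R + \<epsilon>" using CR \<epsilon> by linarith
      then show "0 < C1 * R + \<epsilon> + real n * \<epsilon>" using \<epsilon> by (simp add: add_pos_nonneg)
    qed (use N in simp)
    finally show ?thesis .
  qed
  have "sqrt (real n * (1 - 0)) \<le> C2 * (C1 * R + 0 + real n * 0)"
  proof (rule tendsto_le[OF trivial_limit_at_right_real[of 0]])
    show "((\<lambda>\<epsilon>. C2 * (C1 * R + \<epsilon> + real n * \<epsilon>)) \<longlongrightarrow> C2 * (C1 * R + 0 + real n * 0)) (at_right 0)"
      by (intro tendsto_intros)
    show "((\<lambda>\<epsilon>. sqrt (real n * (1 - \<epsilon>))) \<longlongrightarrow> sqrt (real n * (1 - 0))) (at_right 0)"
      by (intro tendsto_intros)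
    show "\<forall>\<^sub>F \<epsilon> in at_right 0. sqrt (real n * (1 - \<epsilon>)) \<le> C2 * (C1 * R + \<epsilon> + real n * \<epsilon>)"
      by (rule eventually_at_right_less[THEN eventually_mono]) (rule ineq)
  qed
  then show ?thesis by (simp add: R_def mult_ac)
qed

text \<open>In \<open>ennreal\<close> the product of 0 and \<open>top\<close> is 0, so an infinite
  norm on one side forces an infinite product only once the other norm is known to be
  nonzero.\<close>

lemma cb_norm_nonzero:
  assumes E: "\<And>c T. T \<in> E \<Longrightarrow> scale_op c T \<in> E"
    and u: "\<And>c T. T \<in> E \<Longrightarrow> u (scale_op c T) = scale_op c (u T)"
    and T: "T \<in> E" "u T \<noteq> 0"
  shows "cb_norm E u \<noteq> 0"
proof
  assume "cb_norm E u = 0"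
  then have cb: "cb_norm E u = ennreal 0" by simp
  define \<delta> where "\<delta> = mat_norm 1 (\<lambda>i j. T) + 1"
  have "mat_norm 1 (\<lambda>i j. u T) \<le> 0 * \<delta>"
    by (rule mat_norm_cb_le[OF cb, where x = "\<lambda>_ _. T"])
      (auto simp: \<delta>_def E u T(1) mat_norm_nonneg add_nonneg_pos)
  then have "mat_norm 1 (\<lambda>i j. u T) = 0"
    using mat_norm_nonneg[of 1 "\<lambda>i j. u T"] by simp
  then have "blinfun_apply (u T) h = 0" for h
    using mat_norm_apply[of "\<lambda>_ _. u T" "\<lambda>_. h" 1] by simp
  then have "u T = 0" by (intro blinfun_eqI) simp
  then show False using T by simp
qed

theorem corollary10:
  fixes n :: nat and E :: "('h::complex_hilbert \<Rightarrow>\<^sub>L 'h) set"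
  assumes "n \<ge> 2" and "is_OH n E"
  shows "d_SK E \<ge> ennreal (sqrt (real n / (2 * sqrt (real n - 1))))"
proof -
  obtain \<theta> :: "nat \<Rightarrow> 'h \<Rightarrow>\<^sub>L 'h" where E: "operator_space E"
    and Er: "E = range (\<lambda>c. \<Sum>i<n. scale_op (c i) (\<theta> i))"
    and nrm: "\<And>c. norm (\<Sum>i<n. scale_op (c i) (\<theta> i)) = sqrt (\<Sum>i<n. (cmod (c i))\<^sup>2)"
    and min: "\<And>a :: nat \<Rightarrow> ell2 \<Rightarrow>\<^sub>L ell2. (\<And>i. i < n \<Longrightarrow> a i \<in> bop) \<Longrightarrow>
      min_norm (map (\<lambda>i. (\<theta> i, a i)) [0..<n]) = sqrt (min_norm (map (\<lambda>i. (a i, conj_op (a i))) [0..<n]))"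
    using assms(2) unfolding is_OH_def by blast
  have Eb: "E \<subseteq> bop" and Esub: "subspace E" and Esc: "\<And>c T. T \<in> E \<Longrightarrow> scale_op c T \<in> E"
    using E by (auto simp: operator_space_def)
  have inE: "(\<Sum>i<n. scale_op (c i) (\<theta> i)) \<in> E" for c
    by (simp add: Er)
  have sc0: "scale_op 0 T = 0" for T :: "'h \<Rightarrow>\<^sub>L 'h"
    by (rule blinfun_eqI) (simp add: scale_op.rep_eq)
  have \<theta>E: "\<theta> i \<in> E" if "i < n" for i
  proof -
    have "(\<Sum>j<n. scale_op (if j = i then 1 else 0) (\<theta> j)) = (\<Sum>j<n. if j = i then \<theta> i else 0)"
      by (intro sum.cong) (auto simp: scale_op_one sc0)
    then show ?thesis using inE[of "\<lambda>j. if j = i then 1 else 0"] that by simp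
  qed
  \<comment> \<open>The defining identity of OH is tested on finite matrices only, where both
    minimal norms become matrix norms.\<close>
  have OH: "mat_norm N (\<lambda>s t. \<Sum>i<n. scale_op (\<alpha> i s t) (\<theta> i)) =
      sqrt (mat_norm N (\<lambda>s t. \<Sum>i<n. scale_op (cnj (\<alpha> i s t)) (matop N (\<alpha> i))))" for N \<alpha>
    using min[of "\<lambda>i. matop N (\<alpha> i)"] min_norm_matop[of n \<theta> N \<alpha>] \<theta>E Eb
    by (simp add: matop_bop min_norm_matop_conj subset_iff)
  \<comment> \<open>A nonzero element, which keeps both completely bounded norms away from
    zero.\<close>
  obtain T0 where T0: "T0 \<in> E" "T0 \<noteq> 0"
  proof
    have "norm (\<Sum>i<n. scale_op 1 (\<theta> i)) \<noteq> 0"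
      using assms(1) nrm[of "\<lambda>_. 1"] by simp
    then show "(\<Sum>i<n. scale_op 1 (\<theta> i)) \<noteq> 0" by auto
  qed (rule inE)
  have main: "ennreal (sqrt (real n / (2 * sqrt (real n - 1)))) \<le> cb_norm E u * cb_norm F (inv_into E u)"
    if F: "operator_space F" "F \<subseteq> compact_ops" and iso: "linear_iso E F u"
    for F :: "(ell2 \<Rightarrow>\<^sub>L ell2) set" and u
  proof -
    have bij: "bij_betw u E F" and add: "\<And>S T. S \<in> E \<Longrightarrow> T \<in> E \<Longrightarrow> u (S + T) = u S + u T"
      and hom: "\<And>c T. T \<in> E \<Longrightarrow> u (scale_op c T) = scale_op c (u T)"
      using iso by (auto simp: linear_iso_def)
    have uF: "u T \<in> F" if "T \<in> E" for T
      using bij that by (auto simp: bij_betw_def)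
    have inj: "inj_on u E" using bij by (simp add: bij_betw_def)
    have inv: "inv_into E u (u T) = T" if "T \<in> E" for T
      using inv_into_f_f[OF inj that] .
    have Fu: "\<exists>S\<in>E. T = u S" if "T \<in> F" for T
      using bij that by (auto simp: bij_betw_def)
    have Fsc: "scale_op c T \<in> F" if "T \<in> F" for c T
      using F(1) that by (simp add: operator_space_def)
    have invhom: "inv_into E u (scale_op c T) = scale_op c (inv_into E u T)" if "T \<in> F" for c T
    proof -
      obtain S where S: "S \<in> E" "T = u S" using Fu[OF \<open>T \<in> F\<close>] by blast
      then show ?thesis by (simp add: hom[symmetric] inv Esc)
    qed
    have u0: "u 0 = 0"
    proof -
      have "u (scale_op 0 T0) = scale_op 0 (u T0)" by (rule hom[OF T0(1)])
      moreover have "scale_op 0 (u T0) = 0"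
        by (rule blinfun_eqI) (simp add: scale_op.rep_eq)
      ultimately show ?thesis by (simp add: sc0)
    qed
    have usum: "u (\<Sum>i<m. scale_op (c i) (\<theta> i)) = (\<Sum>i<m. scale_op (c i) (u (\<theta> i)))" if "m \<le> n" for m c
      using that
    proof (induction m)
      case (Suc m)
      have "(\<Sum>i<m. scale_op (c i) (\<theta> i)) \<in> E"
        using Suc.prems by (intro subspace_sum[OF Esub] Esc \<theta>E) auto
      then show ?case using Suc by (simp add: add Esc \<theta>E hom)
    qed (simp add: u0)
    have "u T0 \<noteq> 0"
      using T0 inj u0 subspace_0[OF Esub] by (metis inj_on_eq_iff)
    then have nz1: "cb_norm E u \<noteq> 0"
      by (intro cb_norm_nonzero[where T = T0] Esc hom T0)
    have nz2: "cb_norm F (inv_into E u) \<noteq> 0"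
      by (rule cb_norm_nonzero[where T = "u T0"]) (simp_all add: Fsc invhom uF inv T0)
    show ?thesis
    proof (cases "cb_norm E u = top \<or> cb_norm F (inv_into E u) = top")
      case True
      then have "cb_norm E u * cb_norm F (inv_into E u) = top"
        using nz1 nz2 by (auto simp: ennreal_mult_eq_top_iff)
      then show ?thesis by simp
    next
      case False
      then obtain C1 C2 where C: "C1 \<ge> 0" "C2 \<ge> 0" "cb_norm E u = ennreal C1"
        "cb_norm F (inv_into E u) = ennreal C2"
        by (metis ennreal_cases top_neq_ennreal)
      have "sqrt (real n) \<le> C1 * C2 * sqrt (2 * sqrt (real n - 1))"
      proof (rule transfer_inequality[OF assms(1) _ OH C(1,2), where x = "\<lambda>i. u (\<theta> i)"])
        show "u (\<theta> i) \<in> compact_ops" if "i < n" for i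
          using F(2) uF[OF \<theta>E[OF that]] by blast
      next
        fix N :: nat and \<alpha> :: "nat \<Rightarrow> nat \<Rightarrow> nat \<Rightarrow> complex" and \<delta> :: real
        assume N: "N \<ge> 1" "\<delta> > 0"
        have us: "(\<lambda>s t. \<Sum>i<n. scale_op (\<alpha> i s t) (u (\<theta> i))) = (\<lambda>s t. u (\<Sum>i<n. scale_op (\<alpha> i s t) (\<theta> i)))"
          by (intro ext) (rule usum[symmetric], simp)
        show "mat_norm N (\<lambda>s t. \<Sum>i<n. scale_op (\<alpha> i s t) (u (\<theta> i))) \<le> C1 * \<delta>"
          if "mat_norm N (\<lambda>s t. \<Sum>i<n. scale_op (\<alpha> i s t) (\<theta> i)) \<le> \<delta>"
          unfolding us by (rule mat_norm_cb_le[OF C(3,1) N Esc hom inE that])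
        show "mat_norm N (\<lambda>s t. \<Sum>i<n. scale_op (\<alpha> i s t) (\<theta> i)) \<le> C2 * \<delta>"
          if "mat_norm N (\<lambda>s t. \<Sum>i<n. scale_op (\<alpha> i s t) (u (\<theta> i))) \<le> \<delta>"
          using mat_norm_cb_le[OF C(4,2) N Fsc invhom uF[OF inE] that[unfolded us]]
          by (simp add: inv inE)
      qed
      then have "sqrt (real n) / sqrt (2 * sqrt (real n - 1)) \<le> C1 * C2"
        using assms(1) by (simp add: pos_divide_le_eq)
      then have "sqrt (real n / (2 * sqrt (real n - 1))) \<le> C1 * C2"
        by (simp add: real_sqrt_divide)
      then show ?thesis
        unfolding C ennreal_mult[OF C(1,2), symmetric] by (rule ennreal_leI)
    qed
  qed
  show ?thesis
    unfolding d_SK_def d_cb_def by (intro INF_greatest main) auto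
qed

end
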